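(* Let $a\in(0,\pi)$ and suppose that $\rho(k)=\frac{\sin(ka)}{ka}$ (with $\rho(0)=1$), i.e. $\mu_\rho(dx)=\psi_\rho(x)\,dx$ with $\psi_\rho(x)=\frac{1}{2a}\mathbf{1}_{[-a,a]}(x)$ on $[-\pi,\pi]$. Then $$\lim_{n\to+\infty}\frac{\mathbb{E}[\mathcal{N}(f_n,[0,2\pi])]}{n}=\frac{2\pi-2a}{\pi\sqrt2}+\frac{2a}{\pi\sqrt3}.$$
   Context: Let $\mu_\rho$ be a symmetric probability measure on $[-\pi,\pi]$ (the spectral measure), regarded as a measure on the circle $\mathbb{R}/2\pi\mathbb{Z}$, and let $\rho(k)=\int_{-\pi}^{\pi}e^{-ikx}\,\mu_\rho(dx)$, $k\in\mathbb{Z}$. On a probability space $(\Omega,\mathcal{F},\mathbb{P})$ with expectation $\mathbb{E}$, let $(a_k)_{k\ge1}$ and $(b_k)_{k\ge1}$ be two independent centered stationary Gaussian sequences with $\mathbb{E}[a_ka_\ell]=\mathbb{E}[b_kb_\ell]=\rho(|k-\ell|)$ for $k,\ell\ge1$ (so each variable has variance $\rho(0)=1$). For $n\ge1$ set $f_n(x)=\frac{1}{\sqrt n}\sum_{k=1}^n a_k\cos(kx)+b_k\sin(kx)$. For a function $f$ and an interval $[c,d]$, $\mathcal{N}(f,[c,d])=\#\{t\in[c,d]: f(t)=0\}$. *)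

theory Defs
  imports "HOL-Probability.Probability"
begin

text \<open>
  A symmetric probability measure on \<open>[-\<pi>, \<pi>]\<close> is represented as a Borel probability measure on
  the reals that gives full mass to this interval; it is the spectral measure of the correlation
  function \<open>\<rho>\<close> when the integers \<open>k\<close> satisfy \<open>\<rho>(k) = \<integral> e\<^sup>-\<^sup>i\<^sup>k\<^sup>x \<mu>(dx)\<close>.
\<close>

definition spectral_measure :: "real measure \<Rightarrow> (int \<Rightarrow> real) \<Rightarrow> bool" where
  "spectral_measure \<mu> \<rho> \<longleftrightarrow>
     prob_space \<mu> \<and> sets \<mu> = sets borel \<and>
     emeasure \<mu> {-pi..pi} = 1 \<and>
     distr \<mu> borel uminus = \<mu> \<and>
     (\<forall>k. complex_of_real (\<rho> k) = (CLINT x|\<mu>. exp (- \<i> * of_int k * complex_of_real x)))"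

text \<open>Degenerate (almost surely constant) variables count as Gaussian, with variance 0.\<close>

definition gaussian_variable :: "'a measure \<Rightarrow> ('a \<Rightarrow> real) \<Rightarrow> bool" where
  "gaussian_variable M X \<longleftrightarrow>
     X \<in> borel_measurable M \<and>
     (\<exists>m. (AE \<omega> in M. X \<omega> = m) \<or>
          (\<exists>\<sigma>>0. distributed M lborel X (\<lambda>x. ennreal (normal_density m \<sigma> x))))"

definition gaussian_sequence :: "'a measure \<Rightarrow> (nat \<Rightarrow> 'a \<Rightarrow> real) \<Rightarrow> bool" where
  "gaussian_sequence M X \<longleftrightarrow>
     (\<forall>I c. finite I \<and> I \<subseteq> {1..} \<longrightarrow> gaussian_variable M (\<lambda>\<omega>. \<Sum>k\<in>I. c k * X k \<omega>))"

text \<open>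
  Sequences are indexed by \<open>k \<ge> 1\<close>; the value at index 0 is irrelevant. For a Gaussian sequence,
  stationarity amounts to the covariances depending only on \<open>|k - l|\<close>.
\<close>

definition centered_stationary_gaussian ::
    "'a measure \<Rightarrow> (int \<Rightarrow> real) \<Rightarrow> (nat \<Rightarrow> 'a \<Rightarrow> real) \<Rightarrow> bool" where
  "centered_stationary_gaussian M \<rho> X \<longleftrightarrow>
     gaussian_sequence M X \<and>
     (\<forall>k\<ge>1. (LINT \<omega>|M. X k \<omega>) = 0) \<and>
     (\<forall>k\<ge>1. \<forall>l\<ge>1. (LINT \<omega>|M. X k \<omega> * X l \<omega>) = \<rho> \<bar>int k - int l\<bar>)"

definition independent_sequences ::
    "'a measure \<Rightarrow> (nat \<Rightarrow> 'a \<Rightarrow> real) \<Rightarrow> (nat \<Rightarrow> 'a \<Rightarrow> real) \<Rightarrow> bool" where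
  "independent_sequences M X Y \<longleftrightarrow>
     prob_space.indep_var M
       (Pi\<^sub>M {1..} (\<lambda>_. borel)) (\<lambda>\<omega>. \<lambda>k\<in>{1..}. X k \<omega>)
       (Pi\<^sub>M {1..} (\<lambda>_. borel)) (\<lambda>\<omega>. \<lambda>k\<in>{1..}. Y k \<omega>)"

definition trig_poly ::
    "(nat \<Rightarrow> 'a \<Rightarrow> real) \<Rightarrow> (nat \<Rightarrow> 'a \<Rightarrow> real) \<Rightarrow> nat \<Rightarrow> 'a \<Rightarrow> real \<Rightarrow> real" where
  "trig_poly a b n \<omega> x =
     1 / sqrt (real n) * (\<Sum>k=1..n. a k \<omega> * cos (real k * x) + b k \<omega> * sin (real k * x))"

text \<open>The number of zeros takes the value \<open>\<infinity>\<close> when the zero set is infinite.\<close>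

definition zero_count :: "(real \<Rightarrow> real) \<Rightarrow> real \<Rightarrow> real \<Rightarrow> ennreal" where
  "zero_count f c d = emeasure (count_space UNIV) {t \<in> {c..d}. f t = 0}"

text \<open>
  The correlation function with values \<open>sin (k \<alpha>) / (k \<alpha>)\<close> is that of the uniform density on
  \<open>[-\<alpha>, \<alpha>]\<close>. A measure on the circle is determined by its Fourier coefficients, so prescribing
  this correlation function is the same as prescribing this density.
\<close>

lemma spectral_measure_uniform:
  fixes \<alpha> :: real
  assumes \<alpha>: "0 < \<alpha>" "\<alpha> < pi"
  shows "spectral_measure (density lborel (\<lambda>x. ennreal (1 / (2 * \<alpha>) * indicator {-\<alpha>..\<alpha>} x)))
           (\<lambda>k. if k = 0 then 1 else sin (of_int k * \<alpha>) / (of_int k * \<alpha>))"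
proof -
  define f where "f = (\<lambda>x::real. 1 / (2 * \<alpha>) * indicator {-\<alpha>..\<alpha>} x)"
  let ?D = "density lborel (\<lambda>x. ennreal (f x))"
  have [measurable]: "f \<in> borel_measurable borel" by (simp add: f_def)
  have fnn: "f x \<ge> 0" for x using \<alpha> by (simp add: f_def)
  have total: "emeasure ?D A = 1" if "{-\<alpha>..\<alpha>} \<subseteq> A" "A \<in> sets borel" for A
  proof -
    have "emeasure ?D A = (\<integral>\<^sup>+x. ennreal (f x) * indicator A x \<partial>lborel)"
      using that by (simp add: emeasure_density)
    also have "\<dots> = (\<integral>\<^sup>+x. ennreal (1 / (2 * \<alpha>)) * indicator {-\<alpha>..\<alpha>} x \<partial>lborel)"
      using that by (intro nn_integral_cong) (auto simp: f_def indicator_def)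
    also have "\<dots> = ennreal (1 / (2 * \<alpha>)) * ennreal (2 * \<alpha>)"
      using \<alpha> by (simp add: nn_integral_cmult_indicator)
    also have "\<dots> = 1" using \<alpha> by (simp flip: ennreal_mult)
    finally show ?thesis .
  qed
  have sym: "distr ?D borel uminus = ?D"
  proof (rule measure_eqI)
    fix A assume "A \<in> sets (distr ?D borel uminus)"
    hence A[measurable]: "A \<in> sets borel" by simp
    have "emeasure (distr ?D borel uminus) A = (\<integral>\<^sup>+x. ennreal (f x) * indicator A (- x) \<partial>lborel)"
    proof -
      have m: "uminus -` A \<in> sets borel" if "A \<in> sets borel" for A :: "real set"
        using measurable_sets_borel[of uminus borel A] that by simp
      show ?thesis
        using m[OF A] by (subst emeasure_distr)
          (auto simp: emeasure_density indicator_def intro!: nn_integral_cong)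
    qed
    also have "\<dots> = (\<integral>\<^sup>+x. ennreal (f (-x)) * indicator A x \<partial>lborel)"
      by (subst nn_integral_real_affine[where c="-1" and t=0]) auto
    also have "\<dots> = emeasure ?D A"
      by (auto simp: emeasure_density f_def indicator_def intro!: nn_integral_cong)
    finally show "emeasure (distr ?D borel uminus) A = emeasure ?D A" .
  qed simp
  have four: "complex_of_real (if k = 0 then 1 else sin (of_int k * \<alpha>) / (of_int k * \<alpha>))
      = (CLINT x|?D. exp (- \<i> * of_int k * complex_of_real x))" for k
  proof -
    have "(CLINT x|?D. exp (- \<i> * of_int k * complex_of_real x))
        = (CLINT x|lborel. f x *\<^sub>R exp (- \<i> * of_int k * complex_of_real x))"
      using fnn by (subst integral_density) auto
    also have "\<dots> = (1 / (2*\<alpha>)) *\<^sub>R (CLINT x:{-\<alpha>..\<alpha>}|lborel. exp (- \<i> * of_int k * complex_of_real x))"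
      unfolding set_lebesgue_integral_def integral_scaleR_right[symmetric]
      by (intro Bochner_Integration.integral_cong) (auto simp: f_def)
    also have "\<dots> = complex_of_real (if k = 0 then 1 else sin (of_int k * \<alpha>) / (of_int k * \<alpha>))"
    proof (cases "k = 0")
      case True
      then show ?thesis using \<alpha> by (simp add: set_lebesgue_integral_def scaleR_conv_of_real)
    next
      case False
      let ?F = "\<lambda>x. exp (- \<i> * of_int k * complex_of_real x) / (- \<i> * of_int k)"
      have "(CLINT x:{-\<alpha>..\<alpha>}|lborel. exp (- \<i> * of_int k * complex_of_real x)) = ?F \<alpha> - ?F (-\<alpha>)"
        unfolding set_lebesgue_integral_def
      proof (rule integral_FTC_atLeastAtMost)
        show "(?F has_vector_derivative exp (- \<i> * of_int k * complex_of_real x)) (at x within {-\<alpha>..\<alpha>})" for x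
          using False by (auto intro!: derivative_eq_intros has_vector_derivative_real_field)
      qed (use \<alpha> in \<open>auto intro!: continuous_intros\<close>)
      also have "\<dots> = complex_of_real (2 * sin (of_int k * \<alpha>) / of_int k)"
        using False by (simp add: complex_eq_iff Re_exp Im_exp Re_divide Im_divide field_simps power2_eq_square)
      finally show ?thesis using \<alpha> False by (simp add: scaleR_conv_of_real field_simps)
    qed
    finally show ?thesis by simp
  qed
  show ?thesis
    unfolding spectral_measure_def f_def[symmetric]
    using total[of UNIV] total[of "{-pi..pi}"] \<alpha> sym four
    by (auto intro!: prob_spaceI simp: f_def)
qed

end

theory Submission
  imports Defs
begin

text \<open>
  For a centered Gaussian function \<open>f\<close> with variance \<open>v\<close>, derivative variance \<open>w\<close> and covariance \<open>c\<close> of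
  \<open>f\<close> with \<open>f'\<close>, the Kac-Rice formula gives the density \<open>sqrt (v w - c\<^sup>2) / (\<pi> v)\<close> for the expected
  number of zeros (\<open>expected_zero_count\<close>). When the coefficients have the spectral density
  \<open>1 / (2 \<alpha>)\<close> on \<open>[-\<alpha>, \<alpha>]\<close>, the quantities \<open>v(x)\<close> and \<open>w(x)\<close> of the unnormalised random polynomial
  are averages over the window \<open>[x - \<alpha>, x + \<alpha>]\<close> of \<open>\<bar>D\<bar>\<^sup>2\<close> and \<open>\<bar>D'\<bar>\<^sup>2\<close>, where
  \<open>D(t) = \<Sum>\<^sub>k\<^sub>\<le>\<^sub>n e\<^sup>i\<^sup>k\<^sup>t\<close> is the Dirichlet sum, while \<open>c(x)\<close> telescopes to a multiple of
  \<open>\<bar>D(x + \<alpha>)\<bar>\<^sup>2 - \<bar>D(x - \<alpha>)\<bar>\<^sup>2\<close>, which stays bounded as \<open>n\<close> grows unless an endpoint of the window is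
  a multiple of \<open>2 \<pi>\<close>, and is negligible in the limit.

  If \<open>0\<close> is interior to the window, then the window carries almost the whole mass of both kernels
  over a period, namely \<open>2 \<pi> n\<close> and \<open>2 \<pi> \<Sum>\<^sub>k\<^sub>\<le>\<^sub>n k\<^sup>2\<close>, so \<open>w / (n\<^sup>2 v)\<close> tends to \<open>1 / 3\<close>
  (\<open>zero_density_tendsto_inside\<close>). If the window stays away from \<open>0\<close>, then
  \<open>\<bar>D\<bar>\<^sup>2 = sin\<^sup>2 (n t / 2) / sin\<^sup>2 (t / 2)\<close> averages to \<open>1 / (2 sin\<^sup>2 (t / 2))\<close> whereas
  \<open>\<bar>D'\<bar>\<^sup>2\<close> is close to \<open>n\<^sup>2 / (4 sin\<^sup>2 (t / 2))\<close> without oscillation, and the ratio tends to \<open>1 / 2\<close>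
  (\<open>zero_density_tendsto_outside\<close>). The first case covers a set of length \<open>2 \<alpha>\<close> of the circle, the second
  one the rest. The passage to the limit under the integral needs \<open>w \<le> K n\<^sup>2 v\<close> uniformly in \<open>x\<close>, also where
  an endpoint of the window approaches \<open>0\<close> (\<open>fejer'_integral_le\<close>).

  The Kac-Rice formula itself is obtained by counting sign changes along a fine grid. They are never more
  numerous than the zeros. Conversely the zeros are almost surely simple, so that every finite
  set of them is eventually seen by the grid, and Fatou's lemma applies. The probability that a centered Gaussian pair has
  opposite signs is an explicit arc tangent (\<open>centered_normal_opposite_signs\<close>), and the sum over the
  cells of the grid converges like a Riemann sum. The hypotheses speak only of the laws of linear combinations;
  uncorrelated parts of a Gaussian pair are therefore shown to be independent through characteristic
  functions (\<open>indep_var_if_char_factorizes\<close>).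
\<close>

section \<open>Independence and normal laws through characteristic functions\<close>

text \<open>
  The weight \<open>W\<close> is a change of measure, and the hypothesis says that it leaves the characteristic function
  of \<open>X\<close> unchanged. By uniqueness it leaves the law of \<open>X\<close> unchanged.
\<close>

lemma (in prob_space) weighted_law_eq:
  fixes X W :: "'a \<Rightarrow> real"
  assumes [measurable]: "X \<in> borel_measurable M"
    and W: "integrable M W" "\<And>\<omega>. \<omega> \<in> space M \<Longrightarrow> 0 \<le> W \<omega>" "expectation W = 1"
    and char: "\<And>s. (CLINT \<omega>|M. W \<omega> *\<^sub>R iexp (s * X \<omega>)) = (CLINT \<omega>|M. iexp (s * X \<omega>))"
    and A[measurable]: "A \<in> sets borel"
  shows "expectation (\<lambda>\<omega>. W \<omega> * indicator A (X \<omega>)) = prob {\<omega> \<in> space M. X \<omega> \<in> A}"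
proof -
  have [measurable]: "W \<in> borel_measurable M" using W by simp
  let ?D = "density M (\<lambda>\<omega>. ennreal (W \<omega>))"
  have tot: "emeasure ?D (space M) = 1"
    using W by (subst emeasure_density) (auto simp: nn_integral_eq_integral cong: nn_integral_cong_simp)
  interpret D: prob_space ?D by (rule prob_spaceI) (use tot in simp)
  have W_AE: "AE \<omega> in M. 0 \<le> W \<omega>" using W(2) by auto
  have "distr ?D borel X = distr M borel X"
  proof (rule Levy_uniqueness)
    show "real_distribution (distr ?D borel X)"
      by (rule D.real_distribution_distr) simp
    show "real_distribution (distr M borel X)"
      by (rule real_distribution_distr) simp
    show "char (distr ?D borel X) = char (distr M borel X)"
      using char by (auto simp: fun_eq_iff char_def integral_distr integral_density W_AE)
  qed
  then have "emeasure (distr ?D borel X) A = emeasure (distr M borel X) A" by simp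
  then have "emeasure M {\<omega> \<in> space M. X \<omega> \<in> A} = (\<integral>\<^sup>+\<omega>. ennreal (W \<omega>) * indicator {\<omega> \<in> space M. X \<omega> \<in> A} \<omega> \<partial>M)"
    by (simp add: emeasure_distr emeasure_density vimage_def Int_def conj_commute)
  also have "\<dots> = (\<integral>\<^sup>+\<omega>. ennreal (W \<omega> * indicator A (X \<omega>)) \<partial>M)"
    by (intro nn_integral_cong) (auto simp: indicator_def)
  also have "\<dots> = ennreal (expectation (\<lambda>\<omega>. W \<omega> * indicator A (X \<omega>)))"
    using W(2) by (intro nn_integral_eq_integral Bochner_Integration.integrable_bound[OF W(1)] AE_I2)
      (auto simp: indicator_def)
  finally show ?thesis
    by (simp add: emeasure_eq_measure integral_nonneg_AE W(2))
qed

text \<open>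
  Kac's criterion for independence. Uniqueness of characteristic functions is used only on the line, twice:
  a weight depending on \<open>Z\<close> through a trigonometric function does not affect the law of \<open>X\<close>, and then
  conditioning on \<open>X \<in> A\<close> does not affect the law of \<open>Z\<close>.
\<close>

lemma (in prob_space) indep_var_if_char_factorizes:
  fixes X Z :: "'a \<Rightarrow> real"
  assumes X[measurable]: "X \<in> borel_measurable M" and Z[measurable]: "Z \<in> borel_measurable M"
    and char: "\<And>s t. (CLINT \<omega>|M. iexp (s * X \<omega>) * iexp (t * Z \<omega>))
                = (CLINT \<omega>|M. iexp (s * X \<omega>)) * (CLINT \<omega>|M. iexp (t * Z \<omega>))"
  shows "indep_var borel X borel Z"
proof -
  define \<phi> where "\<phi> = (\<lambda>s. CLINT \<omega>|M. iexp (s * X \<omega>))"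
  have int_iexp: "complex_integrable M (\<lambda>\<omega>. iexp (Y \<omega>))" if [measurable]: "Y \<in> borel_measurable M" for Y :: "'a \<Rightarrow> real"
    by (rule integrable_const_bound[where B=1]) auto
  have int_cexp: "complex_integrable M (\<lambda>\<omega>. iexp (s * X \<omega>) * iexp (t * Z \<omega>))" for s t
    by (rule integrable_const_bound[where B=1]) (auto simp: norm_mult)
  \<comment> \<open>The change of measure uses the weight 2 + h (t Z), normalised, for h = cos and h = sin; the constant 2 keeps it positive.\<close>
  have half: "expectation (\<lambda>\<omega>. h (t * Z \<omega>) * indicator A (X \<omega>))
      = expectation (\<lambda>\<omega>. h (t * Z \<omega>)) * prob {\<omega> \<in> space M. X \<omega> \<in> A}"
    if h: "h = cos \<or> h = sin" and A[measurable]: "A \<in> sets borel" for h t A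
  proof -
    have [measurable]: "h \<in> borel_measurable borel" using h by auto
    have h1: "\<bar>h x\<bar> \<le> 1" for x using h by auto
    have hi: "integrable M (\<lambda>\<omega>. h (t * Z \<omega>))"
      by (rule integrable_const_bound[where B=1]) (auto simp: h1)
    define e where "e = expectation (\<lambda>\<omega>. h (t * Z \<omega>))"
    have "\<bar>e\<bar> \<le> expectation (\<lambda>\<omega>. \<bar>h (t * Z \<omega>)\<bar>)" unfolding e_def by (rule integral_abs_bound)
    also have "\<dots> \<le> expectation (\<lambda>\<omega>. 1)" using hi h1 by (intro integral_mono) auto
    finally have e1: "\<bar>e\<bar> \<le> 1" by (simp add: prob_space)
    obtain c1 c2 :: complex where c: "\<And>x. complex_of_real (h x) = c1 * iexp x + c2 * iexp (- x)"
    proof (cases "h = cos")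
      case True
      show thesis by (rule that[of "1/2" "1/2"]) (simp add: True complex_eq_iff Re_exp Im_exp)
    next
      case False
      then have "h = sin" using h by simp
      then show thesis by (intro that[of "- \<i>/2" "\<i>/2"]) (simp add: complex_eq_iff Re_exp Im_exp)
    qed
    have eh: "complex_of_real e = c1 * (CLINT \<omega>|M. iexp (t * Z \<omega>)) + c2 * (CLINT \<omega>|M. iexp ((- t) * Z \<omega>))"
    proof -
      have "complex_of_real e = (CLINT \<omega>|M. complex_of_real (h (t * Z \<omega>)))" by (simp add: e_def)
      also have "\<dots> = (CLINT \<omega>|M. c1 * iexp (t * Z \<omega>) + c2 * iexp ((-t) * Z \<omega>))"
        by (rule Bochner_Integration.integral_cong) (auto simp: c)
      also have "\<dots> = (CLINT \<omega>|M. c1 * iexp (t * Z \<omega>)) + (CLINT \<omega>|M. c2 * iexp ((-t) * Z \<omega>))"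
        by (intro Bochner_Integration.integral_add integrable_mult_right int_iexp) measurable
      finally show ?thesis by (simp only: integral_mult_right_zero)
    qed
    let ?W = "\<lambda>\<omega>. (2 + h (t * Z \<omega>)) / (2 + e)"
    have "(CLINT \<omega>|M. ?W \<omega> *\<^sub>R iexp (s * X \<omega>)) = \<phi> s" for s
    proof -
      have "(CLINT \<omega>|M. ?W \<omega> *\<^sub>R iexp (s * X \<omega>))
        = (CLINT \<omega>|M. (2 * iexp (s * X \<omega>) + c1 * (iexp (s * X \<omega>) * iexp (t * Z \<omega>))
             + c2 * (iexp (s * X \<omega>) * iexp ((-t) * Z \<omega>))) / complex_of_real (2 + e))"
        by (rule Bochner_Integration.integral_cong) (auto simp: c scaleR_conv_of_real field_simps)
      also have "\<dots> = ((CLINT \<omega>|M. 2 * iexp (s * X \<omega>)) + (CLINT \<omega>|M. c1 * (iexp (s * X \<omega>) * iexp (t * Z \<omega>)))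
             + (CLINT \<omega>|M. c2 * (iexp (s * X \<omega>) * iexp ((-t) * Z \<omega>)))) / complex_of_real (2 + e)"
      proof -
        have i1: "complex_integrable M (\<lambda>\<omega>. 2 * iexp (s * X \<omega>))"
          by (intro integrable_mult_right int_iexp) measurable
        have i2: "complex_integrable M (\<lambda>\<omega>. c * (iexp (s * X \<omega>) * iexp (t * Z \<omega>)))" for c t
          by (intro integrable_mult_right int_cexp)
        show ?thesis
          unfolding integral_divide_zero Bochner_Integration.integral_add[OF Bochner_Integration.integrable_add[OF i1 i2] i2]
            Bochner_Integration.integral_add[OF i1 i2] ..
      qed
      also have "\<dots> = (2 * \<phi> s + c1 * (CLINT \<omega>|M. iexp (s * X \<omega>) * iexp (t * Z \<omega>))
             + c2 * (CLINT \<omega>|M. iexp (s * X \<omega>) * iexp ((-t) * Z \<omega>))) / complex_of_real (2 + e)"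
        by (simp only: integral_mult_right_zero \<phi>_def)
      also have "\<dots> = \<phi> s * (2 + complex_of_real e) / complex_of_real (2 + e)"
        unfolding char eh by (simp add: \<phi>_def algebra_simps)
      also have "2 + complex_of_real e = complex_of_real (2 + e)" by simp
      also have "complex_of_real (2 + e) \<noteq> 0" using e1 by (subst of_real_eq_0_iff) auto
      hence "\<phi> s * complex_of_real (2 + e) / complex_of_real (2 + e) = \<phi> s" by simp
      finally show ?thesis .
    qed
    moreover have "0 \<le> ?W \<omega>" for \<omega> using e1 h1[of "t * Z \<omega>"] by (auto simp: divide_simps)
    moreover have "expectation ?W = 1" using e1 hi by (simp add: e_def[symmetric] prob_space)
    moreover have "integrable M ?W" using hi by simp
    ultimately have "expectation (\<lambda>\<omega>. ?W \<omega> * indicator A (X \<omega>)) = prob {\<omega> \<in> space M. X \<omega> \<in> A}"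
      by (intro weighted_law_eq) (auto simp: \<phi>_def)
    also have "expectation (\<lambda>\<omega>. ?W \<omega> * indicator A (X \<omega>))
        = expectation (\<lambda>\<omega>. (2 * indicator A (X \<omega>) + h (t * Z \<omega>) * indicator A (X \<omega>)) / (2 + e))"
      by (rule Bochner_Integration.integral_cong) (auto simp: field_simps)
    also have "\<dots> = (2 * expectation (\<lambda>\<omega>. indicator A (X \<omega>)) + expectation (\<lambda>\<omega>. h (t * Z \<omega>) * indicator A (X \<omega>))) / (2 + e)"
      unfolding integral_divide_zero
      by (subst Bochner_Integration.integral_add)
        (auto intro!: integrable_const_bound[where B=2] simp: indicator_def order.trans[OF h1])
    also have "expectation (\<lambda>\<omega>. indicator A (X \<omega>)) = prob {\<omega> \<in> space M. X \<omega> \<in> A}"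
    proof -
      have "expectation (\<lambda>\<omega>. indicator A (X \<omega>) :: real) = expectation (indicator {\<omega> \<in> space M. X \<omega> \<in> A})"
        by (rule Bochner_Integration.integral_cong) (auto simp: indicator_def)
      then show ?thesis by simp
    qed
    finally show ?thesis using e1 by (simp add: e_def[symmetric] field_simps)
  qed
  \<comment> \<open>If X \<in> A has positive probability, the normalised indicator of this event serves as the weight for Z.\<close>
  have prod: "prob {\<omega> \<in> space M. X \<omega> \<in> A \<and> Z \<omega> \<in> B}
      = prob {\<omega> \<in> space M. X \<omega> \<in> A} * prob {\<omega> \<in> space M. Z \<omega> \<in> B}"
    if A[measurable]: "A \<in> sets borel" and B[measurable]: "B \<in> sets borel" for A B
  proof (cases "prob {\<omega> \<in> space M. X \<omega> \<in> A} = 0")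
    case True
    have "prob {\<omega> \<in> space M. X \<omega> \<in> A \<and> Z \<omega> \<in> B} \<le> prob {\<omega> \<in> space M. X \<omega> \<in> A}"
      by (rule finite_measure_mono) auto
    then show ?thesis using True measure_nonneg[of M "{\<omega> \<in> space M. X \<omega> \<in> A \<and> Z \<omega> \<in> B}"] by simp
  next
    case False
    define p where "p = prob {\<omega> \<in> space M. X \<omega> \<in> A}"
    have p: "p > 0" using False by (simp add: p_def zero_less_measure_iff)
    let ?W = "\<lambda>\<omega>. indicator A (X \<omega>) / p :: real"
    have ind: "expectation (\<lambda>\<omega>. indicator A' (Y \<omega>) :: real) = prob {\<omega> \<in> space M. Y \<omega> \<in> A'}"
      for A' and Y :: "'a \<Rightarrow> real"
    proof -
      have "expectation (\<lambda>\<omega>. indicator A' (Y \<omega>) :: real) = expectation (indicator {\<omega> \<in> space M. Y \<omega> \<in> A'})"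
        by (rule Bochner_Integration.integral_cong) (auto simp: indicator_def)
      also have "\<dots> = prob ({\<omega> \<in> space M. Y \<omega> \<in> A'} \<inter> space M)" by simp
      also have "{\<omega> \<in> space M. Y \<omega> \<in> A'} \<inter> space M = {\<omega> \<in> space M. Y \<omega> \<in> A'}" by auto
      finally show ?thesis .
    qed
    have "(CLINT \<omega>|M. ?W \<omega> *\<^sub>R iexp (t * Z \<omega>)) = (CLINT \<omega>|M. iexp (t * Z \<omega>))" for t
    proof -
      have iexp_eq: "iexp x = complex_of_real (cos x) + \<i> * complex_of_real (sin x)" for x
        by (simp add: complex_eq_iff Re_exp Im_exp)
      have i1: "integrable M (\<lambda>\<omega>. cos (t * Z \<omega>) * indicator A (X \<omega>))" "integrable M (\<lambda>\<omega>. sin (t * Z \<omega>) * indicator A (X \<omega>))"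
        "integrable M (\<lambda>\<omega>. cos (t * Z \<omega>))" "integrable M (\<lambda>\<omega>. sin (t * Z \<omega>))"
        by (auto intro!: integrable_const_bound[where B=1] simp: indicator_def)
      have "(CLINT \<omega>|M. ?W \<omega> *\<^sub>R iexp (t * Z \<omega>))
        = (CLINT \<omega>|M. (complex_of_real (cos (t * Z \<omega>) * indicator A (X \<omega>)) + \<i> * complex_of_real (sin (t * Z \<omega>) * indicator A (X \<omega>))) / complex_of_real p)"
        by (rule Bochner_Integration.integral_cong)
          (auto simp: iexp_eq scaleR_conv_of_real indicator_def simp del: of_real_mult)
      also have "\<dots> = (complex_of_real (expectation (\<lambda>\<omega>. cos (t * Z \<omega>) * indicator A (X \<omega>)))
          + \<i> * complex_of_real (expectation (\<lambda>\<omega>. sin (t * Z \<omega>) * indicator A (X \<omega>)))) / complex_of_real p"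
        unfolding integral_divide_zero
        using i1 by (subst Bochner_Integration.integral_add) (auto simp del: of_real_mult)
      also have "\<dots> = complex_of_real (expectation (\<lambda>\<omega>. cos (t * Z \<omega>)))
          + \<i> * complex_of_real (expectation (\<lambda>\<omega>. sin (t * Z \<omega>)))"
        using p half[of cos A t] half[of sin A t] by (simp add: p_def[symmetric] field_simps)
      also have "\<dots> = (CLINT \<omega>|M. complex_of_real (cos (t * Z \<omega>)) + \<i> * complex_of_real (sin (t * Z \<omega>)))"
        using i1 by (subst Bochner_Integration.integral_add) (auto simp del: of_real_mult)
      finally show ?thesis by (simp add: iexp_eq del: of_real_mult)
    qed
    moreover have "integrable M ?W" by (rule integrable_const_bound[where B="1/p"]) (use p in \<open>auto simp: indicator_def\<close>)
    moreover have "expectation ?W = 1" using ind[of A X] p by (simp add: p_def)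
    ultimately have "expectation (\<lambda>\<omega>. ?W \<omega> * indicator B (Z \<omega>)) = prob {\<omega> \<in> space M. Z \<omega> \<in> B}"
      using p by (intro weighted_law_eq) auto
    also have "expectation (\<lambda>\<omega>. ?W \<omega> * indicator B (Z \<omega>)) = expectation (\<lambda>\<omega>. indicator {\<omega> \<in> space M. X \<omega> \<in> A \<and> Z \<omega> \<in> B} \<omega> / p)"
      by (rule Bochner_Integration.integral_cong) (auto simp: indicator_def)
    also have "\<dots> = prob {\<omega> \<in> space M. X \<omega> \<in> A \<and> Z \<omega> \<in> B} / p" by simp
    finally show ?thesis using p by (simp add: p_def field_simps)
  qed
  interpret DX: prob_space "distr M borel X" by (rule prob_space_distr) simp
  interpret DZ: prob_space "distr M borel Z" by (rule prob_space_distr) simp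
  have "distr M borel X \<Otimes>\<^sub>M distr M borel Z = distr M (borel \<Otimes>\<^sub>M borel) (\<lambda>\<omega>. (X \<omega>, Z \<omega>))"
  proof (rule pair_measure_eqI)
    fix A B assume "A \<in> sets (distr M borel X)" "B \<in> sets (distr M borel Z)"
    then have [measurable]: "A \<in> sets borel" "B \<in> sets borel" by auto
    have "X -` A \<inter> space M = {\<omega> \<in> space M. X \<omega> \<in> A}" "Z -` B \<inter> space M = {\<omega> \<in> space M. Z \<omega> \<in> B}"
      "(\<lambda>\<omega>. (X \<omega>, Z \<omega>)) -` (A \<times> B) \<inter> space M = {\<omega> \<in> space M. X \<omega> \<in> A \<and> Z \<omega> \<in> B}" by auto
    then show "emeasure (distr M borel X) A * emeasure (distr M borel Z) B
        = emeasure (distr M (borel \<Otimes>\<^sub>M borel) (\<lambda>\<omega>. (X \<omega>, Z \<omega>))) (A \<times> B)"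
      using prod[of A B] by (simp add: emeasure_distr emeasure_eq_measure ennreal_mult)
  qed (auto intro: DX.sigma_finite_measure_axioms DZ.sigma_finite_measure_axioms cong: sets_pair_measure_cong)
  then show ?thesis by (simp add: indep_var_distribution_eq)
qed

text \<open>
  The law is described by its characteristic function, so that the variance \<open>v = 0\<close> is included and sums of
  independent variables need no case distinction.
\<close>

definition (in prob_space) centered_normal :: "('a \<Rightarrow> real) \<Rightarrow> real \<Rightarrow> bool" where
  "centered_normal X v \<longleftrightarrow> X \<in> borel_measurable M \<and>
     (\<forall>t. (CLINT \<omega>|M. iexp (t * X \<omega>)) = complex_of_real (exp (- (v * t\<^sup>2) / 2)))"

context prob_space
begin

lemma centered_normal_measurable: "centered_normal X v \<Longrightarrow> X \<in> borel_measurable M"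
  by (simp add: centered_normal_def)

lemma centered_normal_nonneg:
  assumes "centered_normal X v"
  shows "0 \<le> v"
proof -
  have "norm (CLINT \<omega>|M. iexp (1 * X \<omega>)) \<le> expectation (\<lambda>\<omega>. norm (iexp (1 * X \<omega>)))"
    by (rule integral_norm_bound)
  also have "\<dots> = 1" by (simp add: prob_space)
  also have "(CLINT \<omega>|M. iexp (1 * X \<omega>)) = complex_of_real (exp (- (v * 1\<^sup>2) / 2))"
    using assms unfolding centered_normal_def by blast
  finally show ?thesis by simp
qed

lemma centered_normal_distributed:
  assumes X: "centered_normal X v" and v: "0 < v"
  shows "distributed M lborel X (normal_density 0 (sqrt v))"
proof -
  have [measurable]: "X \<in> borel_measurable M" using X by (rule centered_normal_measurable)
  let ?Y = "\<lambda>\<omega>. (X \<omega> - 0) / sqrt v"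
  have "distr M borel ?Y = std_normal_distribution"
  proof (rule Levy_uniqueness)
    show "real_distribution (distr M borel ?Y)" by (rule real_distribution_distr) simp
    show "char (distr M borel ?Y) = char std_normal_distribution"
    proof
      fix t
      have "char (distr M borel ?Y) t = (CLINT \<omega>|M. iexp ((t / sqrt v) * X \<omega>))"
        by (simp add: char_def integral_distr)
      also have "\<dots> = complex_of_real (exp (- (v * (t / sqrt v)\<^sup>2) / 2))"
        using X unfolding centered_normal_def by blast
      also have "v * (t / sqrt v)\<^sup>2 = t\<^sup>2" using v by (simp add: power_divide)
      finally show "char (distr M borel ?Y) t = char std_normal_distribution t"
        by (simp add: char_std_normal_distribution)
    qed
  qed (rule real_dist_normal_dist)
  then have "distributed M lborel ?Y std_normal_density"
    by (simp add: distributed_def cong: distr_cong)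
  then show ?thesis
    using normal_standard_normal_convert[of "sqrt v" X 0] v by simp
qed

lemma centered_normal_0_AE:
  assumes X: "centered_normal X 0"
  shows "AE \<omega> in M. X \<omega> = 0"
proof -
  have [measurable]: "X \<in> borel_measurable M" using X by (rule centered_normal_measurable)
  interpret R: prob_space "return borel (0::real)" by (rule prob_space_return) simp
  have "distr M borel X = return borel 0"
  proof (rule Levy_uniqueness)
    show "real_distribution (distr M borel X)" by (rule real_distribution_distr) simp
    show "real_distribution (return borel 0)" by unfold_locales auto
    show "char (distr M borel X) = char (return borel 0)"
      using X by (auto simp: fun_eq_iff char_def integral_distr integral_return centered_normal_def)
  qed
  then have "emeasure (distr M borel X) (UNIV - {0}) = 0" by simp
  then have "emeasure M {\<omega> \<in> space M. X \<omega> \<noteq> 0} = 0"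
    by (subst (asm) emeasure_distr) (auto simp: vimage_def Int_def conj_commute)
  then show ?thesis by (intro AE_I[where N="{\<omega> \<in> space M. X \<omega> \<noteq> 0}"]) auto
qed

lemma centered_normal_small_ball:
  assumes X: "centered_normal X v" and v: "0 < v" and "0 \<le> \<epsilon>"
  shows "prob {\<omega> \<in> space M. \<bar>X \<omega>\<bar> \<le> \<epsilon>} \<le> \<epsilon> / sqrt v"
proof -
  have [measurable]: "X \<in> borel_measurable M" using X by (rule centered_normal_measurable)
  have D: "distr M lborel X = density lborel (normal_density 0 (sqrt v))"
    using centered_normal_distributed[OF X v] by (simp add: distributed_def)
  have dens: "normal_density 0 (sqrt v) x \<le> 1 / (2 * sqrt v)" for x
  proof -
    have "2 * sqrt v = sqrt (4 * v)" by (simp add: real_sqrt_mult)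
    also have "\<dots> \<le> sqrt (2 * pi * v)" using v pi_gt3 by (intro real_sqrt_le_mono mult_right_mono) auto
    finally have "1 / sqrt (2 * pi * v) \<le> 1 / (2 * sqrt v)" using v by (intro divide_left_mono) auto
    moreover have "exp (- x\<^sup>2 / (2 * v)) \<le> 1" using v by (simp add: divide_nonpos_pos)
    ultimately show ?thesis
      using v mult_mono[of "1 / sqrt (2 * pi * v)" "1 / (2 * sqrt v)" "exp (- x\<^sup>2 / (2 * v))" 1]
      by (simp add: normal_density_def)
  qed
  have "emeasure M {\<omega> \<in> space M. \<bar>X \<omega>\<bar> \<le> \<epsilon>} = emeasure (distr M lborel X) {-\<epsilon>..\<epsilon>}"
    by (subst emeasure_distr) (auto intro!: arg_cong[where f="emeasure M"])
  also have "\<dots> = (\<integral>\<^sup>+x. ennreal (normal_density 0 (sqrt v) x) * indicator {-\<epsilon>..\<epsilon>} x \<partial>lborel)"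
    unfolding D by (subst emeasure_density) auto
  also have "\<dots> \<le> (\<integral>\<^sup>+x. ennreal (1 / (2 * sqrt v)) * indicator {-\<epsilon>..\<epsilon>} x \<partial>lborel)"
    using dens by (intro nn_integral_mono mult_right_mono) (auto intro: ennreal_leI)
  also have "\<dots> = ennreal (1 / (2 * sqrt v)) * ennreal (2 * \<epsilon>)"
    using assms by (subst nn_integral_cmult_indicator) auto
  also have "\<dots> = ennreal (\<epsilon> / sqrt v)" using assms by (simp flip: ennreal_mult)
  finally show ?thesis using assms by (simp add: emeasure_eq_measure)
qed

end

text \<open>
  The integrand is a multiple of \<open>\<bar>x\<bar>\<close> times a normal density with variance
  \<open>\<sigma>\<^sup>2 \<tau>\<^sup>2 / (\<tau>\<^sup>2 + \<sigma>\<^sup>2 u\<^sup>2)\<close>. As a function of \<open>u\<close> the result is the Cauchy density of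
  the ratio of two independent normal variables.
\<close>

lemma nn_integral_normal_product:
  assumes \<sigma>: "0 < \<sigma>" and \<tau>: "0 < \<tau>"
  shows "(\<integral>\<^sup>+x. ennreal (\<bar>x\<bar> * normal_density 0 \<sigma> x * normal_density 0 \<tau> (u * x)) \<partial>lborel)
    = ennreal (\<sigma> * \<tau> / (pi * (\<tau>\<^sup>2 + \<sigma>\<^sup>2 * u\<^sup>2)))"
proof -
  define A where "A = \<tau>\<^sup>2 + \<sigma>\<^sup>2 * u\<^sup>2"
  have A: "A > 0" unfolding A_def using \<sigma> \<tau> by (intro add_pos_nonneg) auto
  define s where "s = \<sigma> * \<tau> / sqrt A"
  have s: "s > 0" using \<sigma> \<tau> A by (simp add: s_def)
  have s2: "s\<^sup>2 = \<sigma>\<^sup>2 * \<tau>\<^sup>2 / A" using A by (simp add: s_def power_divide power_mult_distrib)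
  define k where "k = sqrt (2 * pi) * s / (2 * pi * \<sigma> * \<tau>)"
  have "\<bar>x\<bar> * normal_density 0 \<sigma> x * normal_density 0 \<tau> (u * x) = k * (normal_density 0 s x * \<bar>x - 0\<bar> ^ (2 * 0 + 1))" for x
  proof -
    have "- x\<^sup>2 / (2 * \<sigma>\<^sup>2) + - (u * x)\<^sup>2 / (2 * \<tau>\<^sup>2) = - x\<^sup>2 / (2 * s\<^sup>2)"
      unfolding s2 using \<sigma> \<tau> A by (simp add: A_def field_simps power2_eq_square)
    then have e: "exp (- x\<^sup>2 / (2 * \<sigma>\<^sup>2)) * exp (- (u * x)\<^sup>2 / (2 * \<tau>\<^sup>2)) = exp (- x\<^sup>2 / (2 * s\<^sup>2))"
      by (simp flip: exp_add)
    define q where "q = sqrt (2 * pi)"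
    have r: "sqrt (2 * pi * \<sigma>\<^sup>2) = q * \<sigma>" "sqrt (2 * pi * \<tau>\<^sup>2) = q * \<tau>"
      "sqrt (2 * pi * s\<^sup>2) = q * s" and q: "q > 0"
      using \<sigma> \<tau> s by (simp_all add: real_sqrt_mult q_def)
    have q2: "2 * pi = q\<^sup>2" by (simp add: q_def)
    have "\<bar>x\<bar> * normal_density 0 \<sigma> x * normal_density 0 \<tau> (u * x)
      = \<bar>x\<bar> * (exp (- x\<^sup>2 / (2 * \<sigma>\<^sup>2)) * exp (- (u * x)\<^sup>2 / (2 * \<tau>\<^sup>2))) / (q\<^sup>2 * \<sigma> * \<tau>)"
      unfolding normal_density_def r by (simp add: power2_eq_square mult_ac)
    also have "\<dots> = k * (normal_density 0 s x * \<bar>x - 0\<bar> ^ (2 * 0 + 1))"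
      unfolding e normal_density_def r k_def q_def[symmetric] unfolding q2
      using s \<sigma> \<tau> q by (simp add: field_simps power2_eq_square)
    finally show ?thesis .
  qed
  moreover have "has_bochner_integral lborel (\<lambda>x. k * (normal_density 0 s x * \<bar>x - 0\<bar> ^ (2 * 0 + 1)))
     (k * (2 ^ 0 * s ^ (2 * 0 + 1) * fact 0 * sqrt (2 / pi)))"
    by (intro has_bochner_integral_mult_right normal_moment_abs_odd[OF s])
  ultimately have "(\<integral>\<^sup>+x. ennreal (\<bar>x\<bar> * normal_density 0 \<sigma> x * normal_density 0 \<tau> (u * x)) \<partial>lborel)
    = ennreal (k * (2 ^ 0 * s ^ (2 * 0 + 1) * fact 0 * sqrt (2 / pi)))"
    using s \<sigma> \<tau> nn_integral_eq_integral[of lborel "\<lambda>x. k * (normal_density 0 s x * \<bar>x - 0\<bar> ^ (2 * 0 + 1))"]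
    by (simp add: has_bochner_integral_iff k_def)
  also have "k * (2 ^ 0 * s ^ (2 * 0 + 1) * fact 0 * sqrt (2 / pi)) = \<sigma> * \<tau> / (pi * A)"
  proof -
    have "sqrt (2 * pi) * sqrt (2 / pi) = 2" by (simp flip: real_sqrt_mult)
    then have "k * (2 ^ 0 * s ^ (2 * 0 + 1) * fact 0 * sqrt (2 / pi)) = 2 * s\<^sup>2 / (2 * pi * \<sigma> * \<tau>)"
      by (simp add: k_def power2_eq_square field_simps)
    then show ?thesis unfolding s2 using \<sigma> \<tau> A by (simp add: field_simps power2_eq_square)
  qed
  finally show ?thesis by (simp add: A_def)
qed

lemma nn_integral_cauchy_tail:
  assumes \<sigma>: "0 < \<sigma>" and \<tau>: "0 < \<tau>"
  shows "(\<integral>\<^sup>+u. ennreal (\<sigma> * \<tau> / (pi * (\<tau>\<^sup>2 + \<sigma>\<^sup>2 * u\<^sup>2))) * indicator {\<beta>..} u \<partial>lborel)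
    = ennreal ((pi / 2 - arctan (\<sigma> * \<beta> / \<tau>)) / pi)"
proof -
  have pos: "\<tau>\<^sup>2 + \<sigma>\<^sup>2 * u\<^sup>2 > 0" for u using \<sigma> \<tau> by (intro add_pos_nonneg) auto
  have "(\<integral>\<^sup>+u. ennreal (\<sigma> * \<tau> / (pi * (\<tau>\<^sup>2 + \<sigma>\<^sup>2 * u\<^sup>2))) * indicator {\<beta>..} u \<partial>lborel)
    = (pi / 2) / pi - arctan (\<sigma> * \<beta> / \<tau>) / pi"
  proof (rule nn_integral_FTC_atLeast)
    fix u :: real
    show "((\<lambda>u. arctan (\<sigma> * u / \<tau>) / pi) has_real_derivative \<sigma> * \<tau> / (pi * (\<tau>\<^sup>2 + \<sigma>\<^sup>2 * u\<^sup>2))) (at u)"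
    proof -
      have "1 + (\<sigma> * u / \<tau>)\<^sup>2 = (\<tau>\<^sup>2 + \<sigma>\<^sup>2 * u\<^sup>2) / \<tau>\<^sup>2" using \<tau> by (simp add: field_simps)
      then have "inverse (1 + (\<sigma> * u / \<tau>)\<^sup>2) * (\<sigma> / \<tau>) / pi = \<sigma> * \<tau> / (pi * (\<tau>\<^sup>2 + \<sigma>\<^sup>2 * u\<^sup>2))"
        using \<tau> by (simp add: power2_eq_square mult_ac)
      moreover have "((\<lambda>u. arctan (\<sigma> * u / \<tau>) / pi) has_real_derivative inverse (1 + (\<sigma> * u / \<tau>)\<^sup>2) * (\<sigma> / \<tau>) / pi) (at u)"
        using \<tau> by (auto intro!: derivative_eq_intros)
      ultimately show ?thesis by simp
    qed
    show "0 \<le> \<sigma> * \<tau> / (pi * (\<tau>\<^sup>2 + \<sigma>\<^sup>2 * u\<^sup>2))" using \<sigma> \<tau> pos[of u] by auto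
  next
    have "filterlim (\<lambda>u. (\<sigma> / \<tau>) * u) at_top at_top"
      using \<sigma> \<tau> by (intro filterlim_tendsto_pos_mult_at_top[OF tendsto_const]) (auto simp: filterlim_ident)
    then have "((\<lambda>u. arctan ((\<sigma> / \<tau>) * u) / pi) \<longlongrightarrow> (pi / 2) / pi) at_top"
      by (intro tendsto_divide tendsto_const filterlim_compose[OF tendsto_arctan_at_top]) auto
    then show "((\<lambda>u. arctan (\<sigma> * u / \<tau>) / pi) \<longlongrightarrow> (pi / 2) / pi) at_top" by simp
  qed measurable
  then show ?thesis by (simp add: diff_divide_distrib)
qed

text \<open>
  Write \<open>Y = Z + \<beta> X\<close> with \<open>Z\<close> uncorrelated with \<open>X\<close>, hence independent of it. Then \<open>X Y < 0\<close> means that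
  \<open>- Z / X > \<beta>\<close>, and \<open>- Z / X\<close> has a Cauchy law. If \<open>Z\<close> vanishes almost surely, the signs agree and both sides are \<open>0\<close>.
\<close>

lemma (in prob_space) centered_normal_opposite_signs:
  assumes joint: "\<And>s t. centered_normal (\<lambda>\<omega>. s * X \<omega> + t * Y \<omega>) (s\<^sup>2 * v + 2 * s * t * c + t\<^sup>2 * w)"
    and v: "0 < v" and c: "0 < c"
  shows "0 \<le> v * w - c\<^sup>2"
    and "prob {\<omega> \<in> space M. X \<omega> * Y \<omega> < 0} = arctan (sqrt (v * w - c\<^sup>2) / c) / pi"
proof -
  define \<beta> where "\<beta> = c / v"
  define G where "G = v * w - c\<^sup>2"
  define Z where "Z = (\<lambda>\<omega>. Y \<omega> - \<beta> * X \<omega>)"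
  have Y_eq: "Y \<omega> = Z \<omega> + \<beta> * X \<omega>" for \<omega> by (simp add: Z_def)
  have XZ: "centered_normal (\<lambda>\<omega>. s * X \<omega> + t * Z \<omega>) (s\<^sup>2 * v + t\<^sup>2 * (G / v))" for s t
  proof -
    have "(\<lambda>\<omega>. (s - t * \<beta>) * X \<omega> + t * Y \<omega>) = (\<lambda>\<omega>. s * X \<omega> + t * Z \<omega>)" by (auto simp: Z_def algebra_simps)
    moreover have "(s - t * \<beta>)\<^sup>2 * v + 2 * (s - t * \<beta>) * t * c + t\<^sup>2 * w = s\<^sup>2 * v + t\<^sup>2 * (G / v)"
      using v by (simp add: \<beta>_def G_def field_simps power2_eq_square)
    ultimately show ?thesis using joint[of "s - t * \<beta>" t] by simp
  qed
  have X: "centered_normal X v" and Z: "centered_normal Z (G / v)" using XZ[of 1 0] XZ[of 0 1] by simp_all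
  note [measurable] = centered_normal_measurable[OF X] centered_normal_measurable[OF Z]
  have Yb[measurable]: "Y \<in> borel_measurable M" unfolding Y_eq[abs_def] by measurable
  have "0 \<le> G / v" by (rule centered_normal_nonneg[OF Z])
  then have G0: "0 \<le> G" using v by (simp add: zero_le_divide_iff)
  then show "0 \<le> v * w - c\<^sup>2" by (simp add: G_def)
  have \<beta>: "\<beta> > 0" using v c by (simp add: \<beta>_def)
  have "prob {\<omega> \<in> space M. X \<omega> * Y \<omega> < 0} = arctan (sqrt G / c) / pi"
  proof (cases "G = 0")
    case True
    then have "AE \<omega> in M. Z \<omega> = 0" using Z by (intro centered_normal_0_AE) simp
    then have "AE \<omega> in M. \<not> X \<omega> * Y \<omega> < 0"
    proof eventually_elim
      case (elim \<omega>)
      then have "X \<omega> * Y \<omega> = \<beta> * (X \<omega>)\<^sup>2" by (simp add: Y_eq power2_eq_square)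
      moreover have "0 \<le> \<beta> * (X \<omega>)\<^sup>2" using \<beta> by (intro mult_nonneg_nonneg) auto
      ultimately show ?case by simp
    qed
    then have "prob {\<omega> \<in> space M. X \<omega> * Y \<omega> < 0} = 0" by (intro prob_eq_0_AE) auto
    then show ?thesis using True by simp
  next
    case False
    then have G: "G > 0" using G0 by simp
    define \<sigma> \<tau> where "\<sigma> = sqrt v" and "\<tau> = sqrt (G / v)"
    have \<sigma>: "\<sigma> > 0" and \<tau>: "\<tau> > 0" using v G by (auto simp: \<sigma>_def \<tau>_def)
    have DX: "distr M borel X = density lborel (normal_density 0 \<sigma>)"
      and DZ: "distr M borel Z = density lborel (normal_density 0 \<tau>)"
      using centered_normal_distributed[OF X v] centered_normal_distributed[OF Z] v G
      by (simp_all add: distributed_def \<sigma>_def \<tau>_def cong: distr_cong)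
    have "indep_var borel X borel Z"
    proof (rule indep_var_if_char_factorizes)
      fix s t
      have "(CLINT \<omega>|M. iexp (s * X \<omega>) * iexp (t * Z \<omega>)) = (CLINT \<omega>|M. iexp (1 * (s * X \<omega> + t * Z \<omega>)))"
        by (rule Bochner_Integration.integral_cong) (simp_all add: algebra_simps flip: exp_add)
      also have "\<dots> = complex_of_real (exp (- ((s\<^sup>2 * v + t\<^sup>2 * (G / v)) * 1\<^sup>2) / 2))"
        using XZ[of s t] unfolding centered_normal_def by blast
      also have "\<dots> = complex_of_real (exp (- (v * s\<^sup>2) / 2) * exp (- (G / v * t\<^sup>2) / 2))"
        unfolding exp_add[symmetric] by (rule arg_cong[where f="\<lambda>x. complex_of_real (exp x)"]) (simp add: field_simps)
      also have "\<dots> = (CLINT \<omega>|M. iexp (s * X \<omega>)) * (CLINT \<omega>|M. iexp (t * Z \<omega>))"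
        using X Z unfolding centered_normal_def by simp
      finally show "(CLINT \<omega>|M. iexp (s * X \<omega>) * iexp (t * Z \<omega>))
        = (CLINT \<omega>|M. iexp (s * X \<omega>)) * (CLINT \<omega>|M. iexp (t * Z \<omega>))" .
    qed measurable
    then have prod: "distr M (borel \<Otimes>\<^sub>M borel) (\<lambda>\<omega>. (X \<omega>, Z \<omega>)) = distr M borel X \<Otimes>\<^sub>M distr M borel Z"
      by (simp add: indep_var_distribution_eq)
    interpret PZ: prob_space "distr M borel Z" by (rule prob_space_distr) simp
    define S where "S = {p :: real \<times> real. fst p * (snd p + \<beta> * fst p) < 0}"
    have "(\<lambda>p :: real \<times> real. fst p * (snd p + \<beta> * fst p)) \<in> borel_measurable (borel \<Otimes>\<^sub>M borel)"
      by measurable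
    from measurable_sets[OF this, of "{..<0}"] have "(\<lambda>p. fst p * (snd p + \<beta> * fst p)) -` {..<0} \<inter> space (borel \<Otimes>\<^sub>M borel) \<in> sets (borel \<Otimes>\<^sub>M borel)"
      by simp
    also have "(\<lambda>p. fst p * (snd p + \<beta> * fst p)) -` {..<0} \<inter> space (borel \<Otimes>\<^sub>M borel) = S"
      by (auto simp: S_def space_pair_measure)
    finally have [measurable]: "S \<in> sets (borel \<Otimes>\<^sub>M borel)" .
    let ?j = "\<lambda>x u. ennreal (\<bar>x\<bar> * normal_density 0 \<sigma> x * normal_density 0 \<tau> (u * x)) * indicator {\<beta><..} u"
    let ?q = "\<lambda>x. (\<integral>\<^sup>+z. ennreal (normal_density 0 \<tau> z) * indicator S (x, z) \<partial>lborel)"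
    let ?c = "\<lambda>u. ennreal (\<sigma> * \<tau> / (pi * (\<tau>\<^sup>2 + \<sigma>\<^sup>2 * u\<^sup>2)))"
    have "emeasure M {\<omega> \<in> space M. X \<omega> * Y \<omega> < 0} = emeasure (distr M (borel \<Otimes>\<^sub>M borel) (\<lambda>\<omega>. (X \<omega>, Z \<omega>))) S"
    proof -
      have "(\<lambda>\<omega>. (X \<omega>, Z \<omega>)) -` S \<inter> space M = {\<omega> \<in> space M. X \<omega> * Y \<omega> < 0}"
        by (auto simp: S_def Y_eq)
      then show ?thesis by (subst emeasure_distr) simp_all
    qed
    also have "\<dots> = (\<integral>\<^sup>+x. emeasure (distr M borel Z) (Pair x -` S) \<partial>distr M borel X)"
    proof -
      have "S \<in> sets (distr M borel X \<Otimes>\<^sub>M distr M borel Z)"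
        using \<open>S \<in> sets (borel \<Otimes>\<^sub>M borel)\<close> unfolding prod[symmetric] by simp
      then show ?thesis unfolding prod by (rule PZ.emeasure_pair_measure_alt)
    qed
    also have "\<dots> = (\<integral>\<^sup>+x. ?q x
        \<partial>density lborel (normal_density 0 \<sigma>))"
    proof -
      have "emeasure (density lborel (normal_density 0 \<tau>)) (Pair x -` S)
        = ?q x" for x
      proof -
        have "Pair x -` S \<in> sets borel" by (rule sets_Pair1) measurable
        then have "emeasure (density lborel (normal_density 0 \<tau>)) (Pair x -` S)
          = (\<integral>\<^sup>+z. ennreal (normal_density 0 \<tau> z) * indicator (Pair x -` S) z \<partial>lborel)"
          by (subst emeasure_density) simp_all
        then show ?thesis by (simp add: indicator_def)
      qed
      then show ?thesis unfolding DX DZ by simp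
    qed
    also have "\<dots> = (\<integral>\<^sup>+x. ennreal (normal_density 0 \<sigma> x) * ?q x \<partial>lborel)"
      by (rule nn_integral_density) measurable
    also have "\<dots> = (\<integral>\<^sup>+x. \<integral>\<^sup>+u. ?j x u \<partial>lborel \<partial>lborel)"
    proof (rule nn_integral_cong_AE)
      have "AE x in lborel. x \<noteq> (0::real)" by (rule AE_lborel_singleton)
      then show "AE x in lborel. ennreal (normal_density 0 \<sigma> x) * ?q x
        = (\<integral>\<^sup>+u. ?j x u \<partial>lborel)"
      proof eventually_elim
        case (elim x)
        \<comment> \<open>The substitution z = - u x turns the sign condition into u > \<beta>, whatever the sign of x.\<close>
        have S_iff: "(x, 0 + - x * u) \<in> S \<longleftrightarrow> \<beta> < u" for u
        proof -
          have "(x, 0 + - x * u) \<in> S \<longleftrightarrow> x\<^sup>2 * (\<beta> - u) < 0"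
            by (simp add: S_def algebra_simps power2_eq_square)
          also have "\<dots> \<longleftrightarrow> \<beta> < u" using elim by (simp add: mult_less_0_iff)
          finally show ?thesis .
        qed
        have "?q x
          = \<bar>- x\<bar> * (\<integral>\<^sup>+u. ennreal (normal_density 0 \<tau> (0 + - x * u)) * indicator S (x, 0 + - x * u) \<partial>lborel)"
          using elim by (intro nn_integral_real_affine) auto
        also have "(\<integral>\<^sup>+u. ennreal (normal_density 0 \<tau> (0 + - x * u)) * indicator S (x, 0 + - x * u) \<partial>lborel)
          = (\<integral>\<^sup>+u. ennreal (normal_density 0 \<tau> (u * x)) * indicator {\<beta><..} u \<partial>lborel)"
        proof -
          have "indicator S (x, 0 + - x * u) = (indicator {\<beta><..} u :: ennreal)" for u
            by (simp only: indicator_def S_iff greaterThan_iff)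
          moreover have "normal_density 0 \<tau> (0 + - x * u) = normal_density 0 \<tau> (u * x)" for u
            by (simp add: normal_density_def power_mult_distrib)
          ultimately show ?thesis by (simp only:)
        qed
        finally have "ennreal (normal_density 0 \<sigma> x) * ?q x
          = ennreal (\<bar>x\<bar> * normal_density 0 \<sigma> x) * (\<integral>\<^sup>+u. ennreal (normal_density 0 \<tau> (u * x)) * indicator {\<beta><..} u \<partial>lborel)"
          by (simp add: ennreal_mult' mult_ac)
        also have "\<dots> = (\<integral>\<^sup>+u. ennreal (\<bar>x\<bar> * normal_density 0 \<sigma> x) * (ennreal (normal_density 0 \<tau> (u * x)) * indicator {\<beta><..} u) \<partial>lborel)"
          by (rule nn_integral_cmult[symmetric]) measurable
        also have "\<dots> = (\<integral>\<^sup>+u. ?j x u \<partial>lborel)"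
          by (simp add: ennreal_mult'' mult.assoc)
        finally show ?case .
      qed
    qed
    also have "\<dots> = (\<integral>\<^sup>+u. \<integral>\<^sup>+x. ?j x u \<partial>lborel \<partial>lborel)"
      by (rule lborel_pair.Fubini'[symmetric]) measurable
    also have "\<dots> = (\<integral>\<^sup>+u. ?c u * indicator {\<beta><..} u \<partial>lborel)"
    proof (rule nn_integral_cong)
      fix u :: real
      have "(\<integral>\<^sup>+x. ?j x u \<partial>lborel)
        = (\<integral>\<^sup>+x. ennreal (\<bar>x\<bar> * normal_density 0 \<sigma> x * normal_density 0 \<tau> (u * x)) \<partial>lborel) * indicator {\<beta><..} u"
        by (rule nn_integral_multc) measurable
      then show "(\<integral>\<^sup>+x. ?j x u \<partial>lborel)
        = ?c u * indicator {\<beta><..} u"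
        by (simp only: nn_integral_normal_product[OF \<sigma> \<tau>])
    qed
    also have "\<dots> = (\<integral>\<^sup>+u. ?c u * indicator {\<beta>..} u \<partial>lborel)"
    proof (rule nn_integral_cong_AE)
      have "AE u in lborel. u \<noteq> \<beta>" by (rule AE_lborel_singleton)
      then show "AE u in lborel. ?c u * indicator {\<beta><..} u
        = ?c u * indicator {\<beta>..} u"
        by eventually_elim (simp add: indicator_def)
    qed
    also have "\<dots> = ennreal ((pi / 2 - arctan (\<sigma> * \<beta> / \<tau>)) / pi)"
      by (rule nn_integral_cauchy_tail[OF \<sigma> \<tau>])
    also have "\<sigma> * \<beta> / \<tau> = c / sqrt G"
    proof -
      have "\<sigma> * \<beta> / \<tau> = (sqrt v * sqrt v) * c / (v * sqrt G)"
        by (simp add: \<sigma>_def \<tau>_def \<beta>_def real_sqrt_divide del: real_sqrt_mult_self)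
      then show ?thesis using v by simp
    qed
    also have "pi / 2 - arctan (c / sqrt G) = arctan (sqrt G / c)"
      using arctan_inverse[of "c / sqrt G"] c G by simp
    finally show ?thesis using c G0 by (simp add: emeasure_eq_measure)
  qed
  then show "prob {\<omega> \<in> space M. X \<omega> * Y \<omega> < 0} = arctan (sqrt (v * w - c\<^sup>2) / c) / pi" by (simp add: G_def)
qed

section \<open>Linear combinations of stationary Gaussian sequences\<close>

context prob_space begin

lemma centered_normal_if_gaussian:
  assumes X: "gaussian_variable M X" and mean: "expectation X = 0"
  shows "integrable M X" and "integrable M (\<lambda>\<omega>. (X \<omega>)\<^sup>2)" and "centered_normal X (expectation (\<lambda>\<omega>. (X \<omega>)\<^sup>2))"
proof -
  have [measurable]: "X \<in> borel_measurable M" using X by (simp add: gaussian_variable_def)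
  have "integrable M X \<and> integrable M (\<lambda>\<omega>. (X \<omega>)\<^sup>2) \<and> centered_normal X (expectation (\<lambda>\<omega>. (X \<omega>)\<^sup>2))"
  proof -
    obtain m where "(AE \<omega> in M. X \<omega> = m) \<or> (\<exists>\<sigma>>0. distributed M lborel X (\<lambda>x. ennreal (normal_density m \<sigma> x)))"
      using X by (auto simp: gaussian_variable_def)
    then consider "AE \<omega> in M. X \<omega> = m" | \<sigma> where "\<sigma> > 0" "distributed M lborel X (\<lambda>x. ennreal (normal_density m \<sigma> x))"
      by blast
    then show ?thesis
    proof cases
      case 1
      have "expectation X = expectation (\<lambda>_. m)" by (rule integral_cong_AE) (use 1 in auto)
      then have "m = 0" using mean by (simp add: prob_space)
      then have AE: "AE \<omega> in M. X \<omega> = 0" using 1 by simp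
      have "integrable M X"
        by (rule integrable_cong_AE_imp[of M "\<lambda>_. 0"]) (use AE in auto)
      moreover have "integrable M (\<lambda>\<omega>. (X \<omega>)\<^sup>2)"
        by (rule integrable_cong_AE_imp[of M "\<lambda>_. 0"]) (use AE in auto)
      moreover have "expectation (\<lambda>\<omega>. (X \<omega>)\<^sup>2) = expectation (\<lambda>_. 0)"
        by (rule integral_cong_AE) (use AE in auto)
      moreover have "(CLINT \<omega>|M. iexp (t * X \<omega>)) = (CLINT \<omega>|M. 1)" for t
        by (rule integral_cong_AE) (use AE in auto)
      ultimately show ?thesis by (simp add: centered_normal_def prob_space)
    next
      case 2
      have "m = 0" using normal_distributed_expectation[OF 2] mean by simp
      then have D: "distributed M lborel X (normal_density 0 \<sigma>)" using 2 by simp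
      have var: "expectation (\<lambda>\<omega>. (X \<omega>)\<^sup>2) = \<sigma>\<^sup>2"
        using normal_distributed_variance[OF 2] mean by simp
      have "integrable M (\<lambda>\<omega>. (X \<omega>) ^ k)" for k
      proof -
        have "integrable lborel (\<lambda>x. normal_density 0 \<sigma> x * x ^ k)"
          using integrable_normal_moment[of \<sigma> 0 k] 2(1) by simp
        then show ?thesis
          by (subst distributed_integrable[OF D, of "\<lambda>x. x ^ k", symmetric]) auto
      qed
      from this[of 1] this[of 2] have int: "integrable M X" "integrable M (\<lambda>\<omega>. (X \<omega>)\<^sup>2)" by simp_all
      have std: "distr M borel (\<lambda>\<omega>. (X \<omega> - 0) / \<sigma>) = std_normal_distribution"
      proof -
        have "distributed M lborel (\<lambda>\<omega>. (X \<omega> - 0) / \<sigma>) std_normal_density"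
          using D unfolding normal_standard_normal_convert[OF 2(1), of X 0] .
        then have "distr M lborel (\<lambda>\<omega>. (X \<omega> - 0) / \<sigma>) = std_normal_distribution" by (simp only: distributed_def)
        moreover have "distr M borel (\<lambda>\<omega>. (X \<omega> - 0) / \<sigma>) = distr M lborel (\<lambda>\<omega>. (X \<omega> - 0) / \<sigma>)"
          by (rule distr_cong) auto
        ultimately show ?thesis by simp
      qed
      have "(CLINT \<omega>|M. iexp (t * X \<omega>)) = complex_of_real (exp (- (\<sigma>\<^sup>2 * t\<^sup>2) / 2))" for t
      proof -
        have "(CLINT \<omega>|M. iexp (t * X \<omega>)) = char (distr M borel (\<lambda>\<omega>. (X \<omega> - 0) / \<sigma>)) (t * \<sigma>)"
          using 2(1) by (simp add: char_def integral_distr)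
        also have "\<dots> = complex_of_real (exp (- (t * \<sigma>)\<^sup>2 / 2))" unfolding std char_std_normal_distribution ..
        finally show ?thesis by (simp add: power_mult_distrib mult.commute)
      qed
      then show ?thesis using int var by (simp add: centered_normal_def)
    qed
  qed
  then show "integrable M X" "integrable M (\<lambda>\<omega>. (X \<omega>)\<^sup>2)" "centered_normal X (expectation (\<lambda>\<omega>. (X \<omega>)\<^sup>2))"
    by blast+
qed

text \<open>
  Second moments of the combination are computed by expanding the square, which is legitimate because each \<open>X k\<close>
  is itself Gaussian and hence square integrable.
\<close>

lemma centered_normal_linear_combination:
  assumes X: "centered_stationary_gaussian M \<rho> X" and I: "finite I" "I \<subseteq> {1..}"
  shows "centered_normal (\<lambda>\<omega>. \<Sum>k\<in>I. c k * X k \<omega>) (\<Sum>k\<in>I. \<Sum>l\<in>I. c k * c l * \<rho> \<bar>int k - int l\<bar>)"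
proof -
  have gauss: "gaussian_variable M (\<lambda>\<omega>. \<Sum>k\<in>J. d k * X k \<omega>)" if "finite J" "J \<subseteq> {1..}" for J d
    using X that unfolding centered_stationary_gaussian_def gaussian_sequence_def by blast
  have mean: "expectation (X k) = 0" if "k \<in> I" for k
    using X I that by (auto simp: centered_stationary_gaussian_def)
  have cov: "expectation (\<lambda>\<omega>. X k \<omega> * X l \<omega>) = \<rho> \<bar>int k - int l\<bar>" if "k \<in> I" "l \<in> I" for k l
  proof -
    have "1 \<le> k" "1 \<le> l" using I that by auto
    then show ?thesis using X by (simp add: centered_stationary_gaussian_def)
  qed
  have gX: "gaussian_variable M (X k)" if "k \<in> I" for k
    using gauss[of "{k}" "\<lambda>_. 1"] I that by auto
  have int: "integrable M (X k)" "integrable M (\<lambda>\<omega>. (X k \<omega>)\<^sup>2)" if "k \<in> I" for k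
    using centered_normal_if_gaussian[OF gX[OF that] mean[OF that]] by blast+
  have int2: "integrable M (\<lambda>\<omega>. X k \<omega> * X l \<omega>)" if "k \<in> I" "l \<in> I" for k l
  proof (rule Bochner_Integration.integrable_bound)
    show "integrable M (\<lambda>\<omega>. (X k \<omega>)\<^sup>2 + (X l \<omega>)\<^sup>2)" using int that by auto
    show "(\<lambda>\<omega>. X k \<omega> * X l \<omega>) \<in> borel_measurable M" using int(1) that by (auto dest: borel_measurable_integrable)
    have "\<bar>x * y\<bar> \<le> x\<^sup>2 + y\<^sup>2" for x y :: real
    proof -
      have "0 \<le> \<bar>x\<bar> * \<bar>y\<bar>" by simp
      moreover have "2 * (\<bar>x\<bar> * \<bar>y\<bar>) \<le> x\<^sup>2 + y\<^sup>2"
        using sum_squares_bound[of "\<bar>x\<bar>" "\<bar>y\<bar>"] by (simp add: mult.assoc)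
      ultimately show ?thesis unfolding abs_mult by linarith
    qed
    then show "AE \<omega> in M. norm (X k \<omega> * X l \<omega>) \<le> norm ((X k \<omega>)\<^sup>2 + (X l \<omega>)\<^sup>2)" by simp
  qed
  have "expectation (\<lambda>\<omega>. \<Sum>k\<in>I. c k * X k \<omega>) = (\<Sum>k\<in>I. c k * expectation (X k))"
    using int by (simp add: Bochner_Integration.integral_sum)
  also have "\<dots> = 0" using mean by simp
  finally have m0: "expectation (\<lambda>\<omega>. \<Sum>k\<in>I. c k * X k \<omega>) = 0" .
  have "expectation (\<lambda>\<omega>. (\<Sum>k\<in>I. c k * X k \<omega>)\<^sup>2) = expectation (\<lambda>\<omega>. \<Sum>k\<in>I. \<Sum>l\<in>I. c k * c l * (X k \<omega> * X l \<omega>))"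
    by (rule Bochner_Integration.integral_cong) (simp_all add: power2_eq_square sum_product mult_ac)
  also have "\<dots> = (\<Sum>k\<in>I. \<Sum>l\<in>I. c k * c l * expectation (\<lambda>\<omega>. X k \<omega> * X l \<omega>))"
    using int2 by (simp add: Bochner_Integration.integral_sum Bochner_Integration.integrable_sum)
  also have "\<dots> = (\<Sum>k\<in>I. \<Sum>l\<in>I. c k * c l * \<rho> \<bar>int k - int l\<bar>)" using cov by simp
  finally show ?thesis using centered_normal_if_gaussian(3)[OF gauss[OF I] m0] by simp
qed

lemma centered_normal_add:
  assumes "indep_var borel X borel Y" "centered_normal X v" "centered_normal Y w"
  shows "centered_normal (\<lambda>\<omega>. X \<omega> + Y \<omega>) (v + w)"
proof -
  note [measurable] = assms(2,3)[THEN centered_normal_measurable]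
  have char: "(CLINT \<omega>|M. iexp (t * Z \<omega>)) = char (distr M borel Z) t" if "Z \<in> borel_measurable M" for Z t
    using that by (simp add: char_def integral_distr)
  have "(CLINT \<omega>|M. iexp (t * (X \<omega> + Y \<omega>))) = complex_of_real (exp (- ((v + w) * t\<^sup>2) / 2))" for t
  proof -
    have "(CLINT \<omega>|M. iexp (t * (X \<omega> + Y \<omega>))) = (CLINT \<omega>|M. iexp (t * X \<omega>)) * (CLINT \<omega>|M. iexp (t * Y \<omega>))"
      using char_distr_add[OF assms(1), of t] by (simp only: char[symmetric] borel_measurable_add centered_normal_measurable[OF assms(2)] centered_normal_measurable[OF assms(3)])
    also have "\<dots> = complex_of_real (exp (- (v * t\<^sup>2) / 2) * exp (- (w * t\<^sup>2) / 2))"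
      using assms(2,3) by (simp add: centered_normal_def)
    also have "exp (- (v * t\<^sup>2) / 2) * exp (- (w * t\<^sup>2) / 2) = exp (- ((v + w) * t\<^sup>2) / 2)"
      by (simp flip: exp_add add: algebra_simps add_divide_distrib)
    finally show ?thesis .
  qed
  then show ?thesis by (simp add: centered_normal_def)
qed

lemma indep_linear_combinations:
  assumes "independent_sequences M X Y" and I: "finite I" "I \<subseteq> {1..}"
  shows "indep_var borel (\<lambda>\<omega>. \<Sum>k\<in>I. c k * X k \<omega>) borel (\<lambda>\<omega>. \<Sum>k\<in>I. d k * Y k \<omega>)"
proof -
  have meas: "(\<lambda>f. \<Sum>k\<in>I. c k * f k) \<in> borel_measurable (Pi\<^sub>M {1..} (\<lambda>_. borel))" for c :: "nat \<Rightarrow> real"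
  proof (intro borel_measurable_sum borel_measurable_times borel_measurable_const)
    fix k assume "k \<in> I"
    then show "(\<lambda>f. f k) \<in> borel_measurable (Pi\<^sub>M {1..} (\<lambda>_. borel))"
      using I by (intro measurable_component_singleton) auto
  qed
  have "indep_var borel ((\<lambda>f. \<Sum>k\<in>I. c k * f k) \<circ> (\<lambda>\<omega>. \<lambda>k\<in>{1..}. X k \<omega>))
      borel ((\<lambda>f. \<Sum>k\<in>I. d k * f k) \<circ> (\<lambda>\<omega>. \<lambda>k\<in>{1..}. Y k \<omega>))"
    using assms(1) unfolding independent_sequences_def by (rule indep_var_compose) (rule meas)+
  moreover have "(\<lambda>f. \<Sum>k\<in>I. c k * f k) \<circ> (\<lambda>\<omega>. \<lambda>k\<in>{1..}. Z k \<omega>) = (\<lambda>\<omega>. \<Sum>k\<in>I. c k * Z k \<omega>)" for c and Z :: "nat \<Rightarrow> 'a \<Rightarrow> real"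
    using I by (auto simp: fun_eq_iff comp_def intro!: sum.cong)
  ultimately show ?thesis by simp
qed

end

section \<open>Zeros and sign changes along a grid\<close>

definition grid :: "real \<Rightarrow> real \<Rightarrow> nat \<Rightarrow> nat \<Rightarrow> real" where
  "grid lo hi m j = lo + real j * ((hi - lo) / real m)"

definition sign_changes :: "(real \<Rightarrow> real) \<Rightarrow> real \<Rightarrow> real \<Rightarrow> nat \<Rightarrow> nat" where
  "sign_changes f lo hi m = card {j. j < m \<and> f (grid lo hi m j) * f (grid lo hi m (Suc j)) < 0}"

lemma grid_Suc: "grid lo hi m (Suc j) = grid lo hi m j + (hi - lo) / real m"
  by (simp add: grid_def distrib_right del: times_divide_eq_right)

lemma grid_mono: "lo \<le> hi \<Longrightarrow> i \<le> j \<Longrightarrow> grid lo hi m i \<le> grid lo hi m j"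
  by (simp add: grid_def mult_right_mono divide_right_mono)

lemma grid_0 [simp]: "grid lo hi m 0 = lo"
  by (simp add: grid_def)

lemma grid_end [simp]: "0 < m \<Longrightarrow> grid lo hi m m = hi"
  by (simp add: grid_def)

lemma grid_in: "lo \<le> hi \<Longrightarrow> j \<le> m \<Longrightarrow> grid lo hi m j \<in> {lo..hi}"
  using grid_mono[of lo hi 0 j m] grid_mono[of lo hi j m m] grid_end[of m lo hi] by (cases "m = 0") auto

lemma grid_cell:
  assumes "lo < hi" "lo \<le> x" "x < hi" "0 < m"
  obtains j where "j < m" "grid lo hi m j \<le> x" "x < grid lo hi m (Suc j)"
proof -
  define j where "j = (LEAST j. x < grid lo hi m j)"
  have ex: "x < grid lo hi m m" using assms by simp
  have j: "x < grid lo hi m j" unfolding j_def by (rule LeastI[of _ m]) (rule ex)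
  then have "j \<noteq> 0" using assms by (cases "j = 0") auto
  then obtain k where k: "j = Suc k" by (cases j) auto
  have "j \<le> m" unfolding j_def by (rule Least_le) (rule ex)
  moreover have "\<not> x < grid lo hi m k" using k unfolding j_def by (metis lessI not_less_Least)
  ultimately show thesis using that[of k] j k by auto
qed

lemma grid_cell_unique:
  assumes "lo \<le> hi" "grid lo hi m i \<le> x" "x < grid lo hi m (Suc i)" "grid lo hi m j \<le> x" "x < grid lo hi m (Suc j)"
  shows "i = j"
proof (rule ccontr)
  assume "i \<noteq> j"
  then consider "Suc i \<le> j" | "Suc j \<le> i" by linarith
  then show False
    using grid_mono[OF assms(1), of "Suc i" j m] grid_mono[OF assms(1), of "Suc j" i m] assms by cases auto
qed

lemma sign_changes_le_zero_count:
  assumes cont: "continuous_on {lo..hi} f" and "lo \<le> hi"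
  shows "of_nat (sign_changes f lo hi m) \<le> zero_count f lo hi"
proof -
  define J where "J = {j. j < m \<and> f (grid lo hi m j) * f (grid lo hi m (Suc j)) < 0}"
  have "\<exists>z. grid lo hi m j \<le> z \<and> z < grid lo hi m (Suc j) \<and> f z = 0" if "j \<in> J" for j
  proof -
    let ?a = "grid lo hi m j" and ?b = "grid lo hi m (Suc j)"
    have ab: "?a \<le> ?b" "{?a..?b} \<subseteq> {lo..hi}"
      using that grid_in[OF assms(2), of j m] grid_in[OF assms(2), of "Suc j" m] grid_mono[OF assms(2), of j "Suc j" m]
      by (auto simp: J_def)
    have cont': "continuous_on {?a..?b} f" by (rule continuous_on_subset[OF cont ab(2)])
    have neg: "f ?a * f ?b < 0" using that by (simp add: J_def)
    have "\<exists>z. ?a \<le> z \<and> z \<le> ?b \<and> f z = 0"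
    proof (cases "f ?a < 0")
      case True
      then have "0 < f ?b" using neg by (simp add: mult_less_0_iff)
      then show ?thesis using IVT'[of f ?a 0 ?b] True ab cont' by auto
    next
      case False
      then have "f ?b < 0" "f ?a > 0" using neg by (auto simp: mult_less_0_iff)
      then show ?thesis using IVT2'[of f ?b 0 ?a] ab cont' by auto
    qed
    then obtain z where z: "?a \<le> z" "z \<le> ?b" "f z = 0" by blast
    moreover have "z \<noteq> ?b" using z neg by auto
    ultimately show ?thesis by force
  qed
  then obtain z where z: "\<And>j. j \<in> J \<Longrightarrow> grid lo hi m j \<le> z j \<and> z j < grid lo hi m (Suc j) \<and> f (z j) = 0"
    by metis
  have "inj_on z J"
  proof (rule inj_onI)
    fix i j assume "i \<in> J" "j \<in> J" "z i = z j"
    then show "i = j" using z[of i] z[of j] grid_cell_unique[OF assms(2), of m i "z i" j] by simp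
  qed
  moreover have "z ` J \<subseteq> {t \<in> {lo..hi}. f t = 0}"
  proof safe
    fix j assume j: "j \<in> J"
    then show "f (z j) = 0" using z by blast
    show "z j \<in> {lo..hi}"
      using j z[OF j] grid_in[OF assms(2), of j m] grid_in[OF assms(2), of "Suc j" m] by (auto simp: J_def)
  qed
  moreover have "finite J" by (simp add: J_def)
  ultimately have J: "inj_on z J" "z ` J \<subseteq> {t \<in> {lo..hi}. f t = 0}" "finite J" by auto
  have "of_nat (card J) = emeasure (count_space UNIV) (z ` J)"
    using J by (simp add: card_image)
  also have "\<dots> \<le> emeasure (count_space UNIV) {t \<in> {lo..hi}. f t = 0}"
    using J by (intro emeasure_mono) auto
  finally have "of_nat (card J) \<le> emeasure (count_space UNIV) {t \<in> {lo..hi}. f t = 0}" .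
  then show ?thesis by (simp add: zero_count_def sign_changes_def J_def)
qed

lemma simple_zero_sign_change:
  fixes f :: "real \<Rightarrow> real"
  assumes d: "(f has_real_derivative l) (at z)" and l: "l \<noteq> 0" and z: "f z = 0"
  obtains e where "e > 0" "\<And>s t. z - e < s \<Longrightarrow> s < z \<Longrightarrow> z < t \<Longrightarrow> t < z + e \<Longrightarrow> f s * f t < 0"
proof (cases "l > 0")
  case True
  from DERIV_pos_inc_left[OF d True] obtain e1 where e1: "e1 > 0" "\<And>h. 0 < h \<Longrightarrow> h < e1 \<Longrightarrow> f (z - h) < f z" by blast
  from DERIV_pos_inc_right[OF d True] obtain e2 where e2: "e2 > 0" "\<And>h. 0 < h \<Longrightarrow> h < e2 \<Longrightarrow> f z < f (z + h)" by blast
  show thesis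
  proof (rule that[of "min e1 e2"])
    fix s t assume "z - min e1 e2 < s" "s < z" "z < t" "t < z + min e1 e2"
    then show "f s * f t < 0" using e1(2)[of "z - s"] e2(2)[of "t - z"] z by (auto simp: mult_neg_pos)
  qed (use e1 e2 in auto)
next
  case False
  then have l': "l < 0" using l by simp
  from DERIV_neg_dec_left[OF d l'] obtain e1 where e1: "e1 > 0" "\<And>h. 0 < h \<Longrightarrow> h < e1 \<Longrightarrow> f z < f (z - h)" by blast
  from DERIV_neg_dec_right[OF d l'] obtain e2 where e2: "e2 > 0" "\<And>h. 0 < h \<Longrightarrow> h < e2 \<Longrightarrow> f (z + h) < f z" by blast
  show thesis
  proof (rule that[of "min e1 e2"])
    fix s t assume "z - min e1 e2 < s" "s < z" "z < t" "t < z + min e1 e2"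
    then show "f s * f t < 0" using e1(2)[of "z - s"] e2(2)[of "t - z"] z by (auto simp: mult_pos_neg)
  qed (use e1 e2 in auto)
qed

text \<open>
  Once the mesh is smaller than the gaps between the zeros in \<open>K\<close> and than the radii on which \<open>f\<close> changes sign
  around each of them, these zeros lie in distinct cells, and each of these cells shows a sign change. The grid must avoid the
  zeros, because a zero at a grid point is invisible to strict sign changes.
\<close>

lemma eventually_card_zeros_le_sign_changes:
  fixes f :: "real \<Rightarrow> real"
  assumes lohi: "lo < hi"
    and deriv: "\<And>x. (f has_real_derivative f' x) (at x)"
    and simple: "\<And>x. x \<in> {lo..hi} \<Longrightarrow> f x = 0 \<Longrightarrow> f' x \<noteq> 0"
    and grid: "\<And>m j. j \<le> m \<Longrightarrow> f (grid lo hi m j) \<noteq> 0"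
    and K: "finite K" "K \<subseteq> {t \<in> {lo..hi}. f t = 0}"
  shows "\<forall>\<^sub>F m in sequentially. card K \<le> sign_changes f lo hi m"
proof -
  have "\<exists>e>0. \<forall>s t. z - e < s \<longrightarrow> s < z \<longrightarrow> z < t \<longrightarrow> t < z + e \<longrightarrow> f s * f t < 0" if "z \<in> K" for z
  proof -
    have z: "z \<in> {lo..hi}" "f z = 0" using that K(2) by auto
    show ?thesis by (rule simple_zero_sign_change[OF deriv[of z] simple[OF z] z(2)]) auto
  qed
  then obtain e where e: "\<And>z. z \<in> K \<Longrightarrow> e z > 0"
      "\<And>z s t. z \<in> K \<Longrightarrow> z - e z < s \<Longrightarrow> s < z \<Longrightarrow> z < t \<Longrightarrow> t < z + e z \<Longrightarrow> f s * f t < 0"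
    by metis
  \<comment> \<open>The 1 keeps the set nonempty when K is empty.\<close>
  define E where "E = insert 1 (e ` K \<union> (\<lambda>(z, z'). \<bar>z - z'\<bar>) ` ({(z, z'). z \<in> K \<and> z' \<in> K \<and> z \<noteq> z'}))"
  have "finite {(z, z'). z \<in> K \<and> z' \<in> K \<and> z \<noteq> z'}"
    by (rule finite_subset[of _ "K \<times> K"]) (use K in auto)
  then have finE: "finite E" using K(1) by (simp add: E_def)
  define d where "d = Min E"
  have d: "d > 0" unfolding d_def using finE e(1) by (subst Min_gr_iff) (auto simp: E_def)
  have de: "d \<le> e z" if "z \<in> K" for z unfolding d_def using that finE by (intro Min_le) (auto simp: E_def)
  have dd: "d \<le> \<bar>z - z'\<bar>" if "z \<in> K" "z' \<in> K" "z \<noteq> z'" for z z'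
  proof -
    have "\<bar>z - z'\<bar> \<in> E"
      unfolding E_def using that by (intro insertI2 UnI2 image_eqI[of _ _ "(z, z')"]) auto
    then show ?thesis unfolding d_def using finE by (intro Min_le) auto
  qed
  have "(\<lambda>m. (hi - lo) / real m) \<longlonglongrightarrow> 0" by (rule lim_const_over_n)
  then have "\<forall>\<^sub>F m in sequentially. (hi - lo) / real m < d" using d by (rule order_tendstoD)
  then show ?thesis using eventually_gt_at_top[of 0]
  proof eventually_elim
    case (elim m)
    have "\<exists>j. j < m \<and> grid lo hi m j < z \<and> z < grid lo hi m (Suc j)" if z: "z \<in> K" for z
    proof -
      have zz: "z \<in> {lo..hi}" "f z = 0" using z K(2) by auto
      have "z \<noteq> hi" using grid[of m m] zz(2) elim(2) by auto
      then obtain j where j: "j < m" "grid lo hi m j \<le> z" "z < grid lo hi m (Suc j)"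
        using grid_cell[of lo hi z m] lohi zz elim(2) by auto
      moreover have "grid lo hi m j \<noteq> z" using grid[of j m] j(1) zz(2) by auto
      ultimately show ?thesis by force
    qed
    then obtain j where j: "\<And>z. z \<in> K \<Longrightarrow> j z < m \<and> grid lo hi m (j z) < z \<and> z < grid lo hi m (Suc (j z))" by metis
    have "inj_on j K"
    proof (rule inj_onI, rule ccontr)
      fix z z' assume z: "z \<in> K" "z' \<in> K" "j z = j z'" "z \<noteq> z'"
      have "\<bar>z - z'\<bar> < (hi - lo) / real m"
        using j[OF z(1)] j[OF z(2)] z(3) unfolding grid_Suc by auto
      then show False using dd[OF z(1,2,4)] elim(1) by simp
    qed
    moreover have "j ` K \<subseteq> {j. j < m \<and> f (grid lo hi m j) * f (grid lo hi m (Suc j)) < 0}"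
    proof safe
      fix z assume z: "z \<in> K"
      show "j z < m" using j[OF z] by simp
      show "f (grid lo hi m (j z)) * f (grid lo hi m (Suc (j z))) < 0"
      proof (rule e(2)[OF z])
        show "z - e z < grid lo hi m (j z)" "grid lo hi m (Suc (j z)) < z + e z"
          using j[OF z] de[OF z] elim(1) unfolding grid_Suc by auto
      qed (use j[OF z] in auto)
    qed
    ultimately show ?case unfolding sign_changes_def by (intro card_inj_on_le[of j]) auto
  qed
qed

lemma zero_count_le_liminf_sign_changes:
  fixes f :: "real \<Rightarrow> real"
  assumes lohi: "lo < hi"
    and deriv: "\<And>x. (f has_real_derivative f' x) (at x)"
    and simple: "\<And>x. x \<in> {lo..hi} \<Longrightarrow> f x = 0 \<Longrightarrow> f' x \<noteq> 0"
    and grid: "\<And>m j. j \<le> m \<Longrightarrow> f (grid lo hi m j) \<noteq> 0"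
  shows "zero_count f lo hi \<le> liminf (\<lambda>m. of_nat (sign_changes f lo hi m))"
proof -
  define Z where "Z = {t \<in> {lo..hi}. f t = 0}"
  have *: "of_nat (card K) \<le> liminf (\<lambda>m. of_nat (sign_changes f lo hi m) :: ennreal)" if "finite K" "K \<subseteq> Z" for K
    using eventually_card_zeros_le_sign_changes[OF assms, of K] that
    by (intro Liminf_bounded) (auto simp: Z_def elim!: eventually_mono)
  show ?thesis
  proof (cases "finite Z")
    case True
    then have "zero_count f lo hi = of_nat (card Z)" unfolding zero_count_def Z_def[symmetric] by simp
    then show ?thesis using *[of Z] True by simp
  next
    case False
    have le: "of_nat n \<le> liminf (\<lambda>m. of_nat (sign_changes f lo hi m) :: ennreal)" for n
    proof -
      obtain K where "finite K" "card K = n" "K \<subseteq> Z" using infinite_arbitrarily_large[OF False, of n] by blast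
      then show ?thesis using *[of K] by simp
    qed
    have "(SUP n. of_nat n :: ennreal) \<le> liminf (\<lambda>m. of_nat (sign_changes f lo hi m))"
      by (rule SUP_least) (rule le)
    then have "liminf (\<lambda>m. of_nat (sign_changes f lo hi m) :: ennreal) = \<top>"
      by (simp add: ennreal_SUP_of_nat_eq_top top_unique)
    then show ?thesis by simp
  qed
qed

section \<open>The Kac-Rice formula for finite Gaussian sums\<close>

lemma arctan_ratio_tendsto:
  fixes y d :: "nat \<Rightarrow> real"
  assumes y: "y \<longlonglongrightarrow> a" and d: "d \<longlonglongrightarrow> 0" and d0: "\<forall>\<^sub>F m in sequentially. d m \<noteq> 0"
  shows "(\<lambda>m. arctan (d m * y m) / d m) \<longlonglongrightarrow> a"
proof -
  define h where "h = (\<lambda>z :: real. if z = 0 then 1 else arctan z / z)"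
  have "((\<lambda>z. arctan z / z) \<longlongrightarrow> 1) (at 0)"
    using DERIV_arctan[of 0] by (simp add: has_field_derivative_iff)
  then have "isCont h 0"
    unfolding h_def isCont_def by (simp cong: LIM_cong)
  moreover have "(\<lambda>m. d m * y m) \<longlonglongrightarrow> 0" using tendsto_mult[OF d y] by simp
  ultimately have "(\<lambda>m. h (d m * y m)) \<longlonglongrightarrow> h 0" by (rule isCont_tendsto_compose)
  from tendsto_mult[OF y this] have "(\<lambda>m. y m * h (d m * y m)) \<longlonglongrightarrow> a" by (simp add: h_def)
  then show ?thesis
    by (rule Lim_transform_eventually) (use d0 in eventually_elim, auto simp: h_def)
qed

text \<open>
  A Gaussian function \<open>F(x) = \<Sum>\<^sub>i g\<^sub>i(x) \<xi>\<^sub>i\<close> with finitely many jointly Gaussian coefficients of covariance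
  matrix \<open>R\<close>. Joint normality is stated as normality of all linear combinations.
\<close>

locale gaussian_field = prob_space M for M :: "'a measure" +
  fixes I :: "'i set" and \<xi> :: "'i \<Rightarrow> 'a \<Rightarrow> real" and R :: "'i \<Rightarrow> 'i \<Rightarrow> real"
    and g g' g'' :: "'i \<Rightarrow> real \<Rightarrow> real" and lo hi :: real
  assumes finite_I: "finite I"
    and normal: "\<And>c. centered_normal (\<lambda>\<omega>. \<Sum>i\<in>I. c i * \<xi> i \<omega>) (\<Sum>i\<in>I. \<Sum>j\<in>I. c i * c j * R i j)"
    and R_sym: "\<And>i j. R i j = R j i"
    and g_deriv: "\<And>i x. (g i has_real_derivative g' i x) (at x)"
    and g'_deriv: "\<And>i x. (g' i has_real_derivative g'' i x) (at x)"
    and g''_cont: "\<And>i. continuous_on UNIV (g'' i)"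
    and lo_less_hi: "lo < hi"
    and nondegenerate: "\<And>x. x \<in> {lo..hi} \<Longrightarrow> 0 < (\<Sum>i\<in>I. \<Sum>j\<in>I. g i x * g j x * R i j)"
begin

abbreviation gvec :: "real \<Rightarrow> 'i \<Rightarrow> real" where "gvec x \<equiv> \<lambda>i. g i x"
abbreviation gvec' :: "real \<Rightarrow> 'i \<Rightarrow> real" where "gvec' x \<equiv> \<lambda>i. g' i x"

definition cov :: "('i \<Rightarrow> real) \<Rightarrow> ('i \<Rightarrow> real) \<Rightarrow> real" where
  "cov u w = (\<Sum>i\<in>I. \<Sum>j\<in>I. u i * w j * R i j)"

definition F :: "'a \<Rightarrow> real \<Rightarrow> real" where "F \<omega> x = (\<Sum>i\<in>I. g i x * \<xi> i \<omega>)"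
definition F' :: "'a \<Rightarrow> real \<Rightarrow> real" where "F' \<omega> x = (\<Sum>i\<in>I. g' i x * \<xi> i \<omega>)"

abbreviation flips :: "real \<Rightarrow> real \<Rightarrow> 'a set" where
  "flips x y \<equiv> {\<omega> \<in> space M. F \<omega> x * F \<omega> y < 0}"
abbreviation pt :: "nat \<Rightarrow> nat \<Rightarrow> real" where "pt \<equiv> grid lo hi"

text \<open>
  The Kac-Rice density of zeros: \<open>E[\<bar>F'\<bar> | F = 0]\<close> times the density of \<open>F(x)\<close> at \<open>0\<close>.
\<close>

definition intensity :: "real \<Rightarrow> real" where
  "intensity x = sqrt (cov (gvec x) (gvec x) * cov (gvec' x) (gvec' x) - (cov (gvec x) (gvec' x))\<^sup>2)
     / (pi * cov (gvec x) (gvec x))"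

lemma cov_sym: "cov u w = cov w u"
  unfolding cov_def by (subst sum.swap) (simp add: R_sym mult.commute mult.left_commute)

lemma cov_add_left: "cov (\<lambda>i. u i + s * w i) z = cov u z + s * cov w z"
  by (simp add: cov_def algebra_simps sum.distrib sum_distrib_left)

lemma cov_add_right: "cov z (\<lambda>i. u i + s * w i) = cov z u + s * cov z w"
  by (simp add: cov_def algebra_simps sum.distrib sum_distrib_left)

lemma cov_tendsto:
  assumes "\<And>i. i \<in> I \<Longrightarrow> ((\<lambda>m. u m i) \<longlongrightarrow> u0 i) net" "\<And>i. i \<in> I \<Longrightarrow> ((\<lambda>m. w m i) \<longlongrightarrow> w0 i) net"
  shows "((\<lambda>m. cov (u m) (w m)) \<longlongrightarrow> cov u0 w0) net"
  unfolding cov_def using assms by (intro tendsto_intros)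

lemma cov_bound:
  assumes "\<And>i. i \<in> I \<Longrightarrow> \<bar>u i\<bar> \<le> U" "\<And>i. i \<in> I \<Longrightarrow> \<bar>w i\<bar> \<le> W"
  shows "\<bar>cov u w\<bar> \<le> (\<Sum>i\<in>I. \<Sum>j\<in>I. \<bar>R i j\<bar>) * (U * W)"
proof -
  have "\<bar>cov u w\<bar> \<le> (\<Sum>i\<in>I. \<Sum>j\<in>I. \<bar>u i * w j * R i j\<bar>)"
    unfolding cov_def by (intro order.trans[OF sum_abs] sum_mono sum_abs)
  also have "\<dots> \<le> (\<Sum>i\<in>I. \<Sum>j\<in>I. \<bar>R i j\<bar> * (U * W))"
  proof (intro sum_mono)
    fix i j assume "i \<in> I" "j \<in> I"
    then have "\<bar>u i\<bar> * \<bar>w j\<bar> \<le> U * W" using assms(1)[of i] assms(2)[of j] by (intro mult_mono) auto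
    then have "\<bar>R i j\<bar> * (\<bar>u i\<bar> * \<bar>w j\<bar>) \<le> \<bar>R i j\<bar> * (U * W)" by (rule mult_left_mono) simp
    then show "\<bar>u i * w j * R i j\<bar> \<le> \<bar>R i j\<bar> * (U * W)" by (simp add: abs_mult mult.commute)
  qed
  also have "\<dots> = (\<Sum>i\<in>I. \<Sum>j\<in>I. \<bar>R i j\<bar>) * (U * W)" by (simp add: sum_distrib_right)
  finally show ?thesis .
qed

lemma g_cont: "isCont (g i) x" and g'_cont: "isCont (g' i) x"
  by (rule DERIV_isCont[OF g_deriv], rule DERIV_isCont[OF g'_deriv])

lemma g_measurable [measurable]: "g i \<in> borel_measurable borel" and g'_measurable [measurable]: "g' i \<in> borel_measurable borel"
  using g_cont g'_cont by (auto intro!: borel_measurable_continuous_onI continuous_at_imp_continuous_on)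

lemma xi_measurable [measurable]: assumes "i \<in> I" shows "\<xi> i \<in> borel_measurable M"
proof -
  have "(\<Sum>j\<in>I. (if j = i then 1 else 0) * \<xi> j \<omega>) = \<xi> i \<omega>" for \<omega>
    using assms finite_I by (simp add: if_distrib[of "\<lambda>a. a * _"] sum.delta cong: if_cong)
  then show ?thesis using centered_normal_measurable[OF normal[of "\<lambda>j. if j = i then 1 else 0"]] by simp
qed

lemma F_measurable [measurable]: "(\<lambda>\<omega>. F \<omega> x) \<in> borel_measurable M"
  unfolding F_def by measurable

lemma F_deriv: "(F \<omega> has_real_derivative F' \<omega> x) (at x)"
  unfolding F_def[abs_def] F'_def by (intro DERIV_sum DERIV_cmult_right g_deriv)

lemma F_normal:
  "centered_normal (\<lambda>\<omega>. s * F \<omega> x + t * F \<omega> y)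
    (s\<^sup>2 * cov (gvec x) (gvec x) + 2 * s * t * cov (gvec x) (gvec y) + t\<^sup>2 * cov (gvec y) (gvec y))"
proof -
  have "centered_normal (\<lambda>\<omega>. \<Sum>i\<in>I. (s * g i x + t * g i y) * \<xi> i \<omega>)
      (\<Sum>i\<in>I. \<Sum>j\<in>I. (s * g i x + t * g i y) * (s * g j x + t * g j y) * R i j)" by (rule normal)
  moreover have "(\<Sum>i\<in>I. (s * g i x + t * g i y) * \<xi> i \<omega>) = s * F \<omega> x + t * F \<omega> y" for \<omega>
    by (simp add: F_def algebra_simps sum.distrib sum_distrib_left)
  moreover have "(\<Sum>i\<in>I. \<Sum>j\<in>I. (s * g i x + t * g i y) * (s * g j x + t * g j y) * R i j)
    = s\<^sup>2 * cov (gvec x) (gvec x) + s * t * cov (gvec x) (gvec y) + s * t * cov (gvec y) (gvec x)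
      + t\<^sup>2 * cov (gvec y) (gvec y)"
    by (simp add: cov_def algebra_simps sum.distrib sum_distrib_left power2_eq_square)
  ultimately show ?thesis by (simp add: cov_sym[of "\<lambda>i. g i y" "\<lambda>i. g i x"] algebra_simps)
qed

lemma F_normal_single: "centered_normal (\<lambda>\<omega>. F \<omega> x) (cov (gvec x) (gvec x))"
  using F_normal[of 1 x 0 x] by simp

lemma uniform_bounds:
  obtains K v0 where "0 < K" "0 < v0"
    "\<And>i x. i \<in> I \<Longrightarrow> x \<in> {lo..hi} \<Longrightarrow> \<bar>g i x\<bar> \<le> K \<and> \<bar>g' i x\<bar> \<le> K \<and> \<bar>g'' i x\<bar> \<le> K"
    "\<And>x. x \<in> {lo..hi} \<Longrightarrow> v0 \<le> cov (gvec x) (gvec x)"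
proof -
  have contg: "continuous_on {lo..hi} (g i)" "continuous_on {lo..hi} (g' i)" "continuous_on {lo..hi} (g'' i)" for i
    using g_cont g'_cont continuous_on_subset[OF g''_cont] by (auto intro: continuous_at_imp_continuous_on)
  define b where "b = (\<lambda>x. \<Sum>i\<in>I. \<bar>g i x\<bar> + \<bar>g' i x\<bar> + \<bar>g'' i x\<bar>)"
  have "continuous_on {lo..hi} b" unfolding b_def by (intro continuous_intros contg)
  then obtain x0 where x0: "\<And>x. x \<in> {lo..hi} \<Longrightarrow> b x \<le> b x0"
    using continuous_attains_sup[of "{lo..hi}" b] lo_less_hi by (metis atLeastatMost_empty_iff2 compact_Icc less_imp_le)
  have gb: "\<bar>g i x\<bar> \<le> b x \<and> \<bar>g' i x\<bar> \<le> b x \<and> \<bar>g'' i x\<bar> \<le> b x" if "i \<in> I" for i x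
  proof -
    have "\<bar>g i x\<bar> + \<bar>g' i x\<bar> + \<bar>g'' i x\<bar> \<le> b x"
      unfolding b_def by (rule member_le_sum) (use that finite_I in auto)
    then show ?thesis by linarith
  qed
  have "continuous_on {lo..hi} (\<lambda>x. cov (gvec x) (gvec x))" unfolding cov_def by (intro continuous_intros contg)
  then obtain x1 where x1: "x1 \<in> {lo..hi}" "\<And>x. x \<in> {lo..hi} \<Longrightarrow> cov (gvec x1) (gvec x1) \<le> cov (gvec x) (gvec x)"
    using continuous_attains_inf[of "{lo..hi}" "\<lambda>x. cov (gvec x) (gvec x)"] lo_less_hi by auto
  show thesis
  proof (rule that[of "\<bar>b x0\<bar> + 1" "cov (gvec x1) (gvec x1)"])
    show "0 < cov (gvec x1) (gvec x1)" using nondegenerate[OF x1(1)] by (simp add: cov_def)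
    fix i x assume "i \<in> I" "x \<in> {lo..hi}"
    then show "\<bar>g i x\<bar> \<le> \<bar>b x0\<bar> + 1 \<and> \<bar>g' i x\<bar> \<le> \<bar>b x0\<bar> + 1 \<and> \<bar>g'' i x\<bar> \<le> \<bar>b x0\<bar> + 1"
      using gb[of i x] x0[of x] by linarith
  qed (use x1 in auto)
qed

text \<open>
  The Cauchy-Schwarz inequality for the covariance form, which is positive because its values are variances.
\<close>

lemma intensity_nonneg:
  assumes "x \<in> {lo..hi}"
  shows "0 \<le> intensity x"
proof -
  define u w where "u = (gvec x)" and "w = (gvec' x)"
  have v: "0 < cov u u" using nondegenerate[OF assms] by (simp add: cov_def u_def)
  define s where "s = - cov u w / cov u u"
  have "0 \<le> cov (\<lambda>i. w i + s * u i) (\<lambda>i. w i + s * u i)"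
    unfolding cov_def by (rule centered_normal_nonneg[OF normal])
  also have "\<dots> = cov w w + 2 * s * cov u w + s\<^sup>2 * cov u u"
    unfolding cov_add_left cov_add_right cov_sym[of w u] by (simp add: power2_eq_square algebra_simps)
  also have "\<dots> = (cov u u * cov w w - (cov u w)\<^sup>2) / cov u u"
    using v by (simp add: s_def field_simps power2_eq_square)
  finally have "0 \<le> cov u u * cov w w - (cov u w)\<^sup>2" using v by (simp add: zero_le_divide_iff)
  then show ?thesis using v by (simp add: intensity_def u_def w_def)
qed

lemma F_nonzero_AE:
  assumes "x \<in> {lo..hi}"
  shows "AE \<omega> in M. F \<omega> x \<noteq> 0"
proof -
  have "prob {\<omega> \<in> space M. \<bar>F \<omega> x\<bar> \<le> 0} \<le> 0 / sqrt (cov (gvec x) (gvec x))"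
    using nondegenerate[OF assms] by (intro centered_normal_small_ball[OF F_normal_single]) (auto simp: cov_def)
  then have "prob {\<omega> \<in> space M. F \<omega> x = 0} = 0" by (simp add: measure_le_0_iff)
  then have "emeasure M {\<omega> \<in> space M. F \<omega> x = 0} = 0" by (simp add: emeasure_eq_measure)
  then show ?thesis by (intro AE_I[where N="{\<omega> \<in> space M. F \<omega> x = 0}"]) auto
qed

lemma near_double_zero:
  assumes K: "0 \<le> K" "\<And>i x. i \<in> I \<Longrightarrow> x \<in> {lo..hi} \<Longrightarrow> \<bar>g'' i x\<bar> \<le> K"
    and x: "x \<in> {lo..hi}" "y \<in> {lo..hi}" and zero: "F \<omega> x = 0" "F' \<omega> x = 0"
  shows "\<bar>F \<omega> y\<bar> \<le> K * (\<Sum>i\<in>I. \<bar>\<xi> i \<omega>\<bar>) * (y - x)\<^sup>2"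
proof -
  have taylor: "\<bar>g i y - g i x - (y - x) * g' i x\<bar> \<le> K * (y - x)\<^sup>2" if i: "i \<in> I" for i
  proof (cases "x = y")
    case False
    have mvt: "\<exists>z. z \<in> {lo..hi} \<and> \<bar>z - x\<bar> \<le> \<bar>y - x\<bar> \<and> f y - f x = (y - x) * f' z"
      if d: "\<And>z. (f has_real_derivative f' z) (at z)" and y: "y \<in> {lo..hi}" for f f' :: "real \<Rightarrow> real" and y
    proof -
      consider "x < y" | "x = y" | "y < x" by linarith
      then show ?thesis
      proof cases
        case 1
        from MVT2[OF 1, of f f'] d obtain z where "x < z" "z < y" "f y - f x = (y - x) * f' z" by blast
        then show ?thesis using x y by (intro exI[of _ z]) auto
      next
        case 2
        then show ?thesis using x by (intro exI[of _ x]) auto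
      next
        case 3
        from MVT2[OF 3, of f f'] d obtain z where "y < z" "z < x" "f x - f y = (x - y) * f' z" by blast
        then show ?thesis using x y by (intro exI[of _ z]) (auto simp: algebra_simps)
      qed
    qed
    obtain z where z: "z \<in> {lo..hi}" "\<bar>z - x\<bar> \<le> \<bar>y - x\<bar>" "g i y - g i x = (y - x) * g' i z"
      using mvt[OF g_deriv x(2)] by blast
    obtain w where w: "w \<in> {lo..hi}" "g' i z - g' i x = (z - x) * g'' i w"
      using mvt[OF g'_deriv z(1)] by blast
    have "g i y - g i x - (y - x) * g' i x = (y - x) * (g' i z - g' i x)" using z(3) by (simp add: algebra_simps)
    also have "\<bar>\<dots>\<bar> = \<bar>y - x\<bar> * (\<bar>z - x\<bar> * \<bar>g'' i w\<bar>)" unfolding w(2) by (simp add: abs_mult)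
    also have "\<dots> \<le> \<bar>y - x\<bar> * (\<bar>y - x\<bar> * K)"
      using z(2) K(2)[OF i w(1)] by (intro mult_left_mono mult_mono) auto
    finally show ?thesis by (simp add: power2_eq_square mult_ac abs_mult_self_eq flip: abs_mult)
  qed (use K in simp)
  have "F \<omega> y = (\<Sum>i\<in>I. (g i y - g i x - (y - x) * g' i x) * \<xi> i \<omega>)"
  proof -
    have "(\<Sum>i\<in>I. (g i y - g i x - (y - x) * g' i x) * \<xi> i \<omega>) = F \<omega> y - F \<omega> x - (y - x) * F' \<omega> x"
      by (simp add: F_def F'_def algebra_simps sum_subtractf sum.distrib sum_distrib_left)
    then show ?thesis using zero by simp
  qed
  also have "\<bar>\<dots>\<bar> \<le> (\<Sum>i\<in>I. \<bar>(g i y - g i x - (y - x) * g' i x) * \<xi> i \<omega>\<bar>)" by (rule sum_abs)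
  also have "\<dots> \<le> (\<Sum>i\<in>I. (K * (y - x)\<^sup>2) * \<bar>\<xi> i \<omega>\<bar>)"
    unfolding abs_mult using taylor by (intro sum_mono mult_right_mono) auto
  also have "\<dots> = K * (\<Sum>i\<in>I. \<bar>\<xi> i \<omega>\<bar>) * (y - x)\<^sup>2" by (simp add: sum_distrib_left mult_ac)
  finally show ?thesis .
qed

text \<open>
  Bulinskaya's argument. A double zero makes \<open>F\<close> as small as a constant times the squared mesh at a neighbouring grid point
  (\<open>near_double_zero\<close>). At one point this has probability of the order of the squared mesh, and there are only
  about as many points as the inverse mesh. The constant depends on the size of the coefficients, so
  the event that these are at most \<open>N\<close> is treated for every \<open>N\<close>.
\<close>

lemma no_double_zero_AE: "AE \<omega> in M. \<forall>x\<in>{lo..hi}. F \<omega> x = 0 \<longrightarrow> F' \<omega> x \<noteq> 0"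
proof -
  obtain K v0 where K: "0 < K" "0 < v0"
    "\<And>i x. i \<in> I \<Longrightarrow> x \<in> {lo..hi} \<Longrightarrow> \<bar>g i x\<bar> \<le> K \<and> \<bar>g' i x\<bar> \<le> K \<and> \<bar>g'' i x\<bar> \<le> K"
    "\<And>x. x \<in> {lo..hi} \<Longrightarrow> v0 \<le> cov (gvec x) (gvec x)"
    using uniform_bounds by blast
  have "AE \<omega> in M. (\<Sum>i\<in>I. \<bar>\<xi> i \<omega>\<bar>) \<le> real N \<longrightarrow> (\<forall>x\<in>{lo..hi}. F \<omega> x = 0 \<longrightarrow> F' \<omega> x \<noteq> 0)" for N
  proof -
    define \<delta> where "\<delta> = (\<lambda>m. (hi - lo) / real m)"
    define \<epsilon> where "\<epsilon> = (\<lambda>m. K * real N * (\<delta> m)\<^sup>2)"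
    define B where "B = (\<lambda>m. \<Union>j\<in>{..<Suc m}. {\<omega> \<in> space M. \<bar>F \<omega> (pt m j)\<bar> \<le> \<epsilon> m})"
    have [measurable]: "B m \<in> sets M" for m unfolding B_def by measurable
    have "prob (B m) \<le> real (Suc m) * (\<epsilon> m / sqrt v0)" if "0 < m" for m
    proof -
      have "prob (B m) \<le> (\<Sum>j<Suc m. prob {\<omega> \<in> space M. \<bar>F \<omega> (pt m j)\<bar> \<le> \<epsilon> m})"
        unfolding B_def by (rule finite_measure_subadditive_finite) auto
      also have "\<dots> \<le> (\<Sum>j<Suc m. \<epsilon> m / sqrt v0)"
      proof (rule sum_mono)
        fix j assume "j \<in> {..<Suc m}"
        then have gr: "pt m j \<in> {lo..hi}" using lo_less_hi by (intro grid_in) auto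
        define v where "v = cov (\<lambda>i. g i (pt m j)) (\<lambda>i. g i (pt m j))"
        have v: "v0 \<le> v" using K(4)[OF gr] by (simp add: v_def)
        have e: "0 \<le> \<epsilon> m" using K by (simp add: \<epsilon>_def)
        have "prob {\<omega> \<in> space M. \<bar>F \<omega> (pt m j)\<bar> \<le> \<epsilon> m} \<le> \<epsilon> m / sqrt v"
          using v K e by (intro centered_normal_small_ball) (auto simp: v_def F_normal_single)
        also have "\<dots> \<le> \<epsilon> m / sqrt v0" using v K e by (intro divide_left_mono) auto
        finally show "prob {\<omega> \<in> space M. \<bar>F \<omega> (pt m j)\<bar> \<le> \<epsilon> m} \<le> \<epsilon> m / sqrt v0" .
      qed
      finally show ?thesis by simp
    qed
    then have le: "\<forall>\<^sub>F m in sequentially. prob (B m) \<le> real (Suc m) * (\<epsilon> m / sqrt v0)"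
      by (intro eventually_mono[OF eventually_gt_at_top[of 0]])
    have "(\<lambda>m. K * real N * (hi - lo)\<^sup>2 / sqrt v0 * ((1 / real m) * (1 + 1 / real m))) \<longlonglongrightarrow> K * real N * (hi - lo)\<^sup>2 / sqrt v0 * (0 * (1 + 0))"
      by (intro tendsto_intros lim_1_over_n)
    then have lim: "(\<lambda>m. real (Suc m) * (\<epsilon> m / sqrt v0)) \<longlonglongrightarrow> 0"
      by (rule Lim_transform_eventually[OF _ eventually_mono[OF eventually_gt_at_top[of 0]], THEN tendsto_eq_rhs])
        (auto simp: \<epsilon>_def \<delta>_def field_simps power2_eq_square)
    have B0: "(\<lambda>m. prob (B m)) \<longlonglongrightarrow> 0"
      by (rule tendsto_sandwich[OF _ le tendsto_const lim]) simp
    have "prob (\<Inter>m\<in>{1..}. B m) \<le> prob (B m)" if "1 \<le> m" for m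
      using that by (intro finite_measure_mono) auto
    then have "prob (\<Inter>m\<in>{1..}. B m) \<le> 0"
      by (intro tendsto_lowerbound[OF B0]) (auto intro!: eventually_mono[OF eventually_ge_at_top[of 1]])
    then have null: "emeasure M (\<Inter>m\<in>{1..}. B m) = 0" by (simp add: emeasure_eq_measure measure_le_0_iff)
    show ?thesis
    proof (rule AE_I[OF _ null])
      show "{\<omega> \<in> space M. \<not> ((\<Sum>i\<in>I. \<bar>\<xi> i \<omega>\<bar>) \<le> real N \<longrightarrow> (\<forall>x\<in>{lo..hi}. F \<omega> x = 0 \<longrightarrow> F' \<omega> x \<noteq> 0))} \<subseteq> (\<Inter>m\<in>{1..}. B m)"
      proof (intro subsetI INT_I)
        fix \<omega> and m :: nat
        assume bad: "\<omega> \<in> {\<omega> \<in> space M. \<not> ((\<Sum>i\<in>I. \<bar>\<xi> i \<omega>\<bar>) \<le> real N \<longrightarrow> (\<forall>x\<in>{lo..hi}. F \<omega> x = 0 \<longrightarrow> F' \<omega> x \<noteq> 0))}"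
          and "m \<in> {1..}"
        from bad have \<omega>: "\<omega> \<in> space M" "(\<Sum>i\<in>I. \<bar>\<xi> i \<omega>\<bar>) \<le> real N" by auto
        from bad obtain x where x: "x \<in> {lo..hi}" "F \<omega> x = 0" "F' \<omega> x = 0" by auto
        have m: "0 < m" using \<open>m \<in> {1..}\<close> by auto
        obtain j where j: "j < Suc m" "\<bar>pt m j - x\<bar> \<le> \<delta> m"
        proof (cases "x = hi")
          case True
          then show thesis using that[of m] m lo_less_hi by (simp add: \<delta>_def)
        next
          case False
          then obtain j where "j < m" "pt m j \<le> x" "x < pt m (Suc j)"
            using grid_cell[of lo hi x m] lo_less_hi x(1) m by auto
          then show thesis using that[of j] by (auto simp: grid_Suc \<delta>_def)
        qed
        have gr: "pt m j \<in> {lo..hi}" using j lo_less_hi by (intro grid_in) auto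
        have "\<bar>F \<omega> (pt m j)\<bar> \<le> K * (\<Sum>i\<in>I. \<bar>\<xi> i \<omega>\<bar>) * (pt m j - x)\<^sup>2"
          using K by (intro near_double_zero x gr) auto
        also have "(pt m j - x)\<^sup>2 = \<bar>pt m j - x\<bar>\<^sup>2" by simp
        also have "K * (\<Sum>i\<in>I. \<bar>\<xi> i \<omega>\<bar>) * \<bar>pt m j - x\<bar>\<^sup>2 \<le> K * real N * (\<delta> m)\<^sup>2"
          using K(1) \<omega> j by (intro mult_mono power_mono mult_left_mono mult_nonneg_nonneg sum_nonneg) auto
        finally show "\<omega> \<in> B m" using \<omega>(1) j(1) by (auto simp: B_def \<epsilon>_def)
      qed
    qed measurable
  qed
  then have "AE \<omega> in M. \<forall>N. (\<Sum>i\<in>I. \<bar>\<xi> i \<omega>\<bar>) \<le> real N \<longrightarrow> (\<forall>x\<in>{lo..hi}. F \<omega> x = 0 \<longrightarrow> F' \<omega> x \<noteq> 0)"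
    by (simp only: AE_all_countable) blast
  then show ?thesis
  proof (rule eventually_mono)
    fix \<omega>
    assume all: "\<forall>N. (\<Sum>i\<in>I. \<bar>\<xi> i \<omega>\<bar>) \<le> real N \<longrightarrow> (\<forall>x\<in>{lo..hi}. F \<omega> x = 0 \<longrightarrow> F' \<omega> x \<noteq> 0)"
    obtain N where "(\<Sum>i\<in>I. \<bar>\<xi> i \<omega>\<bar>) \<le> real N" using real_arch_simple by blast
    then show "\<forall>x\<in>{lo..hi}. F \<omega> x = 0 \<longrightarrow> F' \<omega> x \<noteq> 0" using all by blast
  qed
qed

definition slope :: "real \<Rightarrow> real \<Rightarrow> 'i \<Rightarrow> real" where
  "slope x y i = (g i y - g i x) / (y - x)"

text \<open>
  The Gram determinant of the pair \<open>(F(x), F(y))\<close> does not change when \<open>F(y)\<close> is replaced by the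
  increment \<open>F(y) - F(x)\<close>; this extracts the factor \<open>y - x\<close> from the square root.
\<close>

lemma sign_change_prob:
  assumes xy: "x < y" and x: "x \<in> {lo..hi}"
    and c: "0 < cov (gvec x) (gvec x) + (y - x) * cov (gvec x) (slope x y)"
  shows "prob (flips x y)
    = arctan ((y - x) * (sqrt (cov (gvec x) (gvec x) * cov (slope x y) (slope x y) - (cov (gvec x) (slope x y))\<^sup>2)
        / (cov (gvec x) (gvec x) + (y - x) * cov (gvec x) (slope x y)))) / pi"
proof -
  define v where "v = cov (gvec x) (gvec x)"
  define b where "b = cov (gvec x) (slope x y)"
  define D where "D = cov (slope x y) (slope x y)"
  define \<delta> where "\<delta> = y - x"
  have gy: "(gvec y) = (\<lambda>i. g i x + \<delta> * slope x y i)" using xy by (auto simp: slope_def \<delta>_def)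
  have c_eq: "cov (gvec x) (gvec y) = v + \<delta> * b" unfolding gy cov_add_right v_def b_def ..
  have w_eq: "cov (gvec y) (gvec y) = v + 2 * \<delta> * b + \<delta>\<^sup>2 * D"
    unfolding gy cov_add_right cov_add_left cov_sym[of "slope x y" "\<lambda>i. g i x"] v_def b_def D_def
    by (simp add: algebra_simps power2_eq_square)
  have v: "0 < v" using nondegenerate[OF x] by (simp add: v_def cov_def)
  have "prob (flips x y)
    = arctan (sqrt (v * (v + 2 * \<delta> * b + \<delta>\<^sup>2 * D) - (v + \<delta> * b)\<^sup>2) / (v + \<delta> * b)) / pi"
    using F_normal[of _ x _ y, unfolded c_eq w_eq, folded v_def] v c
    by (intro centered_normal_opposite_signs(2)) (auto simp: v_def b_def \<delta>_def)
  also have "v * (v + 2 * \<delta> * b + \<delta>\<^sup>2 * D) - (v + \<delta> * b)\<^sup>2 = \<delta>\<^sup>2 * (v * D - b\<^sup>2)"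
    by (simp add: algebra_simps power2_eq_square)
  also have "sqrt (\<delta>\<^sup>2 * (v * D - b\<^sup>2)) = \<delta> * sqrt (v * D - b\<^sup>2)" using xy by (simp add: real_sqrt_mult \<delta>_def)
  finally show ?thesis by (simp add: v_def b_def D_def \<delta>_def)
qed

lemma expected_sign_changes:
  "(\<integral>\<^sup>+\<omega>. of_nat (sign_changes (F \<omega>) lo hi m) \<partial>M)
    = ennreal (\<Sum>j<m. prob (flips (pt m j) (pt m (Suc j))))"
proof -
  let ?S = "\<lambda>j. (flips (pt m j) (pt m (Suc j)))"
  have "(of_nat (sign_changes (F \<omega>) lo hi m) :: ennreal) = (\<Sum>j<m. indicator (?S j) \<omega>)" if "\<omega> \<in> space M" for \<omega>
  proof -
    have "(\<Sum>j<m. indicator (?S j) \<omega> :: ennreal) = (\<Sum>j\<in>{j. j < m \<and> F \<omega> (pt m j) * F \<omega> (pt m (Suc j)) < 0}. 1)"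
      using that by (intro sum.mono_neutral_cong_right) (auto simp: indicator_def)
    then show ?thesis by (simp add: sign_changes_def)
  qed
  then have "(\<integral>\<^sup>+\<omega>. of_nat (sign_changes (F \<omega>) lo hi m) \<partial>M) = (\<integral>\<^sup>+\<omega>. (\<Sum>j<m. indicator (?S j) \<omega>) \<partial>M)"
    by (intro nn_integral_cong) simp
  also have "\<dots> = (\<Sum>j<m. emeasure M (?S j))" by (subst nn_integral_sum) auto
  finally show ?thesis by (simp add: emeasure_eq_measure sum_ennreal)
qed

lemma slope_tendsto:
  assumes s: "s \<longlonglongrightarrow> x" and t: "t \<longlonglongrightarrow> x" and lt: "\<And>m :: nat. s m < t m"
  shows "(\<lambda>m. slope (s m) (t m) i) \<longlonglongrightarrow> g' i x"
proof -
  have "\<exists>z. s m < z \<and> z < t m \<and> slope (s m) (t m) i = g' i z" for m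
    using MVT2[OF lt[of m], of "g i" "g' i"] g_deriv lt[of m] by (auto simp: slope_def)
  then obtain z where z: "\<And>m. s m < z m \<and> z m < t m \<and> slope (s m) (t m) i = g' i (z m)" by metis
  have "z \<longlonglongrightarrow> x"
    by (rule tendsto_sandwich[OF _ _ s t]) (use z in \<open>auto intro!: eventuallyI less_imp_le\<close>)
  then have "(\<lambda>m. g' i (z m)) \<longlonglongrightarrow> g' i x" by (rule isCont_tendsto_compose[OF g'_cont])
  then show ?thesis using z by simp
qed

text \<open>
  The sum of the cell probabilities is the integral of the step function that takes on each cell the probability
  of a sign change per unit length. The step functions converge pointwise to the intensity and are bounded uniformly,
  because the covariance of the two endpoint values stays away from \<open>0\<close> on short cells.
\<close>

lemma sum_sign_change_prob_tendsto:
  "(\<lambda>m. \<Sum>j<m. prob (flips (pt m j) (pt m (Suc j))))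
     \<longlonglongrightarrow> (LINT x:{lo..hi}|lborel. intensity x)"
proof -
  define P where "P = (\<lambda>m j. prob (flips (pt m j) (pt m (Suc j))))"
  define \<delta> where "\<delta> = (\<lambda>m. (hi - lo) / real m)"
  define H where "H = (\<lambda>m x. \<Sum>j<m. P m j / \<delta> m * indicator {pt m j..<pt m (Suc j)} x)"
  obtain K v0 where K: "0 < K" "0 < v0"
    "\<And>i x. i \<in> I \<Longrightarrow> x \<in> {lo..hi} \<Longrightarrow> \<bar>g i x\<bar> \<le> K \<and> \<bar>g' i x\<bar> \<le> K \<and> \<bar>g'' i x\<bar> \<le> K"
    "\<And>x. x \<in> {lo..hi} \<Longrightarrow> v0 \<le> cov (gvec x) (gvec x)"
    using uniform_bounds by blast
  define S where "S = (\<Sum>i\<in>I. \<Sum>j\<in>I. \<bar>R i j\<bar>) * (K * K)"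
  have S: "0 \<le> S" using K by (auto simp: S_def intro!: mult_nonneg_nonneg sum_nonneg)
  have \<delta>0: "\<delta> \<longlonglongrightarrow> 0" unfolding \<delta>_def by (rule lim_const_over_n)
  have "(\<lambda>m. \<delta> m * S) \<longlonglongrightarrow> 0" using tendsto_mult[OF \<delta>0 tendsto_const[of S]] by simp
  then have "\<forall>\<^sub>F m in sequentially. \<delta> m * S < v0 / 2" using K(2) by (intro order_tendstoD) auto
  then obtain m0 where m0: "\<And>m. m \<ge> m0 \<Longrightarrow> \<delta> m * S < v0 / 2" by (auto simp: eventually_sequentially)
  define B where "B = S / (v0 / 2)"

  \<comment> \<open>For m \<ge> m0 the covariance of the endpoint values is at least v0 / 2, and B bounds the step function.\<close>
  have slope_le: "\<bar>slope x y i\<bar> \<le> K" if i: "i \<in> I" and xy: "x \<in> {lo..hi}" "y \<in> {lo..hi}" "x < y" for x y i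
  proof -
    obtain z where "x < z" "z < y" "g i y - g i x = (y - x) * g' i z"
      using MVT2[OF xy(3), of "g i" "g' i"] g_deriv by blast
    then show ?thesis using K(3)[OF i, of z] xy by (simp add: slope_def)
  qed
  have cell: "0 < cov (gvec x) (gvec x) + (y - x) * cov (gvec x) (slope x y)
      \<and> prob (flips x y) / \<delta> m \<le> B"
    if "m \<ge> m0" "0 < m" "x \<in> {lo..hi}" "y \<in> {lo..hi}" "y = x + \<delta> m" for m x y
  proof -
    have d: "\<delta> m > 0" using that lo_less_hi by (simp add: \<delta>_def)
    then have xy: "x < y" "y - x = \<delta> m" using that by auto
    define v where "v = cov (gvec x) (gvec x)"
    define b where "b = cov (gvec x) (slope x y)"
    define D where "D = cov (slope x y) (slope x y)"
    have g_le: "\<bar>g i x\<bar> \<le> K" if "i \<in> I" for i using K(3)[OF that \<open>x \<in> {lo..hi}\<close>] by simp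
    have sl: "\<bar>slope x y i\<bar> \<le> K" if "i \<in> I" for i using slope_le[OF that \<open>x \<in> _\<close> \<open>y \<in> _\<close> xy(1)] .
    have vS: "\<bar>v\<bar> \<le> S" and bS: "\<bar>b\<bar> \<le> S" and DS: "\<bar>D\<bar> \<le> S"
      unfolding v_def b_def D_def S_def by (intro cov_bound g_le sl; assumption)+
    have "\<bar>\<delta> m * b\<bar> \<le> \<delta> m * S" using d bS by (simp add: abs_mult mult_left_mono)
    then have c: "v0 / 2 \<le> v + \<delta> m * b"
      using m0[OF that(1)] K(4)[OF that(3)] unfolding v_def[symmetric] by linarith
    then have c0: "0 < v + \<delta> m * b" using K(2) by linarith
    have "prob (flips x y) = arctan (\<delta> m * (sqrt (v * D - b\<^sup>2) / (v + \<delta> m * b))) / pi"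
      using sign_change_prob[OF xy(1) that(3)] c0 unfolding xy(2) v_def b_def D_def by blast
    also have "\<dots> \<le> \<delta> m * B"
    proof -
      have "v * D \<le> \<bar>v\<bar> * \<bar>D\<bar>" by (simp flip: abs_mult)
      also have "\<dots> \<le> S * S" using vS DS S by (intro mult_mono) auto
      finally have "v * D - b\<^sup>2 \<le> S * S" using zero_le_power2[of b] by linarith
      then have "sqrt (v * D - b\<^sup>2) \<le> sqrt (S * S)" by (rule real_sqrt_le_mono)
      then have sq: "sqrt (v * D - b\<^sup>2) \<le> S" using S by simp
      have "sqrt (v * D - b\<^sup>2) / (v + \<delta> m * b) \<le> S / (v + \<delta> m * b)" using sq c0 by (intro divide_right_mono) auto
      also have "\<dots> \<le> B" unfolding B_def using c K S by (intro divide_left_mono) auto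
      finally have le: "\<delta> m * (sqrt (v * D - b\<^sup>2) / (v + \<delta> m * b)) \<le> \<delta> m * B" using d by (intro mult_left_mono) auto
      have B0: "0 \<le> \<delta> m * B" using d S K by (simp add: B_def)
      have "arctan (\<delta> m * (sqrt (v * D - b\<^sup>2) / (v + \<delta> m * b))) \<le> arctan (\<delta> m * B)" using le by (simp add: arctan_le_iff)
      also have "\<dots> \<le> \<delta> m * B" using arctan_le_self[OF B0] .
      also have "\<dots> \<le> \<delta> m * B * pi"
      proof -
        have "\<delta> m * B * 1 \<le> \<delta> m * B * pi" using B0 pi_gt3 by (intro mult_left_mono) auto
        then show ?thesis by simp
      qed
      finally show ?thesis by (simp only: pos_divide_le_eq[OF pi_gt_zero])
    qed
    finally have "prob (flips x y) / \<delta> m \<le> (\<delta> m * B) / \<delta> m"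
      using d by (intro divide_right_mono) auto
    also have "(\<delta> m * B) / \<delta> m = B" using d by simp
    finally have "prob (flips x y) / \<delta> m \<le> B" .
    moreover have "0 < cov (gvec x) (gvec x) + (y - x) * cov (gvec x) (slope x y)"
      using c0 by (simp only: xy(2) v_def b_def)
    ultimately show ?thesis by (rule conjI[rotated])
  qed

  have H_cell: "H m x = P m j / \<delta> m" if "j < m" "pt m j \<le> x" "x < pt m (Suc j)" for m j x
  proof -
    have "H m x = (\<Sum>k<m. if k = j then P m j / \<delta> m else 0)"
      unfolding H_def
    proof (intro sum.cong refl)
      fix k
      show "P m k / \<delta> m * indicator {pt m k..<pt m (Suc k)} x = (if k = j then P m j / \<delta> m else 0)"
      proof (cases "k = j")
        case True
        then show ?thesis using that(2,3) by simp
      next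
        case False
        then have "x \<notin> {pt m k..<pt m (Suc k)}"
          using that(2,3) grid_cell_unique[OF less_imp_le[OF lo_less_hi], of m k x j] by auto
        then show ?thesis using False by simp
      qed
    qed
    then show ?thesis using that by simp
  qed
  have H_out: "H m x = 0" if "x \<notin> {lo..<hi}" for m x
  proof -
    have "x \<notin> {pt m j..<pt m (Suc j)}" if "j < m" for j
      using grid_in[of lo hi j m] grid_in[of lo hi "Suc j" m] that \<open>x \<notin> {lo..<hi}\<close> lo_less_hi by auto
    then show ?thesis unfolding H_def by (intro sum.neutral) auto
  qed
  have cellE: "\<exists>j. j < m \<and> pt m j \<le> x \<and> x < pt m (Suc j)" if "x \<in> {lo..<hi}" "0 < m" for m x
    using grid_cell[of lo hi x m] lo_less_hi that by auto
  have gr: "pt m j \<in> {lo..hi}" "pt m (Suc j) \<in> {lo..hi}" "pt m (Suc j) = pt m j + \<delta> m"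
    if "j < m" for m j
    using that lo_less_hi grid_in[of lo hi j m] grid_in[of lo hi "Suc j" m] by (simp_all add: grid_Suc \<delta>_def)

  have lim: "(\<lambda>m. H m x) \<longlonglongrightarrow> indicator {lo..<hi} x * intensity x" for x
  proof (cases "x \<in> {lo..<hi}")
    case False
    then show ?thesis using H_out[OF False] by simp
  next
    case True
    define m1 where "m1 = Suc m0"
    have "\<exists>j. j < m + m1 \<and> pt (m + m1) j \<le> x \<and> x < pt (m + m1) (Suc j)" for m
      by (rule cellE[OF True]) (simp add: m1_def)
    then obtain J where J: "\<And>m. J m < m + m1 \<and> pt (m + m1) (J m) \<le> x \<and> x < pt (m + m1) (Suc (J m))"
      by metis
    define s where "s = (\<lambda>m. pt (m + m1) (J m))"
    define t where "t = (\<lambda>m. pt (m + m1) (Suc (J m)))"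
    have st: "s m \<in> {lo..hi}" "t m \<in> {lo..hi}" "t m = s m + \<delta> (m + m1)" for m
      using gr[of "J m" "m + m1"] J[of m] by (auto simp: s_def t_def)
    have lt: "s m < t m" for m using J[of m] by (auto simp: s_def t_def)
    have \<delta>1: "(\<lambda>m. \<delta> (m + m1)) \<longlonglongrightarrow> 0" by (rule LIMSEQ_ignore_initial_segment[OF \<delta>0])
    have sx: "s m \<le> x" "x < t m" for m using J[of m] by (auto simp: s_def t_def)
    have s_lim: "s \<longlonglongrightarrow> x"
    proof (rule tendsto_sandwich)
      show "(\<lambda>m. x - \<delta> (m + m1)) \<longlonglongrightarrow> x" using tendsto_diff[OF tendsto_const[of x] \<delta>1] by simp
      show "\<forall>\<^sub>F m in sequentially. x - \<delta> (m + m1) \<le> s m"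
      proof (rule always_eventually, rule allI)
        fix m show "x - \<delta> (m + m1) \<le> s m" using sx(2)[of m] st(3)[of m] by linarith
      qed
      show "\<forall>\<^sub>F m in sequentially. s m \<le> x" using sx(1) by simp
    qed (rule tendsto_const)
    have t_lim: "t \<longlonglongrightarrow> x"
    proof -
      have "t = (\<lambda>m. s m + \<delta> (m + m1))" using st(3) by (rule ext)
      then show ?thesis using tendsto_add[OF s_lim \<delta>1] by simp
    qed
    define v where "v = (\<lambda>m. cov (gvec (s m)) (gvec (s m)))"
    define b where "b = (\<lambda>m. cov (gvec (s m)) (slope (s m) (t m)))"
    define D where "D = (\<lambda>m. cov (slope (s m) (t m)) (slope (s m) (t m)))"
    have gs: "(\<lambda>m. g i (s m)) \<longlonglongrightarrow> g i x" for i by (rule isCont_tendsto_compose[OF g_cont s_lim])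
    have v_lim: "v \<longlonglongrightarrow> cov (gvec x) (gvec x)" unfolding v_def by (rule cov_tendsto[where u="\<lambda>m i. g i (s m)" and w="\<lambda>m i. g i (s m)"]) (rule gs)+
    have b_lim: "b \<longlonglongrightarrow> cov (gvec x) (gvec' x)"
      unfolding b_def by (rule cov_tendsto[where u="\<lambda>m i. g i (s m)" and w="\<lambda>m. slope (s m) (t m)"])
        (rule gs, rule slope_tendsto[OF s_lim t_lim lt])
    have D_lim: "D \<longlonglongrightarrow> cov (gvec' x) (gvec' x)"
      unfolding D_def by (rule cov_tendsto[where u="\<lambda>m. slope (s m) (t m)" and w="\<lambda>m. slope (s m) (t m)"])
        (rule slope_tendsto[OF s_lim t_lim lt])+
    have v0: "cov (gvec x) (gvec x) \<noteq> 0" using nondegenerate[of x] True by (auto simp: cov_def)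
    define r where "r = (\<lambda>m. sqrt (v m * D m - (b m)\<^sup>2) / (v m + \<delta> (m + m1) * b m))"
    define r0 where "r0 = sqrt (cov (gvec x) (gvec x) * cov (gvec' x) (gvec' x) - (cov (gvec x) (gvec' x))\<^sup>2)
        / (cov (gvec x) (gvec x) + 0 * cov (gvec x) (gvec' x))"
    have "r \<longlonglongrightarrow> r0"
      unfolding r_def r0_def
      by (intro tendsto_divide tendsto_real_sqrt tendsto_diff tendsto_mult tendsto_power tendsto_add v_lim b_lim D_lim \<delta>1)
        (use v0 in simp)
    moreover have "\<forall>\<^sub>F m in sequentially. \<delta> (m + m1) \<noteq> 0"
    proof (rule always_eventually, rule allI)
      fix m show "\<delta> (m + m1) \<noteq> 0" using lt[of m] st(3)[of m] by linarith
    qed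
    ultimately have "(\<lambda>m. arctan (\<delta> (m + m1) * r m) / \<delta> (m + m1)) \<longlonglongrightarrow> r0"
      by (rule arctan_ratio_tendsto[OF _ \<delta>1])
    then have "(\<lambda>m. arctan (\<delta> (m + m1) * r m) / \<delta> (m + m1) / pi) \<longlonglongrightarrow> r0 / pi"
      by (intro tendsto_divide tendsto_const) auto
    moreover have "H (m + m1) x = arctan (\<delta> (m + m1) * r m) / \<delta> (m + m1) / pi" for m
    proof -
      have ts: "t m - s m = \<delta> (m + m1)" using st(3)[of m] by simp
      have "0 < v m + (t m - s m) * b m"
        using cell[OF _ _ st(1) st(2) st(3)] by (simp add: m1_def v_def b_def)
      then have "prob (flips (s m) (t m)) = arctan (\<delta> (m + m1) * r m) / pi"
        unfolding r_def ts[symmetric] v_def b_def D_def by (rule sign_change_prob[OF lt st(1)])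
      then have "P (m + m1) (J m) = arctan (\<delta> (m + m1) * r m) / pi"
        by (simp only: P_def s_def t_def)
      then show ?thesis using H_cell[of "J m" "m + m1" x] J[of m] by simp
    qed
    moreover have "r0 / pi = intensity x" by (simp add: r0_def intensity_def mult.commute)
    ultimately have "(\<lambda>m. H (m + m1) x) \<longlonglongrightarrow> intensity x" by simp
    then show ?thesis using True using LIMSEQ_offset[of "\<lambda>m. H m x" m1] by simp
  qed

  have H_bound: "\<bar>H (m + Suc m0) x\<bar> \<le> indicator {lo..<hi} x * B" for m x
  proof (cases "x \<in> {lo..<hi}")
    case False
    then show ?thesis using H_out[OF False] by simp
  next
    case True
    obtain j where j: "j < m + Suc m0" "pt (m + Suc m0) j \<le> x" "x < pt (m + Suc m0) (Suc j)"
      using cellE[OF True, of "m + Suc m0"] by auto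
    have "0 \<le> P (m + Suc m0) j / \<delta> (m + Suc m0)" using lo_less_hi by (simp add: P_def \<delta>_def)
    moreover have "P (m + Suc m0) j / \<delta> (m + Suc m0) \<le> B"
      using cell[OF _ _ gr[OF j(1)]] by (simp add: P_def)
    ultimately show ?thesis using H_cell[OF j] True by simp
  qed
  have [measurable]: "intensity \<in> borel_measurable borel" unfolding intensity_def[abs_def] cov_def by measurable
  have int_ind: "integrable lborel (\<lambda>x. indicator {lo..<hi} x * B)" by (intro integrable_mult_left) (simp add: lo_less_hi less_imp_le)
  have "(\<lambda>m. integral\<^sup>L lborel (H (m + Suc m0))) \<longlonglongrightarrow> (LINT x|lborel. indicator {lo..<hi} x * intensity x)"
  proof (rule integral_dominated_convergence)
    show "integrable lborel (\<lambda>x. indicator {lo..<hi} x * B)" by (rule int_ind)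
    show "AE x in lborel. norm (H (m + Suc m0) x) \<le> indicator {lo..<hi} x * B" for m using H_bound by auto
    show "AE x in lborel. (\<lambda>m. H (m + Suc m0) x) \<longlonglongrightarrow> indicator {lo..<hi} x * intensity x"
      by (rule AE_I2) (rule LIMSEQ_ignore_initial_segment[OF lim])
    show "H (m + Suc m0) \<in> borel_measurable lborel" for m unfolding H_def by measurable
  qed measurable
  moreover have "integral\<^sup>L lborel (H m) = (\<Sum>j<m. P m j)" if "0 < m" for m
  proof -
    have d: "\<delta> m > 0" using that lo_less_hi by (simp add: \<delta>_def)
    have "integral\<^sup>L lborel (H m) = (\<Sum>j<m. (LINT x|lborel. P m j / \<delta> m * indicator {pt m j..<pt m (Suc j)} x))"
      unfolding H_def using gr(3) d by (intro Bochner_Integration.integral_sum integrable_mult_right) auto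
    also have "\<dots> = (\<Sum>j<m. P m j)"
    proof (intro sum.cong refl)
      fix j assume "j \<in> {..<m}"
      then have "pt m (Suc j) = pt m j + \<delta> m" using gr(3) by simp
      then show "(LINT x|lborel. P m j / \<delta> m * indicator {pt m j..<pt m (Suc j)} x) = P m j"
        using d by simp
    qed
    finally show ?thesis .
  qed
  ultimately have "(\<lambda>m. \<Sum>j<m + Suc m0. P (m + Suc m0) j) \<longlonglongrightarrow> (LINT x|lborel. indicator {lo..<hi} x * intensity x)"
    by simp
  then have "(\<lambda>m. \<Sum>j<m. P m j) \<longlonglongrightarrow> (LINT x|lborel. indicator {lo..<hi} x * intensity x)" by (rule LIMSEQ_offset)
  also have "(LINT x|lborel. indicator {lo..<hi} x * intensity x) = (LINT x:{lo..hi}|lborel. intensity x)"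
    unfolding set_lebesgue_integral_def
  proof (rule integral_cong_AE)
    have "AE x in lborel. x \<noteq> hi" by (rule AE_lborel_singleton)
    then show "AE x in lborel. indicator {lo..<hi} x * intensity x = indicat_real {lo..hi} x *\<^sub>R intensity x"
      by eventually_elim (auto simp: indicator_def)
  qed measurable
  finally show ?thesis by (simp add: P_def)
qed

text \<open>
  The zeros dominate the sign changes on every grid, which gives the lower bound. Fatou's lemma, applied to the
  numbers of sign changes, gives the upper bound.
\<close>

theorem expected_zero_count:
  "(\<integral>\<^sup>+\<omega>. zero_count (F \<omega>) lo hi \<partial>M) = ennreal (LINT x:{lo..hi}|lborel. intensity x)"
proof (rule antisym)
  let ?N = "\<lambda>m. (\<integral>\<^sup>+\<omega>. of_nat (sign_changes (F \<omega>) lo hi m) \<partial>M)"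
  have meas: "(\<lambda>\<omega>. of_nat (sign_changes (F \<omega>) lo hi m) :: ennreal) \<in> borel_measurable M" for m
  proof -
    have "(\<lambda>\<omega>. of_nat (sign_changes (F \<omega>) lo hi m) :: ennreal) = (\<lambda>\<omega>. \<Sum>j<m. if F \<omega> (pt m j) * F \<omega> (pt m (Suc j)) < 0 then 1 else 0)"
      by (auto simp: sign_changes_def sum.If_cases Int_def intro!: arg_cong[where f="\<lambda>A. of_nat (card A)"])
    then show ?thesis by simp
  qed
  have lim: "?N \<longlonglongrightarrow> ennreal (LINT x:{lo..hi}|lborel. intensity x)"
    unfolding expected_sign_changes by (intro tendsto_ennrealI sum_sign_change_prob_tendsto)
  have "AE \<omega> in M. \<forall>m j. j \<le> m \<longrightarrow> F \<omega> (pt m j) \<noteq> 0"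
    using lo_less_hi by (intro AE_all_countable[THEN iffD2] allI) (auto intro!: F_nonzero_AE grid_in simp del: atLeastAtMost_iff)
  then have "AE \<omega> in M. zero_count (F \<omega>) lo hi \<le> liminf (\<lambda>m. of_nat (sign_changes (F \<omega>) lo hi m))"
    using no_double_zero_AE
    by eventually_elim (intro zero_count_le_liminf_sign_changes[OF lo_less_hi F_deriv]; blast)
  then have "(\<integral>\<^sup>+\<omega>. zero_count (F \<omega>) lo hi \<partial>M) \<le> (\<integral>\<^sup>+\<omega>. liminf (\<lambda>m. of_nat (sign_changes (F \<omega>) lo hi m)) \<partial>M)"
    by (rule nn_integral_mono_AE)
  also have "\<dots> \<le> liminf ?N" by (rule nn_integral_liminf) (rule meas)
  also have "\<dots> = ennreal (LINT x:{lo..hi}|lborel. intensity x)"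
    by (rule lim_imp_Liminf[OF _ lim]) simp
  finally show "(\<integral>\<^sup>+\<omega>. zero_count (F \<omega>) lo hi \<partial>M) \<le> ennreal (LINT x:{lo..hi}|lborel. intensity x)" .
  have "?N m \<le> (\<integral>\<^sup>+\<omega>. zero_count (F \<omega>) lo hi \<partial>M)" for m
    using lo_less_hi by (intro nn_integral_mono sign_changes_le_zero_count)
      (auto intro!: continuous_at_imp_continuous_on DERIV_isCont[OF F_deriv])
  then show "ennreal (LINT x:{lo..hi}|lborel. intensity x) \<le> (\<integral>\<^sup>+\<omega>. zero_count (F \<omega>) lo hi \<partial>M)"
    by (intro LIMSEQ_le_const2[OF lim]) auto
qed

end

section \<open>Dirichlet sums and their windowed integrals\<close>

definition kernel :: "(nat \<Rightarrow> real) \<Rightarrow> nat \<Rightarrow> real \<Rightarrow> real" where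
  "kernel c n t = (cmod (\<Sum>k=1..n. complex_of_real (c k) * cis (real k * t)))\<^sup>2"

text \<open>
  With unit weights this is \<open>n\<close> times the classical Fejer kernel; with weights \<open>k\<close> it is the squared modulus of the
  derivative of the Dirichlet sum.
\<close>

abbreviation fejer :: "nat \<Rightarrow> real \<Rightarrow> real" where "fejer \<equiv> kernel (\<lambda>_. 1)"
abbreviation fejer' :: "nat \<Rightarrow> real \<Rightarrow> real" where "fejer' \<equiv> kernel real"

abbreviation window :: "real \<Rightarrow> real \<Rightarrow> (real \<Rightarrow> real) \<Rightarrow> real" where
  "window \<alpha> x f \<equiv> integral {x - \<alpha>..x + \<alpha>} f"

lemma kernel_nonneg: "0 \<le> kernel c n t"
  by (simp add: kernel_def)

lemma kernel_eq_sum: "kernel c n t = (\<Sum>k=1..n. \<Sum>l=1..n. c k * c l * cos ((real k - real l) * t))"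
proof -
  let ?z = "\<Sum>k=1..n. complex_of_real (c k) * cis (real k * t)"
  have "kernel c n t = Re (?z * cnj ?z)"
    by (simp only: kernel_def complex_norm_square[symmetric] Re_complex_of_real)
  also have "?z * cnj ?z = (\<Sum>k=1..n. \<Sum>l=1..n. (complex_of_real (c k) * cis (real k * t)) * cnj (complex_of_real (c l) * cis (real l * t)))"
    unfolding cnj_sum sum_product ..
  also have "Re \<dots> = (\<Sum>k=1..n. \<Sum>l=1..n. c k * c l * cos ((real k - real l) * t))"
    unfolding Re_sum by (intro sum.cong refl) (simp add: left_diff_distrib cos_diff algebra_simps)
  finally show ?thesis .
qed

lemma kernel_cont: "continuous_on S (kernel c n)"
  unfolding kernel_eq_sum[abs_def] by (intro continuous_intros)

lemma kernel_integrable: "kernel c n integrable_on {a..b}"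
  by (rule integrable_continuous_interval[OF kernel_cont])

lemma cmod_cis_diff: "(cmod (cis a - cis b))\<^sup>2 = 4 * (sin ((a - b) / 2))\<^sup>2"
proof -
  have "(cmod (cis a - cis b))\<^sup>2 = (cos a - cos b)\<^sup>2 + (sin a - sin b)\<^sup>2" by (simp add: cmod_power2)
  also have "\<dots> = 2 - 2 * cos (a - b)"
    using sin_cos_squared_add[of a] sin_cos_squared_add[of b] by (simp add: cos_diff power2_eq_square algebra_simps)
  also have "cos (a - b) = 1 - 2 * (sin ((a - b) / 2))\<^sup>2"
  proof -
    have "cos (2 * ((a - b) / 2)) = 1 - 2 * (sin ((a - b) / 2))\<^sup>2" by (rule cos_double_sin)
    moreover have "2 * ((a - b) / 2) = a - b" by simp
    ultimately show ?thesis by (simp only:)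
  qed
  finally show ?thesis by simp
qed

lemma dirichlet_telescope:
  "(\<Sum>k=1..n. cis (real k * t)) * (cis t - 1) = cis ((real n + 1) * t) - cis t"
proof (induction n)
  case (Suc n)
  have "cis ((real n + 1) * t) * cis t = cis ((real (Suc n) + 1) * t)" by (simp add: cis_mult algebra_simps)
  then show ?case using Suc by (simp add: algebra_simps)
qed simp

lemma dirichlet'_telescope:
  "(\<Sum>k=1..n. complex_of_real (real k) * cis (real k * t)) * (cis t - 1)
    = of_nat n * cis ((real n + 1) * t) - (\<Sum>k=1..n. cis (real k * t))"
proof (induction n)
  case (Suc n)
  have "cis ((real n + 1) * t) * cis t = cis ((real (Suc n) + 1) * t)" by (simp add: cis_mult algebra_simps)
  then show ?case using Suc by (simp add: algebra_simps)
qed simp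

lemma fejer_mult_sin: "fejer n t * (sin (t / 2))\<^sup>2 = (sin (real n * t / 2))\<^sup>2"
proof -
  have "fejer n t * (cmod (cis t - cis 0))\<^sup>2 = (cmod ((\<Sum>k=1..n. cis (real k * t)) * (cis t - 1)))\<^sup>2"
    by (simp add: kernel_def norm_mult power_mult_distrib)
  also have "\<dots> = (cmod (cis ((real n + 1) * t) - cis t))\<^sup>2" by (simp only: dirichlet_telescope)
  finally have "4 * (fejer n t * (sin (t / 2))\<^sup>2) = 4 * (sin (((real n + 1) * t - t) / 2))\<^sup>2"
    unfolding cmod_cis_diff by simp
  then show ?thesis by (simp add: algebra_simps)
qed

lemma cmod_weighted_sum_le:
  assumes "\<And>k. k \<in> {1..n} \<Longrightarrow> \<bar>c k\<bar> \<le> B"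
  shows "cmod (\<Sum>k=1..n. complex_of_real (c k) * cis (real k * t)) \<le> real n * B"
proof -
  have "cmod (\<Sum>k=1..n. complex_of_real (c k) * cis (real k * t)) \<le> (\<Sum>k=1..n. \<bar>c k\<bar>)"
    by (rule order.trans[OF norm_sum]) (simp add: norm_mult)
  also have "\<dots> \<le> real n * B" using sum_bounded_above[of "{1..n}" "\<lambda>k. \<bar>c k\<bar>" B] assms by simp
  finally show ?thesis .
qed

lemma fejer'_le: "fejer' n t \<le> (real n)\<^sup>2 * (real n)\<^sup>2"
  using power_mono[OF cmod_weighted_sum_le[of n real "real n" t], of 2] by (simp add: kernel_def power_mult_distrib power2_eq_square)

text \<open>
  Multiplying the weighted sum by \<open>e\<^sup>i\<^sup>t - 1\<close> leaves \<open>n e\<^sup>i\<^sup>(\<^sup>n\<^sup>+\<^sup>1\<^sup>)\<^sup>t - D(t)\<close>. Away from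
  \<open>0\<close> the Dirichlet sum \<open>D\<close> stays bounded, and the kernel is therefore \<open>n\<^sup>2 / (4 sin\<^sup>2 (t / 2))\<close> up to \<open>O(n)\<close>.
\<close>

lemma fejer'_mult_sin:
  "\<exists>r. \<bar>r\<bar> \<le> sqrt (fejer n t) \<and> 4 * (fejer' n t * (sin (t / 2))\<^sup>2) = (real n + r)\<^sup>2"
proof -
  let ?D = "\<Sum>k=1..n. cis (real k * t)"
  have "fejer' n t * (cmod (cis t - cis 0))\<^sup>2
    = (cmod ((\<Sum>k=1..n. complex_of_real (real k) * cis (real k * t)) * (cis t - 1)))\<^sup>2"
    by (simp add: kernel_def norm_mult power_mult_distrib)
  also have "\<dots> = (cmod (of_nat n * cis ((real n + 1) * t) - ?D))\<^sup>2" by (simp only: dirichlet'_telescope)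
  finally have eq: "4 * (fejer' n t * (sin (t / 2))\<^sup>2) = (cmod (of_nat n * cis ((real n + 1) * t) - ?D))\<^sup>2"
    unfolding cmod_cis_diff by simp
  have D: "sqrt (fejer n t) = cmod ?D" by (simp add: kernel_def)
  have nc: "cmod (of_nat n * cis ((real n + 1) * t)) = real n" by (simp add: norm_mult)
  show ?thesis
  proof (intro exI conjI)
    show "\<bar>cmod (of_nat n * cis ((real n + 1) * t) - ?D) - real n\<bar> \<le> sqrt (fejer n t)"
      using norm_triangle_ineq3[of "of_nat n * cis ((real n + 1) * t) - ?D" "of_nat n * cis ((real n + 1) * t)"]
      unfolding D nc by simp
    show "4 * (fejer' n t * (sin (t / 2))\<^sup>2) = (real n + (cmod (of_nat n * cis ((real n + 1) * t) - ?D) - real n))\<^sup>2"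
      unfolding eq by simp
  qed
qed

lemma fejer_le: "fejer n t \<le> (real n)\<^sup>2"
  using power_mono[OF cmod_weighted_sum_le[of n "\<lambda>_. 1" 1 t], of 2] by (simp add: kernel_def)

lemma fejer'_mult_sin_le: "fejer' n t * (sin (t / 2))\<^sup>2 \<le> (real n)\<^sup>2"
proof -
  obtain r where r: "\<bar>r\<bar> \<le> sqrt (fejer n t)" "4 * (fejer' n t * (sin (t / 2))\<^sup>2) = (real n + r)\<^sup>2"
    using fejer'_mult_sin by blast
  have "sqrt (fejer n t) \<le> real n" using fejer_le[of n t] by (simp add: real_le_lsqrt)
  then have "(real n + r)\<^sup>2 \<le> (2 * real n)\<^sup>2" using r(1) by (intro power2_le_iff_abs_le[THEN iffD2]) linarith+
  then show ?thesis using r(2) by (simp add: power2_eq_square)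
qed

definition sinc_corr :: "real \<Rightarrow> real \<Rightarrow> real" where
  "sinc_corr \<alpha> u = (if u = 0 then 1 else sin (u * \<alpha>) / (u * \<alpha>))"

lemma sinc_corr_minus: "sinc_corr \<alpha> (- u) = sinc_corr \<alpha> u"
  by (simp add: sinc_corr_def)

lemma cos_has_integral:
  assumes "0 < \<alpha>"
  shows "((\<lambda>t. cos (u * t)) has_integral 2 * \<alpha> * (sinc_corr \<alpha> u * cos (u * x))) {x - \<alpha>..x + \<alpha>}"
proof (cases "u = 0")
  case True
  then show ?thesis using has_integral_const_real[of "1::real" "x - \<alpha>" "x + \<alpha>"] assms by (simp add: sinc_corr_def)
next
  case False
  have "((\<lambda>t. cos (u * t)) has_integral sin (u * (x + \<alpha>)) / u - sin (u * (x - \<alpha>)) / u) {x - \<alpha>..x + \<alpha>}"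
    using assms False by (intro fundamental_theorem_of_calculus)
      (auto intro!: derivative_eq_intros simp flip: has_real_derivative_iff_has_vector_derivative)
  moreover have "sin (u * (x + \<alpha>)) / u - sin (u * (x - \<alpha>)) / u = 2 * \<alpha> * (sinc_corr \<alpha> u * cos (u * x))"
  proof -
    have "sin (u * (x + \<alpha>)) - sin (u * (x - \<alpha>)) = 2 * (sin (u * \<alpha>) * cos (u * x))"
      by (simp add: distrib_left right_diff_distrib sin_add sin_diff)
    then have "sin (u * (x + \<alpha>)) / u - sin (u * (x - \<alpha>)) / u = 2 * (sin (u * \<alpha>) * cos (u * x)) / u"
      by (simp only: diff_divide_distrib[symmetric])
    then show ?thesis using False assms by (simp add: sinc_corr_def)
  qed
  ultimately show ?thesis by simp
qed

text \<open>
  Averaging \<open>cos (u t)\<close> over the window multiplies \<open>cos (u x)\<close> by the correlation, so windowed kernel integrals are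
  \<open>2 \<alpha>\<close> times the variances of the random polynomial and of its derivative.
\<close>

lemma kernel_integral:
  assumes "0 < \<alpha>"
  shows "window \<alpha> x (kernel c n)
    = 2 * \<alpha> * (\<Sum>k=1..n. \<Sum>l=1..n. c k * c l * (sinc_corr \<alpha> (real k - real l) * cos ((real k - real l) * x)))"
proof (rule integral_unique)
  have "(kernel c n has_integral (\<Sum>k=1..n. \<Sum>l=1..n. c k * c l * (2 * \<alpha> * (sinc_corr \<alpha> (real k - real l) * cos ((real k - real l) * x)))))
     {x - \<alpha>..x + \<alpha>}"
    unfolding kernel_eq_sum[abs_def] by (intro has_integral_sum has_integral_mult_right cos_has_integral assms) auto
  also have "(\<Sum>k=1..n. \<Sum>l=1..n. c k * c l * (2 * \<alpha> * (sinc_corr \<alpha> (real k - real l) * cos ((real k - real l) * x))))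
    = 2 * \<alpha> * (\<Sum>k=1..n. \<Sum>l=1..n. c k * c l * (sinc_corr \<alpha> (real k - real l) * cos ((real k - real l) * x)))"
    unfolding sum_distrib_left by (intro sum.cong refl) (simp only: mult.left_commute)
  finally show "(kernel c n has_integral 2 * \<alpha> * (\<Sum>k=1..n. \<Sum>l=1..n. c k * c l * (sinc_corr \<alpha> (real k - real l) * cos ((real k - real l) * x))))
     {x - \<alpha>..x + \<alpha>}" .
qed

lemma kernel_integral_period: "integral {x - pi..x + pi} (kernel c n) = 2 * pi * (\<Sum>k=1..n. (c k)\<^sup>2)"
proof -
  have "sinc_corr pi (real k - real l) = (if k = l then 1 else 0)" for k l :: nat
  proof -
    have "sin ((real k - real l) * pi) = 0" using sin_npi_int[of "int k - int l"] by (simp add: mult.commute)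
    then show ?thesis by (simp add: sinc_corr_def)
  qed
  then have "c k * c l * (sinc_corr pi (real k - real l) * cos ((real k - real l) * x)) = (if k = l then (c k)\<^sup>2 else 0)" for k l
    by (simp add: power2_eq_square)
  then show ?thesis by (simp add: kernel_integral[OF pi_gt_zero])
qed

text \<open>
  Exchanging \<open>k\<close> and \<open>l\<close> replaces the weight \<open>l\<close> by \<open>(l - k) / 2\<close>, and \<open>u * sinc_corr \<alpha> u = sin (u \<alpha>) / \<alpha>\<close>
  cancels the denominator of the correlation. A product of two sines is left, that is, a difference of two cosines.
\<close>

lemma sinc_corr_cross_sum:
  assumes "0 < \<alpha>"
  shows "(\<Sum>k=1..n. \<Sum>l=1..n. real l * (sinc_corr \<alpha> (real k - real l) * sin ((real k - real l) * x)))
    = (fejer n (x + \<alpha>) - fejer n (x - \<alpha>)) / (4 * \<alpha>)" (is "?S = _")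
proof -
  have anti: "sinc_corr \<alpha> (real l - real k) * sin ((real l - real k) * x) = - (sinc_corr \<alpha> (real k - real l) * sin ((real k - real l) * x))" for k l
  proof -
    have swap: "real l - real k = - (real k - real l)" by simp
    show ?thesis unfolding swap sinc_corr_minus by (simp only: mult_minus_left sin_minus mult_minus_right)
  qed
  have "?S = (\<Sum>k=1..n. \<Sum>l=1..n. real k * (sinc_corr \<alpha> (real l - real k) * sin ((real l - real k) * x)))" by (rule sum.swap)
  also have "\<dots> = (\<Sum>k=1..n. \<Sum>l=1..n. - (real k * (sinc_corr \<alpha> (real k - real l) * sin ((real k - real l) * x))))"
  proof (intro sum.cong refl)
    fix k l
    show "real k * (sinc_corr \<alpha> (real l - real k) * sin ((real l - real k) * x))
      = - (real k * (sinc_corr \<alpha> (real k - real l) * sin ((real k - real l) * x)))"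
      unfolding anti[where k=k and l=l] by (rule mult_minus_right)
  qed
  finally have "2 * ?S = (\<Sum>k=1..n. \<Sum>l=1..n. real l * (sinc_corr \<alpha> (real k - real l) * sin ((real k - real l) * x)))
     + (\<Sum>k=1..n. \<Sum>l=1..n. - (real k * (sinc_corr \<alpha> (real k - real l) * sin ((real k - real l) * x))))" by simp
  also have "\<dots> = (\<Sum>k=1..n. \<Sum>l=1..n. (cos ((real k - real l) * (x + \<alpha>)) - cos ((real k - real l) * (x - \<alpha>))) / (2 * \<alpha>))"
    unfolding sum.distrib[symmetric]
  proof (intro sum.cong refl)
    fix k l
    define u where "u = real k - real l"
    have "real l * (sinc_corr \<alpha> u * sin (u * x)) + - (real k * (sinc_corr \<alpha> u * sin (u * x))) = - (u * sinc_corr \<alpha> u) * sin (u * x)"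
      by (simp add: u_def algebra_simps)
    also have "u * sinc_corr \<alpha> u = sin (u * \<alpha>) / \<alpha>" by (simp add: sinc_corr_def)
    also have "- (sin (u * \<alpha>) / \<alpha>) * sin (u * x) = (cos (u * (x + \<alpha>)) - cos (u * (x - \<alpha>))) / (2 * \<alpha>)"
    proof -
      have "cos (u * (x + \<alpha>)) - cos (u * (x - \<alpha>)) = - (2 * (sin (u * \<alpha>) * sin (u * x)))"
        by (simp add: distrib_left right_diff_distrib cos_add cos_diff mult.commute)
      then show ?thesis using assms by simp
    qed
    finally show "real l * (sinc_corr \<alpha> (real k - real l) * sin ((real k - real l) * x))
      + - (real k * (sinc_corr \<alpha> (real k - real l) * sin ((real k - real l) * x)))
      = (cos ((real k - real l) * (x + \<alpha>)) - cos ((real k - real l) * (x - \<alpha>))) / (2 * \<alpha>)" by (simp add: u_def)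
  qed
  also have "\<dots> = (fejer n (x + \<alpha>) - fejer n (x - \<alpha>)) / (2 * \<alpha>)"
    unfolding kernel_eq_sum by (simp add: sum_divide_distrib sum_subtractf diff_divide_distrib)
  finally show ?thesis by simp
qed

text \<open>
  With \<open>z = y / 2\<close> this follows from \<open>sin y = 2 sin z cos z\<close> and \<open>z cos z \<le> sin z\<close>.
\<close>

lemma sin_ge_linear:
  fixes y b :: real
  assumes y: "0 \<le> y" "y \<le> b" and b: "b < pi"
  shows "y * (cos (b / 2))\<^sup>2 \<le> sin y"
proof -
  define z where "z = y / 2"
  have z: "0 \<le> z" "z \<le> b / 2" "b / 2 < pi / 2" using y b by (auto simp: z_def)
  have "(\<lambda>z. sin z - z * cos z) 0 \<le> (\<lambda>z. sin z - z * cos z) z"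
  proof (rule DERIV_nonneg_imp_nondecreasing[OF z(1)])
    fix x assume x: "0 \<le> x" "x \<le> z"
    have "((\<lambda>z. sin z - z * cos z) has_real_derivative x * sin x) (at x)"
      by (auto intro!: derivative_eq_intros)
    moreover have "0 \<le> x * sin x" using x z by (intro mult_nonneg_nonneg sin_ge_zero) auto
    ultimately show "\<exists>y. ((\<lambda>z. sin z - z * cos z) has_real_derivative y) (at x) \<and> 0 \<le> y" by blast
  qed
  then have s: "z * cos z \<le> sin z" by simp
  have c0: "0 \<le> cos (b / 2)" using z by (intro cos_ge_zero) auto
  have c1: "cos (b / 2) \<le> cos z" using z by (intro cos_monotone_0_pi_le) auto
  have "y * (cos (b / 2))\<^sup>2 \<le> y * (cos z)\<^sup>2" using c0 c1 y by (intro mult_left_mono power_mono) auto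
  also have "\<dots> = 2 * (z * cos z) * cos z" by (simp add: z_def power2_eq_square)
  also have "\<dots> \<le> 2 * sin z * cos z" using s c0 c1 by (intro mult_right_mono) auto
  also have "\<dots> = sin y" using sin_double[of z] by (simp add: z_def)
  finally show ?thesis .
qed

text \<open>
  The weight \<open>1 / (\<bar>t\<bar> + h)\<^sup>2\<close> with \<open>h = \<pi> / n\<close> interpolates between the sizes \<open>n\<^sup>2\<close> near \<open>0\<close> and \<open>1 / t\<^sup>2\<close>
  away from it. The kernel has zeros and is not bounded below by this weight, but a shift by \<open>h\<close> turns \<open>sin (n t / 2)\<close> into
  \<open>cos (n t / 2)\<close>, so its values at \<open>t\<close> and \<open>t + h\<close> are not small together.
\<close>

lemma fejer_pair_ge:
  assumes n: "0 < n" and h: "h = pi / real n"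
  shows "4 / (\<bar>t\<bar> + h)\<^sup>2 \<le> fejer n t + fejer n (t + h)"
proof -
  have h0: "0 < h" using n h by simp
  have sin_le: "4 * (sin (s / 2))\<^sup>2 \<le> (\<bar>t\<bar> + h)\<^sup>2" if "\<bar>s\<bar> \<le> \<bar>t\<bar> + h" for s
  proof -
    have "\<bar>sin (s / 2)\<bar> \<le> (\<bar>t\<bar> + h) / 2" using abs_sin_x_le_abs_x[of "s / 2"] that by simp
    then have "\<bar>sin (s / 2)\<bar>\<^sup>2 \<le> ((\<bar>t\<bar> + h) / 2)\<^sup>2" by (intro power_mono) auto
    then show ?thesis by (simp add: power_divide)
  qed
  have *: "4 * (sin (real n * s / 2))\<^sup>2 \<le> fejer n s * (\<bar>t\<bar> + h)\<^sup>2" if "\<bar>s\<bar> \<le> \<bar>t\<bar> + h" for s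
    using mult_left_mono[OF sin_le[OF that] kernel_nonneg[of "\<lambda>_. 1" n s]] fejer_mult_sin[of n s] by (simp add: mult_ac)
  have "real n * (t + h) / 2 = real n * t / 2 + pi / 2" using n h by (simp add: field_simps)
  then have "sin (real n * (t + h) / 2) = cos (real n * t / 2)"
    by (simp only: sin_add cos_pi_half sin_pi_half mult_zero_right mult_1_right add_0_left)
  moreover have "\<bar>t + h\<bar> \<le> \<bar>t\<bar> + h" using h0 by linarith
  ultimately have c: "4 * (cos (real n * t / 2))\<^sup>2 \<le> fejer n (t + h) * (\<bar>t\<bar> + h)\<^sup>2"
    using *[of "t + h"] by simp
  have s: "4 * (sin (real n * t / 2))\<^sup>2 \<le> fejer n t * (\<bar>t\<bar> + h)\<^sup>2" using *[of t] h0 by simp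
  have "4 = 4 * (sin (real n * t / 2))\<^sup>2 + 4 * (cos (real n * t / 2))\<^sup>2"
    using sin_cos_squared_add[of "real n * t / 2"] by linarith
  then have "4 \<le> (fejer n t + fejer n (t + h)) * (\<bar>t\<bar> + h)\<^sup>2"
    unfolding distrib_right using c s by linarith
  then show ?thesis using h0 by (subst pos_divide_le_eq) (auto intro!: zero_less_power add_nonneg_pos)
qed

lemma fejer'_weight_le:
  assumes n: "0 < n" and h: "h = pi / real n" and \<alpha>: "0 < \<alpha>" "\<alpha> < pi" and t: "\<bar>t\<bar> \<le> pi + \<alpha>"
  defines "c \<equiv> (cos ((pi + \<alpha>) / 4))\<^sup>2"
  shows "fejer' n t \<le> (8 / c\<^sup>2 + 2 * pi\<^sup>2) * (real n)\<^sup>2 * (1 / (\<bar>t\<bar> + h)\<^sup>2)"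
proof -
  have h0: "0 < h" using n h by simp
  have c0: "0 < c" unfolding c_def using \<alpha> by (intro zero_less_power cos_gt_zero) auto
  have "\<bar>t\<bar> / 2 * (cos (((pi + \<alpha>) / 2) / 2))\<^sup>2 \<le> sin (\<bar>t\<bar> / 2)" using t \<alpha> by (intro sin_ge_linear) auto
  then have "\<bar>t\<bar> / 2 * c \<le> sin (\<bar>t\<bar> / 2)" by (simp add: c_def)
  then have "(\<bar>t\<bar> / 2 * c)\<^sup>2 \<le> (sin (\<bar>t\<bar> / 2))\<^sup>2" using c0 by (intro power_mono) auto
  also have "(sin (\<bar>t\<bar> / 2))\<^sup>2 = (sin (t / 2))\<^sup>2" by (cases "0 \<le> t") auto
  finally have t2: "t\<^sup>2 * c\<^sup>2 \<le> 4 * (sin (t / 2))\<^sup>2" by (simp add: power_mult_distrib power_divide)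
  let ?Q = "fejer' n t"
  have Q0: "0 \<le> ?Q" by (rule kernel_nonneg)
  have "?Q * t\<^sup>2 * c\<^sup>2 \<le> 4 * (?Q * (sin (t / 2))\<^sup>2)" using mult_left_mono[OF t2 Q0] by (simp add: mult_ac)
  also have "\<dots> \<le> 4 * (real n)\<^sup>2" using fejer'_mult_sin_le[of n t] by simp
  finally have Qt: "?Q * t\<^sup>2 \<le> 4 * (real n)\<^sup>2 / c\<^sup>2" using c0 by (simp add: pos_le_divide_eq)
  have "?Q * h\<^sup>2 \<le> ((real n)\<^sup>2 * (real n)\<^sup>2) * h\<^sup>2" using fejer'_le[of n t] by (intro mult_right_mono) auto
  also have "\<dots> = pi\<^sup>2 * (real n)\<^sup>2" using n by (simp add: h power_divide power2_eq_square)
  finally have Qh: "?Q * h\<^sup>2 \<le> pi\<^sup>2 * (real n)\<^sup>2" .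
  have "(\<bar>t\<bar> + h)\<^sup>2 \<le> 2 * t\<^sup>2 + 2 * h\<^sup>2" using sum_squares_ge_zero[of "\<bar>t\<bar> - h" 0] by (simp add: power2_eq_square algebra_simps)
  then have "?Q * (\<bar>t\<bar> + h)\<^sup>2 \<le> ?Q * (2 * t\<^sup>2 + 2 * h\<^sup>2)" using Q0 by (intro mult_left_mono) auto
  also have "\<dots> \<le> (8 / c\<^sup>2 + 2 * pi\<^sup>2) * (real n)\<^sup>2" using Qt Qh by (simp add: algebra_simps)
  finally have "?Q * (\<bar>t\<bar> + h)\<^sup>2 \<le> (8 / c\<^sup>2 + 2 * pi\<^sup>2) * (real n)\<^sup>2" .
  then have "?Q \<le> (8 / c\<^sup>2 + 2 * pi\<^sup>2) * (real n)\<^sup>2 / (\<bar>t\<bar> + h)\<^sup>2"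
    using h0 by (subst pos_le_divide_eq) (auto intro!: zero_less_power add_nonneg_pos)
  then show ?thesis by simp
qed

text \<open>
  Both integrals are compared with that of the weight \<open>w(t) = 1 / (\<bar>t\<bar> + h)\<^sup>2\<close> of \<open>fejer_pair_ge\<close>. The lower bound for the
  Fejer kernel sees the window only up to \<open>h\<close> before its right end. The missing piece costs a factor \<open>2\<close>: for \<open>x \<ge> 0\<close>
  the right end is at least \<open>\<alpha> \<ge> 2 h\<close>, so \<open>w\<close> is decreasing there.
\<close>

lemma fejer'_integral_le:
  assumes \<alpha>: "0 < \<alpha>" "\<alpha> < pi" and n: "2 * pi / \<alpha> \<le> real n" and x: "x \<in> {0..pi}"
  shows "window \<alpha> x (fejer' n)
      \<le> (8 / ((cos ((pi + \<alpha>) / 4))\<^sup>2)\<^sup>2 + 2 * pi\<^sup>2) * (real n)\<^sup>2 * window \<alpha> x (fejer n)"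
    and "0 < window \<alpha> x (fejer n)"
proof -
  define p q h K where "p = x - \<alpha>" and "q = x + \<alpha>" and "h = pi / real n"
    and "K = 8 / ((cos ((pi + \<alpha>) / 4))\<^sup>2)\<^sup>2 + 2 * pi\<^sup>2"
  have n0: "0 < n" using n \<alpha> by (cases n) (auto simp: divide_le_0_iff)
  have h0: "0 < h" using n0 by (simp add: h_def)
  have h\<alpha>: "2 * h \<le> \<alpha>" using n n0 \<alpha> by (simp add: h_def field_simps)
  have q2: "2 * h \<le> q" "p \<le> q - 2 * h" "p < q - h" "q - h \<le> q" "p + h \<le> q" "p \<le> p + h"
    using x h\<alpha> h0 \<alpha> by (auto simp: p_def q_def)
  have K0: "0 \<le> K" by (simp add: K_def)
  define w where "w = (\<lambda>t. 1 / (\<bar>t\<bar> + h)\<^sup>2)"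
  have w_cont: "continuous_on S w" for S
    unfolding w_def using h0 by (intro continuous_intros) (auto simp: add_nonneg_eq_0_iff)
  have w_int: "w integrable_on {a..b}" for a b by (rule integrable_continuous_interval[OF w_cont])
  have w0: "0 \<le> w t" for t by (simp add: w_def)
  have "integral {q - h..q} w = integral {(q - 2 * h) + h..(q - h) + h} w" by simp
  also have "\<dots> = integral {q - 2 * h..q - h} (w \<circ> (+) h)" by (rule integral_shift_Icc_real[symmetric])
  also have "\<dots> \<le> integral {q - 2 * h..q - h} w"
  proof (rule integral_le)
    show "w \<circ> (+) h integrable_on {q - 2 * h..q - h}"
      unfolding comp_def w_def using h0 by (intro integrable_continuous_interval continuous_intros) (auto simp: add_nonneg_eq_0_iff)
    show "w integrable_on {q - 2 * h..q - h}" by (rule w_int)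
    fix t assume t: "t \<in> {q - 2 * h..q - h}"
    have t0: "0 \<le> t" using t q2 by auto
    have "(\<bar>t\<bar> + h)\<^sup>2 \<le> (\<bar>h + t\<bar> + h)\<^sup>2" using t0 h0 by (intro power_mono) auto
    then show "(w \<circ> (+) h) t \<le> w t" unfolding w_def comp_def using t0 h0
      by (intro divide_left_mono) (auto intro!: mult_pos_pos zero_less_power)
  qed
  also have "\<dots> \<le> integral {p..q - h} w"
    using q2 by (intro integral_subset_le w_int) (auto intro: w0)
  finally have tail: "integral {q - h..q} w \<le> integral {p..q - h} w" .
  have "integral {p..q} (fejer' n) \<le> integral {p..q} (\<lambda>t. K * (real n)\<^sup>2 * w t)"
  proof (rule integral_le)
    show "(\<lambda>t. K * (real n)\<^sup>2 * w t) integrable_on {p..q}" by (intro integrable_on_mult_right w_int)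
    fix t assume t: "t \<in> {p..q}"
    then have "\<bar>t\<bar> \<le> pi + \<alpha>" using x \<alpha> by (auto simp: p_def q_def)
    then show "fejer' n t \<le> K * (real n)\<^sup>2 * w t"
      using fejer'_weight_le[OF n0 h_def \<alpha>] by (simp add: K_def w_def)
  qed (rule kernel_integrable)
  also have "\<dots> = K * (real n)\<^sup>2 * integral {p..q} w" by simp
  also have "integral {p..q} w = integral {p..q - h} w + integral {q - h..q} w"
    using q2 by (intro Henstock_Kurzweil_Integration.integral_combine[symmetric] w_int) auto
  also have "K * (real n)\<^sup>2 * \<dots> \<le> K * (real n)\<^sup>2 * (2 * integral {p..q - h} w)"
    using tail K0 by (intro mult_left_mono) auto
  finally have up: "integral {p..q} (fejer' n) \<le> K * (real n)\<^sup>2 * (2 * integral {p..q - h} w)" .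
  have "4 * integral {p..q - h} w \<le> integral {p..q - h} (\<lambda>t. fejer n t + (fejer n \<circ> (+) h) t)"
    unfolding integral_mult_right[symmetric]
  proof (rule integral_le)
    show "(\<lambda>t. 4 * w t) integrable_on {p..q - h}" by (intro integrable_on_mult_right w_int)
    show "(\<lambda>t. fejer n t + (fejer n \<circ> (+) h) t) integrable_on {p..q - h}"
      by (intro integrable_add kernel_integrable integrable_continuous_interval continuous_on_compose kernel_cont continuous_intros)
    fix t show "4 * w t \<le> fejer n t + (fejer n \<circ> (+) h) t"
      using fejer_pair_ge[OF n0 h_def, of t] by (simp add: w_def add.commute)
  qed
  also have "\<dots> = integral {p..q - h} (fejer n) + integral {p..q - h} (fejer n \<circ> (+) h)"
    by (intro integral_add kernel_integrable integrable_continuous_interval continuous_on_compose kernel_cont continuous_intros)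
  also have "integral {p..q - h} (fejer n \<circ> (+) h) = integral {p + h..q} (fejer n)"
    using integral_shift_Icc_real[of p "q - h" "fejer n" h] by simp
  also have "integral {p..q - h} (fejer n) \<le> integral {p..q} (fejer n)"
    using q2 by (intro integral_subset_le kernel_integrable) (auto intro: kernel_nonneg)
  also have "integral {p + h..q} (fejer n) \<le> integral {p..q} (fejer n)"
    using q2 by (intro integral_subset_le kernel_integrable) (auto intro: kernel_nonneg)
  finally have low: "2 * integral {p..q - h} w \<le> integral {p..q} (fejer n)" by simp
  have "integral {p..q} (fejer' n) \<le> K * (real n)\<^sup>2 * integral {p..q} (fejer n)"
    using K0 by (intro order.trans[OF up mult_left_mono[OF low]]) simp
  then show "window \<alpha> x (fejer' n)
      \<le> (8 / ((cos ((pi + \<alpha>) / 4))\<^sup>2)\<^sup>2 + 2 * pi\<^sup>2) * (real n)\<^sup>2 * window \<alpha> x (fejer n)"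
    by (simp add: p_def q_def K_def)
  have "0 < 2 * pi + h" using h0 pi_gt_zero by linarith
  then have "0 < (q - h - p) * (1 / (2 * pi + h)\<^sup>2)" using q2 by (intro mult_pos_pos divide_pos_pos zero_less_power) auto
  also have "\<dots> = integral {p..q - h} (\<lambda>t. 1 / (2 * pi + h)\<^sup>2)" using q2 by simp
  also have "\<dots> \<le> integral {p..q - h} w"
  proof (rule integral_le)
    fix t assume t: "t \<in> {p..q - h}"
    then have "\<bar>t\<bar> \<le> 2 * pi" using x \<alpha> h0 by (auto simp: p_def q_def)
    then have "(\<bar>t\<bar> + h)\<^sup>2 \<le> (2 * pi + h)\<^sup>2" using h0 by (intro power_mono) auto
    then show "1 / (2 * pi + h)\<^sup>2 \<le> w t" unfolding w_def using h0
      by (intro divide_left_mono) (auto intro!: mult_pos_pos zero_less_power add_nonneg_pos)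
  qed (auto intro: w_int)
  finally show "0 < window \<alpha> x (fejer n)" using low by (simp add: p_def q_def)
qed

section \<open>Asymptotics of the density of zeros\<close>

lemma fejer_le_off_zero:
  assumes "0 < \<sigma>" "\<sigma> \<le> (sin (t / 2))\<^sup>2"
  shows "fejer n t \<le> 1 / \<sigma>" and "fejer' n t \<le> (real n)\<^sup>2 / \<sigma>"
proof -
  have "fejer n t * \<sigma> \<le> fejer n t * (sin (t / 2))\<^sup>2" by (intro mult_left_mono assms kernel_nonneg)
  also have "\<dots> \<le> 1" unfolding fejer_mult_sin by (simp add: abs_square_le_1)
  finally show "fejer n t \<le> 1 / \<sigma>" using assms(1) by (simp add: pos_le_divide_eq)
  have "fejer' n t * \<sigma> \<le> fejer' n t * (sin (t / 2))\<^sup>2" by (intro mult_left_mono assms kernel_nonneg)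
  also have "\<dots> \<le> (real n)\<^sup>2" by (rule fejer'_mult_sin_le)
  finally show "fejer' n t \<le> (real n)\<^sup>2 / \<sigma>" using assms(1) by (simp add: pos_le_divide_eq)
qed

lemma sin_bounded_off_zero:
  assumes "0 < p" "q < 2 * pi"
  obtains \<sigma> where "0 < \<sigma>" "\<And>t. \<bar>t\<bar> \<in> {p..q} \<Longrightarrow> \<sigma> \<le> (sin (t / 2))\<^sup>2"
proof (cases "p \<le> q")
  case True
  have "continuous_on {p..q} (\<lambda>t. (sin (t / 2))\<^sup>2)" by (intro continuous_intros) auto
  then obtain t0 where t0: "t0 \<in> {p..q}" "\<And>t. t \<in> {p..q} \<Longrightarrow> (sin (t0 / 2))\<^sup>2 \<le> (sin (t / 2))\<^sup>2"
    using continuous_attains_inf[of "{p..q}" "\<lambda>t. (sin (t / 2))\<^sup>2"] True by auto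
  have "0 < sin (t0 / 2)" using t0 assms by (intro sin_gt_zero) auto
  then have pos: "0 < (sin (t0 / 2))\<^sup>2" by simp
  have sin_abs: "(sin (t / 2))\<^sup>2 = (sin (\<bar>t\<bar> / 2))\<^sup>2" for t :: real by (cases "0 \<le> t") auto
  show thesis
  proof (rule that[OF pos])
    fix t assume "\<bar>t\<bar> \<in> {p..q}"
    then show "(sin (t0 / 2))\<^sup>2 \<le> (sin (t / 2))\<^sup>2" using t0(2)[of "\<bar>t\<bar>"] sin_abs[of t] by simp
  qed
next
  case False
  then show thesis using that[of 1] by auto
qed

text \<open>
  The Kac-Rice density \<open>sqrt (w / v - (c / v)\<^sup>2) / \<pi>\<close> after the common factor \<open>1 / (2 \<alpha>)\<close> has been cancelled.
\<close>

definition zero_density :: "real \<Rightarrow> nat \<Rightarrow> real \<Rightarrow> real" where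
  "zero_density \<alpha> n x = sqrt (window \<alpha> x (fejer' n) / window \<alpha> x (fejer n)
      - ((fejer n (x + \<alpha>) - fejer n (x - \<alpha>)) / (2 * window \<alpha> x (fejer n)))\<^sup>2) / pi"

lemma zero_density_over_n:
  assumes "0 < n"
  shows "zero_density \<alpha> n x / real n = sqrt (window \<alpha> x (fejer' n) / ((real n)\<^sup>2 * window \<alpha> x (fejer n))
      - ((fejer n (x + \<alpha>) - fejer n (x - \<alpha>)) / (2 * (real n * window \<alpha> x (fejer n))))\<^sup>2) / pi"
proof -
  define A V d where "A = window \<alpha> x (fejer' n)" and "V = window \<alpha> x (fejer n)"
    and "d = fejer n (x + \<alpha>) - fejer n (x - \<alpha>)"
  have "A / ((real n)\<^sup>2 * V) - (d / (2 * (real n * V)))\<^sup>2 = (A / V - (d / (2 * V))\<^sup>2) / (real n)\<^sup>2"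
    by (simp add: power_divide power_mult_distrib diff_divide_distrib mult_ac)
  then show ?thesis using assms unfolding zero_density_def A_def[symmetric] V_def[symmetric] d_def[symmetric]
    by (simp add: real_sqrt_divide)
qed

lemma zero_density_tendsto:
  assumes A: "(\<lambda>n. window \<alpha> x (fejer' n) / ((real n)\<^sup>2 * window \<alpha> x (fejer n))) \<longlonglongrightarrow> r"
    and V: "(\<lambda>n. 1 / (real n * window \<alpha> x (fejer n))) \<longlonglongrightarrow> 0"
    and \<sigma>: "0 < \<sigma>" "\<sigma> \<le> (sin ((x + \<alpha>) / 2))\<^sup>2" "\<sigma> \<le> (sin ((x - \<alpha>) / 2))\<^sup>2"
  shows "(\<lambda>n. zero_density \<alpha> n x / real n) \<longlonglongrightarrow> sqrt r / pi"
proof -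
  let ?d = "\<lambda>n. fejer n (x + \<alpha>) - fejer n (x - \<alpha>)"
  let ?V = "\<lambda>n. window \<alpha> x (fejer n)"
  have d: "\<bar>?d n / 2\<bar> \<le> 1 / \<sigma>" for n
  proof -
    have "\<bar>?d n\<bar> \<le> 1 / \<sigma>"
      using fejer_le_off_zero(1)[OF \<sigma>(1,2), of n] fejer_le_off_zero(1)[OF \<sigma>(1,3), of n]
        kernel_nonneg[of "\<lambda>_. 1" n "x + \<alpha>"] kernel_nonneg[of "\<lambda>_. 1" n "x - \<alpha>"]
      by (intro abs_leI) linarith+
    then show ?thesis by simp
  qed
  have "(\<lambda>n. ?d n / 2 * (1 / (real n * ?V n))) \<longlonglongrightarrow> 0"
  proof (rule tendsto_rabs_zero_cancel, rule tendsto_sandwich[OF _ _ tendsto_const])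
    show "(\<lambda>n. 1 / \<sigma> * \<bar>1 / (real n * ?V n)\<bar>) \<longlonglongrightarrow> 0"
      using tendsto_mult[OF tendsto_const[of "1 / \<sigma>"] tendsto_rabs_zero[OF V]] by simp
    show "\<forall>\<^sub>F n in sequentially. \<bar>?d n / 2 * (1 / (real n * ?V n))\<bar> \<le> 1 / \<sigma> * \<bar>1 / (real n * ?V n)\<bar>"
      unfolding abs_mult[of "?d _ / 2"] by (intro always_eventually allI mult_right_mono d) auto
  qed simp
  then have "(\<lambda>n. ?d n / (2 * (real n * ?V n))) \<longlonglongrightarrow> 0" by simp
  then have "(\<lambda>n. sqrt (window \<alpha> x (fejer' n) / ((real n)\<^sup>2 * ?V n) - (?d n / (2 * (real n * ?V n)))\<^sup>2) / pi)
    \<longlonglongrightarrow> sqrt (r - 0\<^sup>2) / pi"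
    by (intro tendsto_divide tendsto_real_sqrt tendsto_diff tendsto_power A tendsto_const) auto
  then show ?thesis
    by (rule Lim_transform_eventually[THEN tendsto_eq_rhs])
      (auto intro!: eventually_mono[OF eventually_gt_at_top[of 0]] simp: zero_density_over_n)
qed

text \<open>
  Over a full period the kernel integrals are known exactly by orthogonality. The part of the period outside the
  window is away from \<open>0\<close>, so its contribution is smaller by a factor of order \<open>n\<close>.
\<close>

lemma zero_density_tendsto_inside:
  assumes \<alpha>: "\<alpha> < pi" and x: "0 < x" "x < \<alpha>"
  shows "(\<lambda>n. zero_density \<alpha> n x / real n) \<longlonglongrightarrow> 1 / (pi * sqrt 3)"
proof -
  obtain \<sigma> where \<sigma>: "0 < \<sigma>" "\<And>t. \<bar>t\<bar> \<in> {\<alpha> - x..x + pi} \<Longrightarrow> \<sigma> \<le> (sin (t / 2))\<^sup>2"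
    using sin_bounded_off_zero[of "\<alpha> - x" "x + pi"] \<alpha> x by auto
  let ?A = "\<lambda>n. window \<alpha> x (fejer' n)" and ?V = "\<lambda>n. window \<alpha> x (fejer n)"
  have split: "\<bar>2 * pi * (\<Sum>k=1..n. (c k)\<^sup>2) - window \<alpha> x (kernel c n)\<bar> \<le> 2 * pi * B"
    if B: "\<And>t. \<sigma> \<le> (sin (t / 2))\<^sup>2 \<Longrightarrow> kernel c n t \<le> B" and B0: "0 \<le> B" for c n B
  proof -
    have small: "0 \<le> integral {a..b} (kernel c n) \<and> integral {a..b} (kernel c n) \<le> (b - a) * B"
      if "\<And>t. t \<in> {a..b} \<Longrightarrow> \<bar>t\<bar> \<in> {\<alpha> - x..x + pi}" "a \<le> b" for a b
    proof
      show "0 \<le> integral {a..b} (kernel c n)" by (intro integral_nonneg kernel_integrable kernel_nonneg)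
      have "integral {a..b} (kernel c n) \<le> integral {a..b} (\<lambda>_. B)"
        using that by (intro integral_le kernel_integrable B \<sigma>(2)) auto
      then show "integral {a..b} (kernel c n) \<le> (b - a) * B" using that(2) by simp
    qed
    have "integral {x - pi..x + pi} (kernel c n)
      = integral {x - pi..x - \<alpha>} (kernel c n) + (window \<alpha> x (kernel c n) + integral {x + \<alpha>..x + pi} (kernel c n))"
    proof -
      have "integral {x - pi..x - \<alpha>} (kernel c n) + integral {x - \<alpha>..x + pi} (kernel c n) = integral {x - pi..x + pi} (kernel c n)"
        using \<alpha> x by (intro Henstock_Kurzweil_Integration.integral_combine kernel_integrable) auto
      moreover have "window \<alpha> x (kernel c n) + integral {x + \<alpha>..x + pi} (kernel c n) = integral {x - \<alpha>..x + pi} (kernel c n)"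
        using \<alpha> x by (intro Henstock_Kurzweil_Integration.integral_combine kernel_integrable) auto
      ultimately show ?thesis by linarith
    qed
    moreover have "0 \<le> integral {x - pi..x - \<alpha>} (kernel c n) \<and> integral {x - pi..x - \<alpha>} (kernel c n) \<le> ((x - \<alpha>) - (x - pi)) * B"
      using \<alpha> x by (intro small) auto
    moreover have "0 \<le> integral {x + \<alpha>..x + pi} (kernel c n) \<and> integral {x + \<alpha>..x + pi} (kernel c n) \<le> ((x + pi) - (x + \<alpha>)) * B"
      using \<alpha> x by (intro small) auto
    moreover have "((x - \<alpha>) - (x - pi)) * B + ((x + pi) - (x + \<alpha>)) * B \<le> 2 * pi * B"
    proof -
      have "((x - \<alpha>) - (x - pi)) * B + ((x + pi) - (x + \<alpha>)) * B = (2 * pi - 2 * \<alpha>) * B" by (simp add: algebra_simps)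
      also have "\<dots> \<le> 2 * pi * B" using B0 x by (intro mult_right_mono) auto
      finally show ?thesis .
    qed
    ultimately show ?thesis unfolding kernel_integral_period by linarith
  qed
  have inv: "(\<lambda>n. 1 / real n) \<longlonglongrightarrow> 0" by (rule lim_1_over_n)
  have V_lim: "(\<lambda>n. ?V n / real n) \<longlonglongrightarrow> 2 * pi"
  proof (rule LIM_zero_cancel, rule tendsto_rabs_zero_cancel, rule tendsto_sandwich[OF _ _ tendsto_const])
    show "(\<lambda>n. 2 * pi * (1 / \<sigma>) * (1 / real n)) \<longlonglongrightarrow> 0" using tendsto_mult[OF tendsto_const inv, of "2 * pi * (1 / \<sigma>)"] by simp
    show "\<forall>\<^sub>F n in sequentially. \<bar>?V n / real n - 2 * pi\<bar> \<le> 2 * pi * (1 / \<sigma>) * (1 / real n)"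
      using eventually_gt_at_top[of 0]
    proof eventually_elim
      case (elim n)
      have "\<bar>2 * pi * (\<Sum>k=1..n. (1::real)\<^sup>2) - ?V n\<bar> \<le> 2 * pi * (1 / \<sigma>)"
        by (rule split) (use \<sigma>(1) fejer_le_off_zero(1) in auto)
      then have "\<bar>?V n - 2 * pi * real n\<bar> / real n \<le> 2 * pi * (1 / \<sigma>) / real n"
        by (intro divide_right_mono) (auto simp: abs_minus_commute)
      moreover have "?V n / real n - 2 * pi = (?V n - 2 * pi * real n) / real n" using elim by (simp add: field_simps)
      ultimately show ?case by (simp add: abs_divide)
    qed
  qed simp
  have A_lim: "(\<lambda>n. ?A n / real n ^ 3) \<longlonglongrightarrow> 2 * pi / 3"
  proof -
    have "(\<lambda>n. ?A n / real n ^ 3 - 2 * pi * (\<Sum>k=1..n. (real k)\<^sup>2) / real n ^ 3) \<longlonglongrightarrow> 0"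
    proof (rule tendsto_rabs_zero_cancel, rule tendsto_sandwich[OF _ _ tendsto_const])
      show "(\<lambda>n. 2 * pi * (1 / \<sigma>) * (1 / real n)) \<longlonglongrightarrow> 0" using tendsto_mult[OF tendsto_const inv, of "2 * pi * (1 / \<sigma>)"] by simp
      show "\<forall>\<^sub>F n in sequentially. \<bar>?A n / real n ^ 3 - 2 * pi * (\<Sum>k=1..n. (real k)\<^sup>2) / real n ^ 3\<bar> \<le> 2 * pi * (1 / \<sigma>) * (1 / real n)"
        using eventually_gt_at_top[of 0]
      proof eventually_elim
        case (elim n)
        have "\<bar>2 * pi * (\<Sum>k=1..n. (real k)\<^sup>2) - ?A n\<bar> \<le> 2 * pi * ((real n)\<^sup>2 / \<sigma>)"
          by (rule split) (use \<sigma>(1) fejer_le_off_zero(2) in auto)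
        then have "\<bar>?A n - 2 * pi * (\<Sum>k=1..n. (real k)\<^sup>2)\<bar> / real n ^ 3 \<le> 2 * pi * ((real n)\<^sup>2 / \<sigma>) / real n ^ 3"
          by (intro divide_right_mono) (auto simp: abs_minus_commute)
        moreover have "2 * pi * ((real n)\<^sup>2 / \<sigma>) / real n ^ 3 = 2 * pi * (1 / \<sigma>) * (1 / real n)"
          using elim by (simp add: power2_eq_square power3_eq_cube)
        ultimately show ?case by (simp add: abs_divide flip: diff_divide_distrib)
      qed
    qed simp
    moreover have "(\<lambda>n. 2 * pi * (\<Sum>k=1..n. (real k)\<^sup>2) / real n ^ 3) \<longlonglongrightarrow> 2 * pi / 3"
    proof -
      have sq: "6 * (\<Sum>k=1..n. (real k)\<^sup>2) = real n * (real n + 1) * (2 * real n + 1)" for n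
        by (induction n) (simp_all add: algebra_simps power2_eq_square)
      have "(\<lambda>n. 2 * pi / 6 * ((1 + 1 / real n) * (2 + 1 / real n))) \<longlonglongrightarrow> 2 * pi / 6 * ((1 + 0) * (2 + 0))"
        by (intro tendsto_intros inv)
      then show ?thesis
      proof (rule Lim_transform_eventually[THEN tendsto_eq_rhs])
        show "\<forall>\<^sub>F n in sequentially. 2 * pi / 6 * ((1 + 1 / real n) * (2 + 1 / real n)) = 2 * pi * (\<Sum>k=1..n. (real k)\<^sup>2) / real n ^ 3"
          using eventually_gt_at_top[of 0]
        proof eventually_elim
          case (elim n)
          have "(\<Sum>k=1..n. (real k)\<^sup>2) = real n * (real n + 1) * (2 * real n + 1) / 6" using sq[of n] by simp
          then show ?case using elim by (simp add: field_simps power3_eq_cube)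
        qed
      qed simp
    qed
    ultimately have "(\<lambda>n. (?A n / real n ^ 3 - 2 * pi * (\<Sum>k=1..n. (real k)\<^sup>2) / real n ^ 3) + 2 * pi * (\<Sum>k=1..n. (real k)\<^sup>2) / real n ^ 3)
      \<longlonglongrightarrow> 0 + 2 * pi / 3" by (rule tendsto_add)
    then show ?thesis by simp
  qed
  have "(\<lambda>n. (?A n / real n ^ 3) / (?V n / real n)) \<longlonglongrightarrow> (2 * pi / 3) / (2 * pi)"
    by (intro tendsto_divide A_lim V_lim) simp
  then have "(\<lambda>n. ?A n / ((real n)\<^sup>2 * ?V n)) \<longlonglongrightarrow> 1 / 3"
    by (rule Lim_transform_eventually[THEN tendsto_eq_rhs])
      (auto intro!: eventually_mono[OF eventually_gt_at_top[of 0]] simp: power2_eq_square power3_eq_cube)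
  moreover have "(\<lambda>n. 1 / (real n * ?V n)) \<longlonglongrightarrow> 0"
  proof -
    have "(\<lambda>n. (1 / real n) * (1 / real n) / (?V n / real n)) \<longlonglongrightarrow> 0 * 0 / (2 * pi)"
      by (intro tendsto_divide tendsto_mult inv V_lim) simp
    then show ?thesis
      by (rule Lim_transform_eventually[THEN tendsto_eq_rhs])
        (auto intro!: eventually_mono[OF eventually_gt_at_top[of 0]])
  qed
  ultimately have "(\<lambda>n. zero_density \<alpha> n x / real n) \<longlonglongrightarrow> sqrt (1 / 3) / pi"
    using x \<alpha> by (intro zero_density_tendsto[OF _ _ \<sigma>(1)] \<sigma>(2)) auto
  then show ?thesis by (simp add: real_sqrt_divide mult.commute)
qed

text \<open>
  Integration by parts bounds the integral by a constant over \<open>n\<close>.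
\<close>

lemma riemann_lebesgue:
  fixes f f' :: "real \<Rightarrow> real"
  assumes pq: "p \<le> q" and f: "\<And>t. t \<in> {p..q} \<Longrightarrow> (f has_real_derivative f' t) (at t within {p..q})"
    and f': "continuous_on {p..q} f'"
  shows "(\<lambda>n. integral {p..q} (\<lambda>t. cos (real n * t) * f t)) \<longlonglongrightarrow> 0"
proof -
  have fc: "continuous_on {p..q} f" using f by (intro DERIV_continuous_on) auto
  let ?B = "\<bar>f q\<bar> + \<bar>f p\<bar> + integral {p..q} (\<lambda>t. \<bar>f' t\<bar>)"
  show ?thesis
  proof (rule tendsto_rabs_zero_cancel, rule tendsto_sandwich[OF _ _ tendsto_const])
    show "(\<lambda>n. ?B * (1 / real n)) \<longlonglongrightarrow> 0" using tendsto_mult[OF tendsto_const lim_1_over_n, of ?B] by simp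
    show "\<forall>\<^sub>F n in sequentially. \<bar>integral {p..q} (\<lambda>t. cos (real n * t) * f t)\<bar> \<le> ?B * (1 / real n)"
      using eventually_gt_at_top[of 0]
    proof eventually_elim
      case (elim n)
      have ci: "(\<lambda>t. cos (real n * t) * f t) integrable_on {p..q}"
        by (intro integrable_continuous_interval continuous_intros fc)
      have si: "(\<lambda>t. sin (real n * t) * f' t) integrable_on {p..q}"
        by (intro integrable_continuous_interval continuous_intros f')
      have "((\<lambda>t. cos (real n * t) * f t + sin (real n * t) * f' t / real n) has_integral
          sin (real n * q) * f q / real n - sin (real n * p) * f p / real n) {p..q}"
      proof (rule fundamental_theorem_of_calculus[OF pq])
        fix t assume t: "t \<in> {p..q}"
        have "((\<lambda>t. sin (real n * t) * f t / real n) has_real_derivative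
            (cos (real n * t) * f t + sin (real n * t) * f' t / real n)) (at t within {p..q})"
          using elim by (auto intro!: derivative_eq_intros f[OF t] simp: field_simps)
        then show "((\<lambda>t. sin (real n * t) * f t / real n) has_vector_derivative
            (cos (real n * t) * f t + sin (real n * t) * f' t / real n)) (at t within {p..q})"
          by (simp add: has_real_derivative_iff_has_vector_derivative)
      qed
      then have "integral {p..q} (\<lambda>t. cos (real n * t) * f t + sin (real n * t) * f' t / real n)
        = sin (real n * q) * f q / real n - sin (real n * p) * f p / real n" by (rule integral_unique)
      moreover have "integral {p..q} (\<lambda>t. cos (real n * t) * f t + sin (real n * t) * f' t / real n)
        = integral {p..q} (\<lambda>t. cos (real n * t) * f t) + integral {p..q} (\<lambda>t. sin (real n * t) * f' t) / real n"
        using ci si by (subst integral_add) (auto intro: integrable_on_divide)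
      ultimately have "integral {p..q} (\<lambda>t. cos (real n * t) * f t)
        = (sin (real n * q) * f q - sin (real n * p) * f p - integral {p..q} (\<lambda>t. sin (real n * t) * f' t)) / real n"
        by (simp add: diff_divide_distrib)
      moreover have "\<bar>sin (real n * q) * f q - sin (real n * p) * f p - integral {p..q} (\<lambda>t. sin (real n * t) * f' t)\<bar> \<le> ?B"
      proof -
        have "\<bar>sin (real n * q) * f q\<bar> \<le> \<bar>f q\<bar>" "\<bar>sin (real n * p) * f p\<bar> \<le> \<bar>f p\<bar>"
          by (simp_all add: abs_mult mult_left_le_one_le)
        moreover have "norm (integral {p..q} (\<lambda>t. sin (real n * t) * f' t)) \<le> integral {p..q} (\<lambda>t. \<bar>f' t\<bar>)"
          by (intro integral_norm_bound_integral si integrable_continuous_interval continuous_intros f')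
            (simp add: abs_mult mult_left_le_one_le)
        ultimately show ?thesis unfolding real_norm_def by linarith
      qed
      ultimately show ?case by (simp add: abs_divide divide_right_mono)
    qed
  qed simp
qed

text \<open>
  Only the Fejer kernel oscillates: \<open>2 sin\<^sup>2 (n t / 2) = 1 - cos (n t)\<close>, and the cosine disappears in the limit by
  \<open>riemann_lebesgue\<close>. With \<open>f(t) = 1 / (2 sin\<^sup>2 (t / 2))\<close> the two kernels integrate asymptotically to \<open>H\<close> and
  \<open>n\<^sup>2 H / 2\<close>, where \<open>H\<close> is the integral of \<open>f\<close> over the window.
\<close>

lemma zero_density_tendsto_outside:
  assumes \<alpha>: "0 < \<alpha>" and x: "\<alpha> < x" "x < pi"
  shows "(\<lambda>n. zero_density \<alpha> n x / real n) \<longlonglongrightarrow> 1 / (pi * sqrt 2)"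
proof -
  define p q where "p = x - \<alpha>" and "q = x + \<alpha>"
  have pq: "0 < p" "p < q" "q < 2 * pi" using x \<alpha> by (auto simp: p_def q_def)
  obtain \<sigma> where \<sigma>0: "0 < \<sigma>" "\<And>t. \<bar>t\<bar> \<in> {p..q} \<Longrightarrow> \<sigma> \<le> (sin (t / 2))\<^sup>2"
    using sin_bounded_off_zero[OF pq(1,3)] by blast
  have \<sigma>: "\<sigma> \<le> (sin (t / 2))\<^sup>2" "sin (t / 2) \<noteq> 0" if "t \<in> {p..q}" for t
    using \<sigma>0(2)[of t] that pq \<sigma>0(1) by auto
  define f where "f = (\<lambda>t::real. 1 / (2 * (sin (t / 2))\<^sup>2))"
  have fc: "continuous_on {p..q} f" unfolding f_def by (intro continuous_intros) (use \<sigma>(2) in auto)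
  have fi: "f integrable_on {p..q}" by (rule integrable_continuous_interval[OF fc])
  define H where "H = integral {p..q} f"
  have H: "0 < H"
  proof -
    have "0 < (q - p) * (1 / 2)" using pq by simp
    also have "\<dots> = integral {p..q} (\<lambda>_. 1 / 2)" using pq by simp
    also have "\<dots> \<le> H" unfolding H_def
    proof (rule integral_le[OF _ fi])
      fix t assume t: "t \<in> {p..q}"
      have "(sin (t / 2))\<^sup>2 \<le> 1" by (simp add: abs_square_le_1)
      then show "1 / 2 \<le> f t" unfolding f_def using \<sigma>(2)[OF t] by (intro divide_left_mono) auto
    qed auto
    finally show ?thesis .
  qed
  have V_lim: "(\<lambda>n. integral {p..q} (fejer n)) \<longlonglongrightarrow> H"
  proof -
    have eq: "integral {p..q} (fejer n) = H - integral {p..q} (\<lambda>t. cos (real n * t) * f t)" for n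
    proof -
      have "integral {p..q} (fejer n) = integral {p..q} (\<lambda>t. f t - cos (real n * t) * f t)"
      proof (rule Henstock_Kurzweil_Integration.integral_cong)
        fix t assume t: "t \<in> {p..q}"
        have "fejer n t = (sin (real n * t / 2))\<^sup>2 / (sin (t / 2))\<^sup>2"
          using fejer_mult_sin[of n t] \<sigma>(2)[OF t] by (simp add: eq_divide_eq)
        moreover have "2 * (sin (real n * t / 2))\<^sup>2 = 1 - cos (real n * t)"
        proof -
          have "cos (2 * (real n * t / 2)) = 1 - 2 * (sin (real n * t / 2))\<^sup>2" by (rule cos_double_sin)
          moreover have "2 * (real n * t / 2) = real n * t" by simp
          ultimately show ?thesis by simp
        qed
        moreover have "(sin (real n * t / 2))\<^sup>2 / (sin (t / 2))\<^sup>2 = (2 * (sin (real n * t / 2))\<^sup>2) / (2 * (sin (t / 2))\<^sup>2)"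
          by simp
        ultimately have "fejer n t = (1 - cos (real n * t)) / (2 * (sin (t / 2))\<^sup>2)" by (simp only:)
        then show "fejer n t = f t - cos (real n * t) * f t" by (simp add: f_def diff_divide_distrib)
      qed
      then show ?thesis unfolding H_def
        by (simp add: Henstock_Kurzweil_Integration.integral_diff fi integrable_continuous_interval continuous_intros fc)
    qed
    have "(\<lambda>n. integral {p..q} (\<lambda>t. cos (real n * t) * f t)) \<longlonglongrightarrow> 0"
    proof (rule riemann_lebesgue[where f' = "\<lambda>t. - (cos (t / 2) / (2 * sin (t / 2) ^ 3))"])
      fix t assume t: "t \<in> {p..q}"
      show "(f has_real_derivative - (cos (t / 2) / (2 * sin (t / 2) ^ 3))) (at t within {p..q})"
        unfolding f_def using \<sigma>(2)[OF t]
        by (auto intro!: derivative_eq_intros simp: field_simps power2_eq_square power3_eq_cube)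
    qed (use pq \<sigma>(2) in \<open>auto intro!: continuous_intros\<close>)
    from tendsto_diff[OF tendsto_const this, of H] show ?thesis unfolding eq by simp
  qed
  have A_lim: "(\<lambda>n. integral {p..q} (fejer' n) / (real n)\<^sup>2) \<longlonglongrightarrow> H / 2"
  proof (rule LIM_zero_cancel, rule tendsto_rabs_zero_cancel, rule tendsto_sandwich[OF _ _ tendsto_const])
    define \<rho> where "\<rho> = sqrt (1 / \<sigma>)"
    have \<rho>: "0 \<le> \<rho>" using \<sigma>0 by (simp add: \<rho>_def)
    define e where "e = (\<lambda>n::nat. (2 * \<rho> * (1 / real n) + \<rho>\<^sup>2 * ((1 / real n) * (1 / real n))) / (4 * \<sigma>))"
    have "(\<lambda>n. e n) \<longlonglongrightarrow> (2 * \<rho> * 0 + \<rho>\<^sup>2 * (0 * 0)) / (4 * \<sigma>)"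
      unfolding e_def using \<sigma>0 by (intro tendsto_intros lim_1_over_n) auto
    then show "(\<lambda>n. (q - p) * e n) \<longlonglongrightarrow> 0" using tendsto_mult[OF tendsto_const[of "q - p"], of e 0] by simp
    show "\<forall>\<^sub>F n in sequentially. \<bar>integral {p..q} (fejer' n) / (real n)\<^sup>2 - H / 2\<bar> \<le> (q - p) * e n"
      using eventually_gt_at_top[of 0]
    proof eventually_elim
      case (elim n)
      have "integral {p..q} (fejer' n) / (real n)\<^sup>2 - H / 2 = integral {p..q} (\<lambda>t. fejer' n t / (real n)\<^sup>2 - f t / 2)"
        unfolding H_def using fi kernel_integrable
        by (subst Henstock_Kurzweil_Integration.integral_diff) (auto intro: integrable_on_divide)
      also have "norm \<dots> \<le> integral {p..q} (\<lambda>_. e n)"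
      proof (rule integral_norm_bound_integral)
        show "(\<lambda>t. fejer' n t / (real n)\<^sup>2 - f t / 2) integrable_on {p..q}"
          by (intro integrable_diff integrable_on_divide fi kernel_integrable)
        fix t assume t: "t \<in> {p..q}"
        obtain r where r: "\<bar>r\<bar> \<le> sqrt (fejer n t)" "4 * (fejer' n t * (sin (t / 2))\<^sup>2) = (real n + r)\<^sup>2"
          using fejer'_mult_sin by blast
        have "sqrt (fejer n t) \<le> \<rho>" unfolding \<rho>_def
          by (intro real_sqrt_le_mono fejer_le_off_zero(1)[OF \<sigma>0(1) \<sigma>(1)[OF t]])
        then have r\<rho>: "\<bar>r\<bar> \<le> \<rho>" using r(1) by simp
        define s where "s = (sin (t / 2))\<^sup>2"
        have s: "\<sigma> \<le> s" "0 < s" using \<sigma>(1)[OF t] \<sigma>0(1) by (auto simp: s_def)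
        have "fejer' n t = (real n + r)\<^sup>2 / (4 * s)" using r(2) s(2) by (simp add: s_def[symmetric] field_simps)
        then have "fejer' n t / (real n)\<^sup>2 - f t / 2 = (2 * r * (1 / real n) + r\<^sup>2 * ((1 / real n) * (1 / real n))) / (4 * s)"
          unfolding f_def s_def[symmetric] using s(2) elim by (simp add: field_simps power2_eq_square)
        also have "\<bar>\<dots>\<bar> \<le> (2 * \<rho> * (1 / real n) + \<rho>\<^sup>2 * ((1 / real n) * (1 / real n))) / (4 * s)"
        proof -
          have "\<bar>2 * r * (1 / real n) + r\<^sup>2 * ((1 / real n) * (1 / real n))\<bar> \<le> \<bar>2 * r * (1 / real n)\<bar> + \<bar>r\<^sup>2 * ((1 / real n) * (1 / real n))\<bar>"
            by (rule abs_triangle_ineq)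
          also have "\<dots> = 2 * \<bar>r\<bar> * (1 / real n) + \<bar>r\<bar>\<^sup>2 * ((1 / real n) * (1 / real n))" by (simp add: abs_mult)
          also have "\<dots> \<le> 2 * \<rho> * (1 / real n) + \<rho>\<^sup>2 * ((1 / real n) * (1 / real n))"
            using r\<rho> by (intro add_mono mult_right_mono power_mono mult_left_mono) auto
          finally show ?thesis using s(2) by (simp add: abs_divide divide_right_mono)
        qed
        also have "\<dots> \<le> e n" unfolding e_def using s \<sigma>0(1) \<rho> by (intro divide_left_mono) auto
        finally show "norm (fejer' n t / (real n)\<^sup>2 - f t / 2) \<le> e n" by simp
      qed auto
      finally show ?case using pq by simp
    qed
  qed simp
  have "(\<lambda>n. (integral {p..q} (fejer' n) / (real n)\<^sup>2) / integral {p..q} (fejer n)) \<longlonglongrightarrow> (H / 2) / H"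
    using H by (intro tendsto_divide A_lim V_lim) simp
  then have "(\<lambda>n. integral {p..q} (fejer' n) / ((real n)\<^sup>2 * integral {p..q} (fejer n))) \<longlonglongrightarrow> 1 / 2" using H by simp
  moreover have "(\<lambda>n. 1 / (real n * integral {p..q} (fejer n))) \<longlonglongrightarrow> 0"
  proof -
    have "(\<lambda>n. (1 / real n) / integral {p..q} (fejer n)) \<longlonglongrightarrow> 0 / H"
      using H by (intro tendsto_divide lim_1_over_n V_lim) simp
    then show ?thesis by simp
  qed
  ultimately have "(\<lambda>n. zero_density \<alpha> n x / real n) \<longlonglongrightarrow> sqrt (1 / 2) / pi"
    unfolding p_def q_def using x \<alpha> by (intro zero_density_tendsto[OF _ _ \<sigma>0(1)] \<sigma>(1)) (auto simp: p_def q_def)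
  then show ?thesis by (simp add: real_sqrt_divide mult.commute)
qed

lemma cos_int_2pi_minus: "cos ((real k - real l) * (2 * pi - t)) = cos ((real k - real l) * t)"
proof -
  have eq: "(real k - real l) * (2 * pi - t) = (2 * pi) * real_of_int (int k - int l) - (real k - real l) * t"
    by (simp add: algebra_simps)
  show ?thesis unfolding eq cos_diff by (simp only: cos_int_2pin sin_int_2pin mult_zero_left mult_1 add_0_right)
qed

lemma kernel_2pi_minus: "kernel c n (2 * pi - t) = kernel c n t"
  unfolding kernel_eq_sum by (simp only: cos_int_2pi_minus)

text \<open>
  The symmetry that reduces \<open>[0, 2 \<pi>]\<close> to \<open>[0, \<pi>]\<close>, where the window contains no multiple of \<open>2 \<pi>\<close> except possibly \<open>0\<close>.
\<close>

lemma zero_density_2pi_minus: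
  assumes "0 < \<alpha>"
  shows "zero_density \<alpha> n (2 * pi - x) = zero_density \<alpha> n x"
proof -
  have I: "integral {2 * pi - x - \<alpha>..2 * pi - x + \<alpha>} (kernel c n) = window \<alpha> x (kernel c n)" for c
    unfolding kernel_integral[OF assms] by (simp only: cos_int_2pi_minus)
  have d: "fejer n (2 * pi - x + \<alpha>) = fejer n (x - \<alpha>)" "fejer n (2 * pi - x - \<alpha>) = fejer n (x + \<alpha>)"
    using kernel_2pi_minus[of "\<lambda>_. 1" n "x - \<alpha>"] kernel_2pi_minus[of "\<lambda>_. 1" n "x + \<alpha>"] by (simp_all add: algebra_simps)
  have sq: "((a - b) / c)\<^sup>2 = ((b - a) / c)\<^sup>2" for a b c :: real by (simp add: power_divide power2_commute)
  show ?thesis unfolding zero_density_def I d by (subst sq) (rule refl)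
qed

lemma zero_density_measurable:
  assumes "0 < \<alpha>"
  shows "zero_density \<alpha> n \<in> borel_measurable borel"
proof -
  have [measurable]: "kernel c n \<in> borel_measurable borel" for c
    by (intro borel_measurable_continuous_onI kernel_cont)
  show ?thesis unfolding zero_density_def[abs_def] kernel_integral[OF assms] by measurable
qed

lemma fejer_integral_pos:
  assumes \<alpha>: "0 < \<alpha>" "\<alpha> < pi" and n: "2 * pi / \<alpha> \<le> real n" and x: "x \<in> {0..2 * pi}"
  shows "0 < window \<alpha> x (fejer n)"
proof (cases "x \<le> pi")
  case True
  then show ?thesis using fejer'_integral_le(2)[OF \<alpha> n, of x] x by simp
next
  case False
  then have "0 < integral {2 * pi - x - \<alpha>..2 * pi - x + \<alpha>} (fejer n)"
    using fejer'_integral_le(2)[OF \<alpha> n, of "2 * pi - x"] x by simp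
  then show ?thesis unfolding kernel_integral[OF \<alpha>(1)] by (simp only: cos_int_2pi_minus)
qed

lemma zero_density_bounded:
  assumes \<alpha>: "0 < \<alpha>" "\<alpha> < pi"
  obtains B where "\<And>n x. 2 * pi / \<alpha> \<le> real n \<Longrightarrow> x \<in> {0..2 * pi} \<Longrightarrow> zero_density \<alpha> n x / real n \<le> B"
proof -
  define K where "K = 8 / ((cos ((pi + \<alpha>) / 4))\<^sup>2)\<^sup>2 + 2 * pi\<^sup>2"
  have half: "zero_density \<alpha> n x / real n \<le> sqrt K / pi" if n: "2 * pi / \<alpha> \<le> real n" and x: "x \<in> {0..pi}" for n x
  proof -
    have n0: "0 < n" using n \<alpha> by (cases n) (auto simp: divide_le_0_iff)
    let ?V = "window \<alpha> x (fejer n)" and ?A = "window \<alpha> x (fejer' n)"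
    have V: "0 < ?V" by (rule fejer'_integral_le(2)[OF \<alpha> n x])
    have "?A \<le> K * ((real n)\<^sup>2 * ?V)" using fejer'_integral_le(1)[OF \<alpha> n x] by (simp add: K_def mult.assoc)
    then have "?A / ((real n)\<^sup>2 * ?V) \<le> K" using V n0 by (subst pos_divide_le_eq) auto
    then have "?A / ((real n)\<^sup>2 * ?V) - ((fejer n (x + \<alpha>) - fejer n (x - \<alpha>)) / (2 * (real n * ?V)))\<^sup>2 \<le> K"
      using zero_le_power2[of "(fejer n (x + \<alpha>) - fejer n (x - \<alpha>)) / (2 * (real n * ?V))"] by linarith
    then show ?thesis unfolding zero_density_over_n[OF n0] by (intro divide_right_mono real_sqrt_le_mono) auto
  qed
  show thesis
  proof (rule that[of "sqrt K / pi"])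
    fix n x assume n: "2 * pi / \<alpha> \<le> real n" and x: "x \<in> {0..2 * pi}"
    show "zero_density \<alpha> n x / real n \<le> sqrt K / pi"
      using half[OF n, of x] half[OF n, of "2 * pi - x"] zero_density_2pi_minus[OF \<alpha>(1), of n x] x by (cases "x \<le> pi") auto
  qed
qed

text \<open>
  Dominated convergence. The limit is \<open>1 / (\<pi> sqrt 3)\<close> where the window around \<open>x\<close> contains a multiple of \<open>2 \<pi>\<close>
  in its interior and \<open>1 / (\<pi> sqrt 2)\<close> where the closed window contains none.
\<close>

lemma zero_density_integral_tendsto:
  assumes \<alpha>: "0 < \<alpha>" "\<alpha> < pi"
    and nonneg: "\<And>n x. 2 * pi / \<alpha> \<le> real n \<Longrightarrow> x \<in> {0..2 * pi} \<Longrightarrow> 0 \<le> zero_density \<alpha> n x"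
  shows "(\<lambda>n. (LINT x:{0..2 * pi}|lborel. zero_density \<alpha> n x) / real n)
     \<longlonglongrightarrow> (2 * pi - 2 * \<alpha>) / (pi * sqrt 2) + 2 * \<alpha> / (pi * sqrt 3)"
proof -
  obtain B where B: "\<And>n x. 2 * pi / \<alpha> \<le> real n \<Longrightarrow> x \<in> {0..2 * pi} \<Longrightarrow> zero_density \<alpha> n x / real n \<le> B"
    using zero_density_bounded[OF \<alpha>] by blast
  obtain N where N: "2 * pi / \<alpha> \<le> real N" using real_arch_simple by blast
  define L where "L = (\<lambda>x. 1 / (pi * sqrt 3) * indicator {0..\<alpha>} x + 1 / (pi * sqrt 2) * indicator {\<alpha><..<2 * pi - \<alpha>} x
     + 1 / (pi * sqrt 3) * indicat_real {2 * pi - \<alpha>..2 * pi} x)"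
  have [measurable]: "zero_density \<alpha> n \<in> borel_measurable borel" for n by (rule zero_density_measurable[OF \<alpha>(1)])
  have pt: "(\<lambda>n. zero_density \<alpha> n x / real n) \<longlonglongrightarrow> L x"
    if x: "x \<in> {0..2 * pi}" "x \<noteq> 0" "x \<noteq> \<alpha>" "x \<noteq> pi" "x \<noteq> 2 * pi - \<alpha>" "x \<noteq> 2 * pi" for x
  proof -
    have half: "(\<lambda>n. zero_density \<alpha> n y / real n) \<longlonglongrightarrow> L y" if "0 < y" "y < pi" "y \<noteq> \<alpha>" for y
    proof (cases "y < \<alpha>")
      case True
      then have "L y = 1 / (pi * sqrt 3)" using that \<alpha> by (simp add: L_def indicator_def)
      then show ?thesis using zero_density_tendsto_inside[OF \<alpha>(2) that(1) True] by simp
    next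
      case False
      then have "L y = 1 / (pi * sqrt 2)" using that \<alpha> by (simp add: L_def indicator_def)
      then show ?thesis using zero_density_tendsto_outside[OF \<alpha>(1) _ that(2)] that False by simp
    qed
    show ?thesis
    proof (cases "x < pi")
      case True
      then show ?thesis using half[of x] x by auto
    next
      case False
      then have "(\<lambda>n. zero_density \<alpha> n (2 * pi - x) / real n) \<longlonglongrightarrow> L (2 * pi - x)" using x by (intro half) auto
      moreover have "L (2 * pi - x) = L x" using x False \<alpha> by (auto simp: L_def indicator_def)
      ultimately show ?thesis by (simp add: zero_density_2pi_minus[OF \<alpha>(1)])
    qed
  qed
  have "(\<lambda>n. LINT x|lborel. indicator {0..2 * pi} x * (zero_density \<alpha> (n + N) x / real (n + N))) \<longlonglongrightarrow> (LINT x|lborel. L x)"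
  proof (rule integral_dominated_convergence)
    show "integrable lborel (\<lambda>x. indicator {0..2 * pi} x * B)" by (intro integrable_mult_left) simp
    show "AE x in lborel. norm (indicator {0..2 * pi} x * (zero_density \<alpha> (n + N) x / real (n + N))) \<le> indicator {0..2 * pi} x * B" for n
    proof (rule AE_I2)
      fix x
      have "2 * pi / \<alpha> \<le> real (n + N)" using N by simp
      then show "norm (indicator {0..2 * pi} x * (zero_density \<alpha> (n + N) x / real (n + N))) \<le> indicator {0..2 * pi} x * B"
        using nonneg[of "n + N" x] B[of "n + N" x] by (auto simp: indicator_def)
    qed
    have "AE x in lborel. x \<noteq> 0 \<and> x \<noteq> \<alpha> \<and> x \<noteq> pi \<and> x \<noteq> 2 * pi - \<alpha> \<and> x \<noteq> 2 * pi"
      by (intro AE_conjI AE_lborel_singleton)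
    then show "AE x in lborel. (\<lambda>n. indicator {0..2 * pi} x * (zero_density \<alpha> (n + N) x / real (n + N))) \<longlonglongrightarrow> L x"
    proof eventually_elim
      case (elim x)
      show ?case
      proof (cases "x \<in> {0..2 * pi}")
        case True
        then show ?thesis using LIMSEQ_ignore_initial_segment[OF pt[OF True], of N] elim by simp
      next
        case False
        then have "L x = 0" using \<alpha> by (auto simp: L_def indicator_def)
        then show ?thesis using False by simp
      qed
    qed
  qed (simp_all add: L_def)
  also have "(LINT x|lborel. L x) = 1 / (pi * sqrt 3) * \<alpha> + 1 / (pi * sqrt 2) * (2 * pi - \<alpha> - \<alpha>) + 1 / (pi * sqrt 3) * \<alpha>"
    unfolding L_def using \<alpha>
    by (subst Bochner_Integration.integral_add; (intro Bochner_Integration.integrable_add integrable_mult_right)?; simp)+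
  also have "\<dots> = (2 * pi - 2 * \<alpha>) / (pi * sqrt 2) + 2 * \<alpha> / (pi * sqrt 3)" by (simp add: add_divide_distrib diff_divide_distrib)
  finally have "(\<lambda>n. (LINT x:{0..2 * pi}|lborel. zero_density \<alpha> (n + N) x) / real (n + N))
     \<longlonglongrightarrow> (2 * pi - 2 * \<alpha>) / (pi * sqrt 2) + 2 * \<alpha> / (pi * sqrt 3)"
    by (simp add: set_lebesgue_integral_def)
  then show ?thesis by (rule LIMSEQ_offset)
qed

section \<open>The random trigonometric polynomial\<close>

lemma sum_times_bool: "(\<Sum>i\<in>A \<times> UNIV. f i) = (\<Sum>k\<in>A. f (k, False) + f (k, True))"
proof -
  have "(\<Sum>i\<in>A \<times> UNIV. f i) = (\<Sum>k\<in>A. \<Sum>b\<in>UNIV. f (k, b))" by (simp add: sum.cartesian_product)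
  then show ?thesis by (simp add: UNIV_bool)
qed

context
  fixes M :: "'a measure" and \<rho> :: "int \<Rightarrow> real" and a b :: "nat \<Rightarrow> 'a \<Rightarrow> real" and \<alpha> :: real
  assumes \<alpha>: "0 < \<alpha>" "\<alpha> < pi"
    and \<rho>: "\<And>k. \<rho> k = (if k = 0 then 1 else sin (of_int k * \<alpha>) / (of_int k * \<alpha>))"
    and M: "prob_space M"
    and a: "centered_stationary_gaussian M \<rho> a" and b: "centered_stationary_gaussian M \<rho> b"
    and indep: "independent_sequences M a b"
begin

text \<open>
  The pair \<open>(k, False)\<close> indexes the cosine of frequency \<open>k\<close> with coefficient \<open>a k\<close>, the pair \<open>(k, True)\<close> the sine with
  coefficient \<open>b k\<close>.
\<close>

definition coef :: "nat \<times> bool \<Rightarrow> 'a \<Rightarrow> real" where "coef i = (if snd i then b (fst i) else a (fst i))"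
definition coef_cov :: "nat \<times> bool \<Rightarrow> nat \<times> bool \<Rightarrow> real" where
  "coef_cov i j = (if snd i = snd j then sinc_corr \<alpha> (real (fst i) - real (fst j)) else 0)"
definition mode :: "nat \<times> bool \<Rightarrow> real \<Rightarrow> real" where
  "mode i x = (if snd i then sin (real (fst i) * x) else cos (real (fst i) * x))"
definition mode' :: "nat \<times> bool \<Rightarrow> real \<Rightarrow> real" where
  "mode' i x = (if snd i then real (fst i) * cos (real (fst i) * x) else - (real (fst i) * sin (real (fst i) * x)))"
definition mode'' :: "nat \<times> bool \<Rightarrow> real \<Rightarrow> real" where
  "mode'' i x = - ((real (fst i))\<^sup>2 * mode i x)"

lemma quadratic_form_bool:
  "(\<Sum>i\<in>{1..n} \<times> UNIV. \<Sum>j\<in>{1..n} \<times> UNIV. u i * w j * coef_cov i j)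
   = (\<Sum>k=1..n. \<Sum>l=1..n. (u (k, False) * w (l, False) + u (k, True) * w (l, True)) * sinc_corr \<alpha> (real k - real l))"
  unfolding sum_times_bool by (intro sum.cong refl) (simp add: coef_cov_def sum.distrib algebra_simps)

lemma sum_mode_mode:
  "(\<Sum>i\<in>{1..n} \<times> UNIV. \<Sum>j\<in>{1..n} \<times> UNIV. mode i x * mode j x * coef_cov i j) = window \<alpha> x (fejer n) / (2 * \<alpha>)"
proof -
  have "(mode (k, False) x * mode (l, False) x + mode (k, True) x * mode (l, True) x) * sinc_corr \<alpha> (real k - real l)
    = 1 * 1 * (sinc_corr \<alpha> (real k - real l) * cos ((real k - real l) * x))" for k l
    by (simp add: mode_def left_diff_distrib[of _ _ x] cos_diff)
  then show ?thesis unfolding quadratic_form_bool kernel_integral[OF \<alpha>(1)] using \<alpha>(1) by (simp only:) simp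
qed

lemma sum_mode'_mode':
  "(\<Sum>i\<in>{1..n} \<times> UNIV. \<Sum>j\<in>{1..n} \<times> UNIV. mode' i x * mode' j x * coef_cov i j) = window \<alpha> x (fejer' n) / (2 * \<alpha>)"
proof -
  have "(mode' (k, False) x * mode' (l, False) x + mode' (k, True) x * mode' (l, True) x) * sinc_corr \<alpha> (real k - real l)
    = real k * real l * (sinc_corr \<alpha> (real k - real l) * cos ((real k - real l) * x))" for k l
    by (simp add: mode'_def left_diff_distrib[of _ _ x] cos_diff algebra_simps)
  then show ?thesis unfolding quadratic_form_bool kernel_integral[OF \<alpha>(1)] using \<alpha>(1) by (simp only:) simp
qed

lemma sum_mode_mode':
  "(\<Sum>i\<in>{1..n} \<times> UNIV. \<Sum>j\<in>{1..n} \<times> UNIV. mode i x * mode' j x * coef_cov i j) = (fejer n (x + \<alpha>) - fejer n (x - \<alpha>)) / (4 * \<alpha>)"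
proof -
  have "(mode (k, False) x * mode' (l, False) x + mode (k, True) x * mode' (l, True) x) * sinc_corr \<alpha> (real k - real l)
    = real l * (sinc_corr \<alpha> (real k - real l) * sin ((real k - real l) * x))" for k l
    by (simp add: mode_def mode'_def left_diff_distrib[of _ _ x] sin_diff algebra_simps)
  then show ?thesis unfolding quadratic_form_bool by (simp only: sinc_corr_cross_sum[OF \<alpha>(1)])
qed

text \<open>
  The bound on \<open>n\<close> comes from \<open>fejer_integral_pos\<close>, which makes the variance positive on \<open>[0, 2 \<pi>]\<close>.
\<close>

lemma trig_poly_gaussian_field:
  assumes n: "2 * pi / \<alpha> \<le> real n"
  shows "gaussian_field M ({1..n} \<times> UNIV) coef coef_cov mode mode' mode'' 0 (2 * pi)"
proof -
  interpret prob_space M by (rule M)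
  show ?thesis
  proof unfold_locales
    show "finite ({1..n} \<times> (UNIV :: bool set))" by simp
    fix c :: "nat \<times> bool \<Rightarrow> real"
    have rho: "\<rho> \<bar>int k - int l\<bar> = sinc_corr \<alpha> (real k - real l)" for k l
      using sinc_corr_minus[of \<alpha> "real k - real l"] by (cases "l \<le> k") (simp_all add: \<rho> sinc_corr_def abs_if)
    have sub: "finite {1..n}" "{1..n} \<subseteq> {1..}" by auto
    have "centered_normal (\<lambda>\<omega>. (\<Sum>k=1..n. c (k, False) * a k \<omega>) + (\<Sum>k=1..n. c (k, True) * b k \<omega>))
      ((\<Sum>k=1..n. \<Sum>l=1..n. c (k, False) * c (l, False) * \<rho> \<bar>int k - int l\<bar>)
        + (\<Sum>k=1..n. \<Sum>l=1..n. c (k, True) * c (l, True) * \<rho> \<bar>int k - int l\<bar>))"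
      by (intro centered_normal_add indep_linear_combinations[OF indep sub] centered_normal_linear_combination[OF _ sub] a b)
    moreover have "(\<Sum>i\<in>{1..n} \<times> UNIV. c i * coef i \<omega>) = (\<Sum>k=1..n. c (k, False) * a k \<omega>) + (\<Sum>k=1..n. c (k, True) * b k \<omega>)" for \<omega>
      unfolding sum_times_bool by (simp add: coef_def sum.distrib)
    moreover have "(\<Sum>i\<in>{1..n} \<times> UNIV. \<Sum>j\<in>{1..n} \<times> UNIV. c i * c j * coef_cov i j)
      = (\<Sum>k=1..n. \<Sum>l=1..n. c (k, False) * c (l, False) * \<rho> \<bar>int k - int l\<bar>)
        + (\<Sum>k=1..n. \<Sum>l=1..n. c (k, True) * c (l, True) * \<rho> \<bar>int k - int l\<bar>)"
      unfolding quadratic_form_bool rho by (simp add: distrib_right sum.distrib)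
    ultimately show "centered_normal (\<lambda>\<omega>. \<Sum>i\<in>{1..n} \<times> UNIV. c i * coef i \<omega>) (\<Sum>i\<in>{1..n} \<times> UNIV. \<Sum>j\<in>{1..n} \<times> UNIV. c i * c j * coef_cov i j)"
      by simp
  next
    fix i j :: "nat \<times> bool" and x
    show "coef_cov i j = coef_cov j i"
      using sinc_corr_minus[of \<alpha> "real (fst i) - real (fst j)"] by (simp add: coef_cov_def)
    show "(mode i has_real_derivative mode' i x) (at x)"
      unfolding mode_def[abs_def] mode'_def by (cases "snd i") (auto intro!: derivative_eq_intros)
    show "(mode' i has_real_derivative mode'' i x) (at x)"
      unfolding mode_def[abs_def] mode'_def[abs_def] mode''_def
      by (cases "snd i") (auto intro!: derivative_eq_intros simp: power2_eq_square)
    show "continuous_on UNIV (mode'' i)"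
      unfolding mode_def[abs_def] mode''_def[abs_def] by (cases "snd i") (auto intro!: continuous_intros)
  next
    show "0 < (\<Sum>i\<in>{1..n} \<times> UNIV. \<Sum>j\<in>{1..n} \<times> UNIV. mode i x * mode j x * coef_cov i j)" if "x \<in> {0..2 * pi}" for x
      unfolding sum_mode_mode using fejer_integral_pos[OF \<alpha> n that] \<alpha> by simp
  qed simp
qed

lemma expected_zeros:
  assumes n: "2 * pi / \<alpha> \<le> real n"
  shows "(\<integral>\<^sup>+ \<omega>. zero_count (trig_poly a b n \<omega>) 0 (2 * pi) \<partial>M) = ennreal (LINT x:{0..2 * pi}|lborel. zero_density \<alpha> n x)"
    and "x \<in> {0..2 * pi} \<Longrightarrow> 0 \<le> zero_density \<alpha> n x"
proof -
  have n0: "0 < n" using n \<alpha> by (cases n) (auto simp: divide_le_0_iff)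
  interpret G: gaussian_field M "{1..n} \<times> UNIV" coef coef_cov mode mode' mode'' 0 "2 * pi"
    by (rule trig_poly_gaussian_field[OF n])
  have intensity: "G.intensity x = zero_density \<alpha> n x" if "x \<in> {0..2 * pi}" for x
  proof -
    define V A d where "V = window \<alpha> x (fejer n)" and "A = window \<alpha> x (fejer' n)"
      and "d = fejer n (x + \<alpha>) - fejer n (x - \<alpha>)"
    have V: "0 < V" unfolding V_def by (rule fejer_integral_pos[OF \<alpha> n that])
    have "G.intensity x = sqrt (V / (2 * \<alpha>) * (A / (2 * \<alpha>)) - (d / (4 * \<alpha>))\<^sup>2) / (pi * (V / (2 * \<alpha>)))"
      unfolding G.intensity_def G.cov_def sum_mode_mode sum_mode'_mode' sum_mode_mode' V_def A_def d_def ..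
    also have "V / (2 * \<alpha>) * (A / (2 * \<alpha>)) - (d / (4 * \<alpha>))\<^sup>2 = (V / (2 * \<alpha>))\<^sup>2 * (A / V - (d / (2 * V))\<^sup>2)"
      using V \<alpha> by (simp add: field_simps power2_eq_square)
    also have "sqrt \<dots> = (V / (2 * \<alpha>)) * sqrt (A / V - (d / (2 * V))\<^sup>2)"
      using V \<alpha> by (simp add: real_sqrt_mult)
    also have "\<dots> / (pi * (V / (2 * \<alpha>))) = sqrt (A / V - (d / (2 * V))\<^sup>2) / pi" using V \<alpha> by simp
    finally show ?thesis by (simp add: zero_density_def V_def A_def d_def)
  qed
  have "zero_count (trig_poly a b n \<omega>) 0 (2 * pi) = zero_count (G.F \<omega>) 0 (2 * pi)" for \<omega>
  proof -
    have "trig_poly a b n \<omega> t = 1 / sqrt (real n) * G.F \<omega> t" for t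
      unfolding trig_poly_def G.F_def sum_times_bool by (simp add: mode_def coef_def mult.commute)
    then have "trig_poly a b n \<omega> t = 0 \<longleftrightarrow> G.F \<omega> t = 0" for t using n0 by simp
    then show ?thesis by (simp add: zero_count_def)
  qed
  then have "(\<integral>\<^sup>+ \<omega>. zero_count (trig_poly a b n \<omega>) 0 (2 * pi) \<partial>M) = ennreal (LINT x:{0..2 * pi}|lborel. G.intensity x)"
    by (simp only: G.expected_zero_count)
  also have "(LINT x:{0..2 * pi}|lborel. G.intensity x) = (LINT x:{0..2 * pi}|lborel. zero_density \<alpha> n x)"
    by (rule set_lebesgue_integral_cong) (simp_all add: intensity del: One_nat_def)
  finally show "(\<integral>\<^sup>+ \<omega>. zero_count (trig_poly a b n \<omega>) 0 (2 * pi) \<partial>M) = ennreal (LINT x:{0..2 * pi}|lborel. zero_density \<alpha> n x)" .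
  show "x \<in> {0..2 * pi} \<Longrightarrow> 0 \<le> zero_density \<alpha> n x" using G.intensity_nonneg[of x] intensity[of x] by (simp only:)
qed

end

theorem corollary1p1:
  fixes M :: "'a measure"
    and \<mu> :: "real measure"
    and \<rho> :: "int \<Rightarrow> real"
    and a b :: "nat \<Rightarrow> 'a \<Rightarrow> real"
    and \<alpha> :: real
  assumes "0 < \<alpha>" and "\<alpha> < pi"
    and "spectral_measure \<mu> \<rho>"
    and "\<And>k. \<rho> k = (if k = 0 then 1 else sin (of_int k * \<alpha>) / (of_int k * \<alpha>))"
    and "prob_space M"
    and "centered_stationary_gaussian M \<rho> a"
    and "centered_stationary_gaussian M \<rho> b"
    and "independent_sequences M a b"
  shows "(\<lambda>n. (\<integral>\<^sup>+ \<omega>. zero_count (trig_poly a b n \<omega>) 0 (2 * pi) \<partial>M) / of_nat n)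
           \<longlonglongrightarrow> ennreal ((2 * pi - 2 * \<alpha>) / (pi * sqrt 2) + 2 * \<alpha> / (pi * sqrt 3))"
proof -
  note zeros = expected_zeros[OF assms(1,2,4-8)]
  have "(\<lambda>n. ennreal ((LINT x:{0..2 * pi}|lborel. zero_density \<alpha> n x) / real n))
      \<longlonglongrightarrow> ennreal ((2 * pi - 2 * \<alpha>) / (pi * sqrt 2) + 2 * \<alpha> / (pi * sqrt 3))"
    by (intro tendsto_ennrealI zero_density_integral_tendsto assms(1,2) zeros(2))
  then show ?thesis
  proof (rule Lim_transform_eventually)
    obtain N where N: "2 * pi / \<alpha> \<le> real N" using real_arch_simple by blast
    have "\<forall>\<^sub>F n in sequentially. 2 * pi / \<alpha> \<le> real n"
      by (rule eventually_sequentiallyI[of N]) (rule order.trans[OF N], simp)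
    then show "\<forall>\<^sub>F n in sequentially. ennreal ((LINT x:{0..2 * pi}|lborel. zero_density \<alpha> n x) / real n)
        = (\<integral>\<^sup>+ \<omega>. zero_count (trig_poly a b n \<omega>) 0 (2 * pi) \<partial>M) / of_nat n"
      using eventually_gt_at_top[of 0]
    proof eventually_elim
      case (elim n)
      have "0 \<le> (LINT x:{0..2 * pi}|lborel. zero_density \<alpha> n x)"
        unfolding set_lebesgue_integral_def using zeros(2)[OF elim(1)]
        by (intro Bochner_Integration.integral_nonneg) (simp add: indicator_def)
      then show ?case using elim(2) by (simp add: zeros(1)[OF elim(1)] ennreal_of_nat_eq_real_of_nat divide_ennreal)
    qed
  qed
qed

end
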